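(* Fix projective cameras $A,B,C$. The multi-view varieties $X_{A,B,C}^{PLL}, X_{A,B,C}^{LLL}, X_{A,B,C}^{PPL}, X_{A,B,C}^{PLP}, X_{A,B,C}^{PPP}$ are irreducible. If $A,B,C$ have linearly independent centers in $\mathbb{P}^{3}$, then the varieties have the following dimensions and multi-homogeneous prime ideals. \begin{itemize} \item $\dim(X_{A,B,C}^{PLL}) = 5$ and $I(X_{A,B,C}^{PLL}) = \langle T_{A,B,C}(x, \ell', \ell'') \rangle \subset \mathbb{C}[x_{i}, \ell'_{j}, \ell''_{k}]$. \item $\dim(X_{A,B,C}^{LLL}) = 4$ and $I(X_{A,B,C}^{LLL}) \subset \mathbb{C}[\ell_{i}, \ell'_{j}, \ell''_{k}]$ is generated by the maximal minors of the $4\times 3$ matrix $\begin{pmatrix} A^{T} \ell & B^{T} \ell' & C^{T} \ell'' \end{pmatrix}$. \item $\dim(X_{A,B,C}^{PPL}) = 4$ and $I(X_{A,B,C}^{PPL}) \subset \mathbb{C}[x_{i}, x'_{j}, \ell''_{k}]$ is generated by the maximal minors of the $7\times 6$ matrix $\begin{pmatrix} A & x & 0 \\ B & 0 & x' \\ \ell''^{T}C & 0 & 0 \end{pmatrix}$. \item $\dim(X_{A,B,C}^{PLP}) = 4$ and $I(X_{A,B,C}^{PLP}) \subset \mathbb{C}[x_{i}, \ell'_{j}, x''_{k}]$ is generated by the maximal minors of the $7\times 6$ matrix $\begin{pmatrix} A & x & 0 \\ C & 0 & x'' \\ \ell'^{T}B & 0 & 0 \end{pmatrix}$. \item $\dim(X_{A,B,C}^{PPP})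 = 3$ and $I(X_{A,B,C}^{PPP}) \subset \mathbb{C}[x_{i}, x'_{j}, x''_{k}]$ is generated by the maximal minors of the $9\times 7$ matrix $\begin{pmatrix} A & x & 0 & 0 \\ B & 0 & x' & 0 \\ C & 0 & 0 & x'' \end{pmatrix}$ together with the three $6\times 6$ determinants $\det \begin{pmatrix} A & x & 0 \\ B & 0 & x' \end{pmatrix}$, $\det \begin{pmatrix} A & x & 0 \\ C & 0 & x'' \end{pmatrix}$ and $\det \begin{pmatrix} B & x' & 0 \\ C & 0 & x'' \end{pmatrix}$. \end{itemize}
   Context: A projective camera is a full rank $3\times 4$ complex matrix defined up to nonzero scalar; its center is $\ker(A)\in\mathbb{P}^3$. Let $A,B,C$ be projective cameras with linear projections $\alpha:\mathbb{P}^3\dashrightarrow\mathbb{P}^2_A$, $\beta:\mathbb{P}^3\dashrightarrow\mathbb{P}^2_B$, $\gamma:\mathbb{P}^3\dashrightarrow\mathbb{P}^2_C$. Let $\mathcal{F\ell}_{0,1}=\{(X,L)\in\mathbb{P}^3\times\mathrm{Gr}(\mathbb{P}^1,\mathbb{P}^3): X\in L\}$. The multi-view varieties are the Zariski closures of the images of: $X^{PLL}_{A,B,C}$: $\mathcal{F\ell}_{0,1}\dashrightarrow \mathbb{P}^2_A\times(\mathbb{P}^2_B)^\vee\times(\mathbb{P}^2_C)^\vee$, $(X,L)\mapsto(\alpha(X),\beta(L),\gamma(L))$; $X^{LLL}_{A,B,C}$: $\mathrm{Gr}(\mathbb{P}^1,\mathbb{P}^3)\dashrightarrow (\mathbb{P}^2_A)^\vee\times(\mathbb{P}^2_B)^\vee\times(\mathbb{P}^2_C)^\vee$,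 $L\mapsto(\alpha(L),\beta(L),\gamma(L))$; $X^{PPL}_{A,B,C}$: $\mathcal{F\ell}_{0,1}\dashrightarrow\mathbb{P}^2_A\times\mathbb{P}^2_B\times(\mathbb{P}^2_C)^\vee$, $(X,L)\mapsto(\alpha(X),\beta(X),\gamma(L))$; $X^{PLP}_{A,B,C}$: $\mathcal{F\ell}_{0,1}\dashrightarrow\mathbb{P}^2_A\times(\mathbb{P}^2_B)^\vee\times\mathbb{P}^2_C$, $(X,L)\mapsto(\alpha(X),\beta(L),\gamma(X))$; $X^{PPP}_{A,B,C}$: $\mathbb{P}^3\dashrightarrow\mathbb{P}^2_A\times\mathbb{P}^2_B\times\mathbb{P}^2_C$, $X\mapsto(\alpha(X),\beta(X),\gamma(X))$. Here $x,x',x''$ denote image points in $\mathbb{P}^2_A,\mathbb{P}^2_B,\mathbb{P}^2_C$ and $\ell,\ell',\ell''$ image lines in the dual planes. The trifocal tensor $T_{A,B,C}\in\mathbb{C}^{3\times3\times3}$ has entries $(T_{A,B,C})_{ijk}=(-1)^{i+1}\det$ of the $4\times4$ matrix whose rows are the two rows of $A$ other than the $i$-th, the $j$-th row of $B$, and the $k$-th row of $C$; and $T_{A,B,C}(x,\ell',\ell'')=\sum_{i,j,k}(T_{A,B,C})_{ijk}x_i\ell'_j\ell''_k$. *)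

theory Defs
  imports "HOL-Analysis.Analysis" "HOL-Library.Poly_Mapping" "HOL-Library.Extended_Nat"
begin

text \<open>A projective camera: a full-rank 3x4 complex matrix (up to scalar, which is irrelevant below).\<close>
definition camera :: "complex^4^3 \<Rightarrow> bool" where
  "camera A \<longleftrightarrow> rank A = 3"

definition indep_centers :: "complex^4^3 \<Rightarrow> complex^4^3 \<Rightarrow> complex^4^3 \<Rightarrow> bool" where
  "indep_centers A B C \<longleftrightarrow>
     (\<forall>a b c. a \<noteq> 0 \<and> b \<noteq> 0 \<and> c \<noteq> 0 \<and> A *v a = 0 \<and> B *v b = 0 \<and> C *v c = 0 \<longrightarrow>
        (\<forall>s t u. s *s a + t *s b + u *s c = 0 \<longrightarrow> s = 0 \<and> t = 0 \<and> u = 0))"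

text \<open>Cross product on complex 3-vectors: the dual coordinates of the line through two image points.\<close>
definition cross3c :: "complex^3 \<Rightarrow> complex^3 \<Rightarrow> complex^3" where
  "cross3c u v = vector [u$2 * v$3 - u$3 * v$2, u$3 * v$1 - u$1 * v$3, u$1 * v$2 - u$2 * v$1]"

definition indep2 :: "complex^4 \<Rightarrow> complex^4 \<Rightarrow> bool" where
  "indep2 P Q \<longleftrightarrow> (\<forall>s t. s *s P + t *s Q = 0 \<longrightarrow> s = 0 \<and> t = 0)"

type_synonym pt = "(complex^3) \<times> (complex^3) \<times> (complex^3)"

text \<open>A line L in P^3 is span(P,Q) with P,Q independent; its image under camera B is the
  line with dual coordinates cross3c (B P) (B Q), defined iff this is nonzero.\<close>

definition img_PLL :: "complex^4^3 \<Rightarrow> complex^4^3 \<Rightarrow> complex^4^3 \<Rightarrow> pt set" where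
  "img_PLL A B C = {(A *v X, cross3c (B *v P) (B *v Q), cross3c (C *v P) (C *v Q)) | X P Q.
      indep2 P Q \<and> (\<exists>s t. X = s *s P + t *s Q) \<and> A *v X \<noteq> 0 \<and>
      cross3c (B *v P) (B *v Q) \<noteq> 0 \<and> cross3c (C *v P) (C *v Q) \<noteq> 0}"

definition img_LLL :: "complex^4^3 \<Rightarrow> complex^4^3 \<Rightarrow> complex^4^3 \<Rightarrow> pt set" where
  "img_LLL A B C = {(cross3c (A *v P) (A *v Q), cross3c (B *v P) (B *v Q), cross3c (C *v P) (C *v Q)) | P Q.
      indep2 P Q \<and> cross3c (A *v P) (A *v Q) \<noteq> 0 \<and>
      cross3c (B *v P) (B *v Q) \<noteq> 0 \<and> cross3c (C *v P) (C *v Q) \<noteq> 0}"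

definition img_PPL :: "complex^4^3 \<Rightarrow> complex^4^3 \<Rightarrow> complex^4^3 \<Rightarrow> pt set" where
  "img_PPL A B C = {(A *v X, B *v X, cross3c (C *v P) (C *v Q)) | X P Q.
      indep2 P Q \<and> (\<exists>s t. X = s *s P + t *s Q) \<and> A *v X \<noteq> 0 \<and> B *v X \<noteq> 0 \<and>
      cross3c (C *v P) (C *v Q) \<noteq> 0}"

definition img_PLP :: "complex^4^3 \<Rightarrow> complex^4^3 \<Rightarrow> complex^4^3 \<Rightarrow> pt set" where
  "img_PLP A B C = {(A *v X, cross3c (B *v P) (B *v Q), C *v X) | X P Q.
      indep2 P Q \<and> (\<exists>s t. X = s *s P + t *s Q) \<and> A *v X \<noteq> 0 \<and>
      cross3c (B *v P) (B *v Q) \<noteq> 0 \<and> C *v X \<noteq> 0}"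

definition img_PPP :: "complex^4^3 \<Rightarrow> complex^4^3 \<Rightarrow> complex^4^3 \<Rightarrow> pt set" where
  "img_PPP A B C = {(A *v X, B *v X, C *v X) | X. A *v X \<noteq> 0 \<and> B *v X \<noteq> 0 \<and> C *v X \<noteq> 0}"

type_synonym var = "3 + 3 + 3"
type_synonym mpoly = "((var) \<Rightarrow>\<^sub>0 nat) \<Rightarrow>\<^sub>0 complex"

definition asg :: "pt \<Rightarrow> var \<Rightarrow> complex" where
  "asg p x = (case p of (u, v, w) \<Rightarrow>
     (case x of Inl i \<Rightarrow> u $ i | Inr (Inl j) \<Rightarrow> v $ j | Inr (Inr k) \<Rightarrow> w $ k))"

definition mpeval :: "mpoly \<Rightarrow> pt \<Rightarrow> complex" where
  "mpeval f p = (\<Sum>m\<in>Poly_Mapping.keys f. Poly_Mapping.lookup f m * (\<Prod>x\<in>(UNIV :: var set). asg p x ^ Poly_Mapping.lookup (m :: var \<Rightarrow>\<^sub>0 nat) x))"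

definition pvar :: "var \<Rightarrow> mpoly" where
  "pvar x = Poly_Mapping.single (Poly_Mapping.single x 1) 1"

definition pconst :: "complex \<Rightarrow> mpoly" where
  "pconst c = Poly_Mapping.single 0 c"

definition ideal_gen :: "mpoly set \<Rightarrow> mpoly set" where
  "ideal_gen G = {(\<Sum>g\<in>F. c g * g) | F c. finite F \<and> F \<subseteq> G}"

section \<open>Multiprojective Zariski topology on P^2 x P^2 x P^2 (points given by representatives)\<close>

definition valid_pt :: "pt \<Rightarrow> bool" where
  "valid_pt p \<longleftrightarrow> (case p of (u, v, w) \<Rightarrow> u \<noteq> 0 \<and> v \<noteq> 0 \<and> w \<noteq> 0)"

text \<open>f vanishes at the multiprojective point p: vanishes at every representative.\<close>
definition mvanish :: "mpoly \<Rightarrow> pt \<Rightarrow> bool" where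
  "mvanish f p \<longleftrightarrow> (case p of (u, v, w) \<Rightarrow>
     (\<forall>a b c. a \<noteq> 0 \<and> b \<noteq> 0 \<and> c \<noteq> 0 \<longrightarrow> mpeval f (a *s u, b *s v, c *s w) = 0))"

definition vanI :: "pt set \<Rightarrow> mpoly set" where
  "vanI X = {f. \<forall>p\<in>X. mvanish f p}"

definition Zc :: "mpoly set \<Rightarrow> pt set" where
  "Zc S = {p. valid_pt p \<and> (\<forall>f\<in>S. mvanish f p)}"

definition mp_closed :: "pt set \<Rightarrow> bool" where
  "mp_closed Y \<longleftrightarrow> (\<exists>S. Y = Zc S)"

definition zclosure :: "pt set \<Rightarrow> pt set" where
  "zclosure X = Zc (vanI X)"

definition mp_irreducible :: "pt set \<Rightarrow> bool" where
  "mp_irreducible Y \<longleftrightarrow> Y \<noteq> {} \<and>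
     (\<forall>Z1 Z2. mp_closed Z1 \<and> mp_closed Z2 \<and> Y \<subseteq> Z1 \<union> Z2 \<longrightarrow> Y \<subseteq> Z1 \<or> Y \<subseteq> Z2)"

definition mp_dim :: "pt set \<Rightarrow> enat" where
  "mp_dim Y = Sup {enat n | n. \<exists>Z :: nat \<Rightarrow> pt set.
     (\<forall>i\<le>n. mp_closed (Z i) \<and> mp_irreducible (Z i) \<and> Z i \<subseteq> Y) \<and> (\<forall>i<n. Z i \<subset> Z (Suc i))}"

definition X_PLL where "X_PLL A B C = zclosure (img_PLL A B C)"
definition X_LLL where "X_LLL A B C = zclosure (img_LLL A B C)"
definition X_PPL where "X_PPL A B C = zclosure (img_PPL A B C)"
definition X_PLP where "X_PLP A B C = zclosure (img_PLP A B C)"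
definition X_PPP where "X_PPP A B C = zclosure (img_PPP A B C)"

definition trifocal :: "complex^4^3 \<Rightarrow> complex^4^3 \<Rightarrow> complex^4^3 \<Rightarrow> 3 \<Rightarrow> 3 \<Rightarrow> 3 \<Rightarrow> complex" where
  "trifocal A B C i j k =
     (if i = 1 then det (vector [A$2, A$3, B$j, C$k] :: complex^4^4)
      else if i = 2 then - det (vector [A$1, A$3, B$j, C$k] :: complex^4^4)
      else det (vector [A$1, A$2, B$j, C$k] :: complex^4^4))"

definition trif_poly :: "complex^4^3 \<Rightarrow> complex^4^3 \<Rightarrow> complex^4^3 \<Rightarrow> mpoly" where
  "trif_poly A B C = (\<Sum>i\<in>UNIV. \<Sum>j\<in>UNIV. \<Sum>k\<in>UNIV.
      pconst (trifocal A B C i j k) * pvar (Inl i) * pvar (Inr (Inl j)) * pvar (Inr (Inr k)))"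

text \<open>Maximal minors (up to sign) of a matrix with at least as many rows as columns.\<close>
definition maxminors :: "'a::comm_ring_1^'c^'r \<Rightarrow> 'a set" where
  "maxminors M = {det (\<chi> i. M $ r i) | r :: 'c \<Rightarrow> 'r. inj r}"

definition lll_mat :: "complex^4^3 \<Rightarrow> complex^4^3 \<Rightarrow> complex^4^3 \<Rightarrow> mpoly^3^4" where
  "lll_mat A B C = (\<chi> r c.
     if c = 1 then (\<Sum>i\<in>UNIV. pconst (A$i$r) * pvar (Inl i))
     else if c = 2 then (\<Sum>i\<in>UNIV. pconst (B$i$r) * pvar (Inr (Inl i)))
     else (\<Sum>i\<in>UNIV. pconst (C$i$r) * pvar (Inr (Inr i))))"

definition e4 :: "3 \<Rightarrow> 4" where
  "e4 c = (if c = 1 then 1 else if c = 2 then 2 else 3)"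

text \<open>Column layout for 6 columns (type 3+3): Inl c = camera column c (c=1,2,3),
  Inr 1 = camera column 4, Inr 2 = fifth column, Inr 3 = sixth column.\<close>
definition col6 :: "3 + 3 \<Rightarrow> 4 option" where
  "col6 col = (case col of Inl c \<Rightarrow> Some (e4 c) | Inr c \<Rightarrow> if c = 1 then Some 4 else None)"

definition two_mat :: "complex^4^3 \<Rightarrow> complex^4^3 \<Rightarrow> (3 \<Rightarrow> var) \<Rightarrow> (3 \<Rightarrow> var) \<Rightarrow> mpoly^(3+3)^(3+3)" where
  "two_mat P Q xv yv = (\<chi> row col. case row of
     Inl i \<Rightarrow> (case col6 col of Some k \<Rightarrow> pconst (P$i$k) | None \<Rightarrow> if col = Inr 2 then pvar (xv i) else 0)
   | Inr j \<Rightarrow> (case col6 col of Some k \<Rightarrow> pconst (Q$j$k) | None \<Rightarrow> if col = Inr 3 then pvar (yv j) else 0))"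

definition pl_mat :: "complex^4^3 \<Rightarrow> complex^4^3 \<Rightarrow> complex^4^3 \<Rightarrow> (3 \<Rightarrow> var) \<Rightarrow> (3 \<Rightarrow> var) \<Rightarrow> (3 \<Rightarrow> var)
     \<Rightarrow> mpoly^(3+3)^(3+3+1)" where
  "pl_mat P Q R xv yv lv = (\<chi> row col. case row of
     Inl i \<Rightarrow> (case col6 col of Some k \<Rightarrow> pconst (P$i$k) | None \<Rightarrow> if col = Inr 2 then pvar (xv i) else 0)
   | Inr (Inl j) \<Rightarrow> (case col6 col of Some k \<Rightarrow> pconst (Q$j$k) | None \<Rightarrow> if col = Inr 3 then pvar (yv j) else 0)
   | Inr (Inr _) \<Rightarrow> (case col6 col of Some k \<Rightarrow> (\<Sum>m\<in>UNIV. pvar (lv m) * pconst (R$m$k)) | None \<Rightarrow> 0))"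

text \<open>Column layout for 7 columns (type 3+3+1): Inl c = camera column c, Inr (Inl 1) = camera
  column 4, Inr (Inl 2), Inr (Inl 3), Inr (Inr 1) = columns 5,6,7.\<close>
definition col7 :: "3 + 3 + 1 \<Rightarrow> 4 option" where
  "col7 col = (case col of Inl c \<Rightarrow> Some (e4 c) | Inr (Inl c) \<Rightarrow> if c = 1 then Some 4 else None
                 | Inr (Inr _) \<Rightarrow> None)"

definition three_mat :: "complex^4^3 \<Rightarrow> complex^4^3 \<Rightarrow> complex^4^3 \<Rightarrow> mpoly^(3+3+1)^(3+3+3)" where
  "three_mat A B C = (\<chi> row col. case row of
     Inl i \<Rightarrow> (case col7 col of Some k \<Rightarrow> pconst (A$i$k)
                 | None \<Rightarrow> if col = Inr (Inl 2) then pvar (Inl i) else 0)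
   | Inr (Inl j) \<Rightarrow> (case col7 col of Some k \<Rightarrow> pconst (B$j$k)
                 | None \<Rightarrow> if col = Inr (Inl 3) then pvar (Inr (Inl j)) else 0)
   | Inr (Inr k') \<Rightarrow> (case col7 col of Some k \<Rightarrow> pconst (C$k'$k)
                 | None \<Rightarrow> if col = Inr (Inr 1) then pvar (Inr (Inr k')) else 0))"

end

theory Submission
  imports Defs
begin

text \<open>Choose coordinates of \<open>P^3\<close> in which the three centers are unit vectors and coordinates of the
  image planes in which the cameras forget one coordinate each. In these coordinates every variety has
  a chart, i.e. a polynomial parametrization by \<open>d\<close> of the image coordinates with one coordinate of each
  factor normalised to 1.

  Dimension: if \<open>f_1, \<dots>, f_k\<close> are algebraically independent modulo a prime \<open>Q\<close> and \<open>g\<close> lies in \<open>Q\<close> but not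
  in a smaller prime \<open>P\<close>, then \<open>f_1, \<dots>, f_k, g\<close> are algebraically independent modulo \<open>P\<close>. So a chain of \<open>n + 1\<close>
  irreducible closed sets gives \<open>n + 3\<close> independent polynomials on the cone, and counting monomials
  bounds their number by \<open>d + 3\<close>. Fixing the chart coordinates one by one gives a chain of length \<open>d\<close>.

  Ideals: a weight makes the leading monomials of a few explicit minors squarefree. Modulo these minors
  every polynomial is a combination of standard monomials. Each standard monomial survives on some
  coordinate subspace to which the cone degenerates under the weight, so no nonzero combination of
  standard monomials vanishes on the cone.

  Irreducibility only uses that the images are parametrized by polynomials.\<close>

section \<open>Evaluation and substitution of polynomials\<close>

text \<open>Equality of ideals is claimed, not only of zero sets, and it is not known in advance
  that the minors generate a radical ideal. Squarefree leading monomials settle this: a monomial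
  divisible by none of them omits all variables of some set that meets every one of them, so it is
  visible on the coordinate subspace where that set vanishes. What remains for each variety is to
  reach these subspaces as limits of the cone, and an explicit curve is found by solving the
  equations of the cone for the vanishing coordinates. The number 3 in d + 3 is the dimension of the
  scaling torus: vanishing ideals are studied on the cone in affine 9-space, which is parametrized
  by three scalars together with the chart. A change of basis N of an image plane acts on points by
  N and on lines by the inverse transpose, up to the scalar det N, which the cone absorbs. So both
  the parametrizations and the minors can be moved to normal coordinates and back.\<close>

abbreviation (input) "lookup \<equiv> Poly_Mapping.lookup"
abbreviation (input) "keys \<equiv> Poly_Mapping.keys"
abbreviation (input) "single \<equiv> Poly_Mapping.single"

text \<open>Values lie in an arbitrary commutative ring, so that one set of homomorphism rules
  serves both numerical evaluation (\<open>ev\<close>) and substitution of polynomials for variables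
  (\<open>subst\<close>).\<close>

definition peval :: "(complex \<Rightarrow> 'r::comm_ring_1) \<Rightarrow> (var \<Rightarrow> 'r) \<Rightarrow> mpoly \<Rightarrow> 'r" where
  "peval h v f = (\<Sum>m\<in>keys f. h (lookup f m) * (\<Prod>x\<in>UNIV. v x ^ lookup m x))"

definition scalar_hom :: "(complex \<Rightarrow> 'r::comm_ring_1) \<Rightarrow> bool" where
  "scalar_hom h \<longleftrightarrow> h 0 = 0 \<and> h 1 = 1 \<and> (\<forall>a b. h (a + b) = h a + h b) \<and> (\<forall>a b. h (a * b) = h a * h b)"

lemma sum_single_keys:
  fixes f :: "'a \<Rightarrow>\<^sub>0 'b::comm_monoid_add"
  shows "f = (\<Sum>m\<in>keys f. single m (lookup f m))"
proof (rule poly_mapping_eqI)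
  fix k
  have "(\<Sum>m\<in>keys f. lookup (single m (lookup f m)) k)
      = (\<Sum>m\<in>keys f. if m = k then lookup f m else 0)"
    by (rule sum.cong) (auto simp: lookup_single when_def)
  then show "lookup f k = lookup
      (\<Sum>m\<in>keys f. single m (lookup f m)) k"
    by (simp add: lookup_sum in_keys_iff)
qed

lemma mpoly_induct [case_names single add]:
  assumes "\<And>m c. P (single m c)" and "\<And>f g. P f \<Longrightarrow> P g \<Longrightarrow> P (f + g)"
  shows "P (f :: mpoly)"
proof -
  have 0: "P 0" using assms(1)[of 0 0] by simp
  have "P (\<Sum>m\<in>K. single m (lookup f m))" if "finite K" for K
    using that by (induction K rule: finite_induct) (auto intro: assms 0)
  then show ?thesis by (subst sum_single_keys) simp
qed

context
  fixes h :: "complex \<Rightarrow> 'r::comm_ring_1"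
  assumes h: "scalar_hom h"
begin

lemma peval_superset:
  assumes "finite K" "keys f \<subseteq> K"
  shows "peval h v f = (\<Sum>m\<in>K. h (lookup f m) * (\<Prod>x\<in>UNIV. v x ^ lookup m x))"
  unfolding peval_def using assms h
  by (intro sum.mono_neutral_left) (auto simp: scalar_hom_def in_keys_iff)

lemma peval_single: "peval h v (single m c) = h c * (\<Prod>x\<in>UNIV. v x ^ lookup m x)"
  using peval_superset[of "{m}" "single m c" v] by (simp split: if_splits)

lemma peval_add: "peval h v (f + g) = peval h v f + peval h v g"
proof -
  let ?K = "keys f \<union> keys g"
  have "keys (f + g) \<subseteq> ?K" by (rule Poly_Mapping.keys_add)
  then show ?thesis
    using h by (simp add: peval_superset[of ?K] lookup_add scalar_hom_def sum.distrib distrib_right)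
qed

lemma peval_0: "peval h v 0 = 0"
  by (simp add: peval_def)

lemma peval_mult: "peval h v (f * g) = peval h v f * peval h v g"
proof (induction f rule: mpoly_induct)
  case (single m c)
  show ?case
  proof (induction g rule: mpoly_induct)
    case (single n d)
    show ?case using h
      by (simp add: mult_single peval_single lookup_add power_add prod.distrib scalar_hom_def mult_ac)
  qed (simp add: distrib_left peval_add)
qed (simp add: distrib_right peval_add)

lemma peval_pconst: "peval h v (pconst c) = h c"
  by (simp add: pconst_def peval_single)

lemma peval_pvar: "peval h v (pvar x) = v x"
proof -
  have "(\<Prod>y\<in>UNIV. v y ^ lookup (single x (1::nat)) y) = (\<Prod>y\<in>UNIV. if y = x then v y else 1)"
    by (rule prod.cong) (auto simp: lookup_single when_def)
  then show ?thesis using h by (simp add: pvar_def peval_single scalar_hom_def)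
qed

lemma peval_1: "peval h v 1 = 1"
  using peval_pconst[of v 1] h by (simp add: pconst_def scalar_hom_def)

lemma peval_uminus: "peval h v (- f) = - peval h v f"
  using peval_add[of v f "- f"] by (simp add: peval_0 eq_neg_iff_add_eq_0 add.commute)

lemma peval_diff: "peval h v (f - g) = peval h v f - peval h v g"
  using peval_add[of v f "- g"] by (simp add: peval_uminus)

lemma peval_sum: "peval h v (\<Sum>i\<in>S. f i) = (\<Sum>i\<in>S. peval h v (f i))"
  by (induction S rule: infinite_finite_induct) (auto simp: peval_0 peval_add)

lemma peval_prod: "peval h v (\<Prod>i\<in>S. f i) = (\<Prod>i\<in>S. peval h v (f i))"
  by (induction S rule: infinite_finite_induct) (auto simp: peval_1 peval_mult)

lemma peval_power: "peval h v (f ^ n) = peval h v f ^ n"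
  by (induction n) (auto simp: peval_1 peval_mult)

lemma peval_of_int: "peval h v (of_int n) = of_int n"
proof -
  have nat: "peval h v (of_nat k) = of_nat k" for k
    by (induction k) (auto simp: peval_0 peval_1 peval_add)
  show ?thesis by (cases n) (auto simp: nat peval_uminus peval_diff peval_1)
qed

lemma peval_det: "peval h v (det M) = det (\<chi> i j. peval h v (M $ i $ j))"
  by (simp add: det_def peval_sum peval_mult peval_prod peval_of_int)

lemmas peval_hom = peval_0 peval_1 peval_add peval_mult peval_pconst peval_pvar peval_uminus peval_diff
  peval_sum peval_prod peval_power peval_of_int

end

lemma mpoly_gen_induct [case_names const var add mult]:
  assumes "\<And>c. P (pconst c)" "\<And>x. P (pvar x)" "\<And>f g. P f \<Longrightarrow> P g \<Longrightarrow> P (f + g)"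
    "\<And>f g. P f \<Longrightarrow> P g \<Longrightarrow> P (f * g)"
  shows "P f"
proof (induction f rule: mpoly_induct)
  case (single m c)
  show ?case
  proof (induction m rule: update_induct)
    case const
    then show ?case using assms(1)[of c] by (simp add: pconst_def)
  next
    case (update m x k)
    have pow: "P (single (single x k) 1)" for k :: nat
    proof (induction k)
      case 0
      then show ?case using assms(1)[of 1] by (simp add: pconst_def)
    next
      case (Suc k)
      have "single (single x (Suc k)) (1::complex)
        = pvar x * single (single x k) 1"
        by (simp add: pvar_def mult_single flip: single_add)
      then show ?case using assms(2,4) Suc by simp
    qed
    have "Poly_Mapping.update x k m = single x k + m"
      using update by (intro poly_mapping_eqI)
        (auto simp: lookup_update lookup_add lookup_single when_def in_keys_iff)
    then have "single (Poly_Mapping.update x k m) c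
      = single (single x k) 1 * single m c"
      by (simp add: mult_single)
    then show ?case using pow update assms(4) by simp
  qed
qed (use assms in auto)

definition ev :: "mpoly \<Rightarrow> (var \<Rightarrow> complex) \<Rightarrow> complex" where
  "ev f v = peval (\<lambda>c. c) v f"

lemma scalar_hom_id: "scalar_hom (\<lambda>c. c :: complex)"
  by (simp add: scalar_hom_def)

lemmas ev_hom = peval_hom[OF scalar_hom_id, folded ev_def]
lemmas ev_det = peval_det[OF scalar_hom_id, folded ev_def]

lemma ev_eq: "ev f v = (\<Sum>m\<in>keys f. lookup f m * (\<Prod>x\<in>UNIV. v x ^ lookup m x))"
  by (simp add: ev_def peval_def)

lemma mpeval_ev: "mpeval f p = ev f (asg p)"
  by (simp add: mpeval_def ev_def peval_def)

lemma scalar_hom_pconst: "scalar_hom pconst"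
  by (simp add: scalar_hom_def pconst_def single_add mult_single)

definition subst :: "(var \<Rightarrow> mpoly) \<Rightarrow> mpoly \<Rightarrow> mpoly" where
  "subst s f = peval pconst s f"

lemmas subst_hom = peval_hom[OF scalar_hom_pconst, folded subst_def]
lemmas subst_det = peval_det[OF scalar_hom_pconst, folded subst_def]

lemma ev_subst: "ev (subst s f) v = ev f (\<lambda>x. ev (s x) v)"
  by (induction f rule: mpoly_gen_induct) (simp_all add: ev_hom subst_hom)

text \<open>Reduction modulo B isolates the lowest digit, and division by B leads to the next one.
  This keeps the exponents of the Kronecker substitution apart.\<close>

lemma digits_unique:
  fixes a b :: "nat \<Rightarrow> nat"
  assumes "\<And>i. i < n \<Longrightarrow> a i < B" "\<And>i. i < n \<Longrightarrow> b i < B" "(\<Sum>i<n. a i * B ^ i) = (\<Sum>i<n. b i * B ^ i)"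
  shows "\<forall>i<n. a i = b i"
  using assms
proof (induction n arbitrary: a b)
  case (Suc n)
  have e: "(\<Sum>i<Suc n. c i * B ^ i) = c 0 + B * (\<Sum>i<n. c (Suc i) * B ^ i)" for c :: "nat \<Rightarrow> nat"
    by (simp add: sum.lessThan_Suc_shift sum_distrib_left mult_ac del: sum.lessThan_Suc)
  have B: "a 0 < B" "b 0 < B" using Suc.prems(1,2) by auto
  have eq: "a 0 + B * (\<Sum>i<n. a (Suc i) * B ^ i) = b 0 + B * (\<Sum>i<n. b (Suc i) * B ^ i)"
    using Suc.prems(3) e by metis
  from arg_cong[OF this, of "\<lambda>k. k mod B"] B have 0: "a 0 = b 0" by simp
  with eq B have "(\<Sum>i<n. a (Suc i) * B ^ i) = (\<Sum>i<n. b (Suc i) * B ^ i)" by simp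
  then have "\<forall>i<n. a (Suc i) = b (Suc i)" using Suc.prems by (intro Suc.IH) auto
  with 0 show ?case using less_Suc_eq_0_disj by auto
qed simp

text \<open>Kronecker substitution: \<open>x\<close> goes to \<open>t ^ (B ^ idx x)\<close> with \<open>B\<close> above all exponents.\<close>
lemma ev_nonzero:
  assumes "f \<noteq> 0"
  shows "\<exists>v. ev f v \<noteq> 0"
proof -
  define K where "K = keys f"
  have K: "finite K" "K \<noteq> {}" using assms by (auto simp: K_def)
  obtain idx :: "var \<Rightarrow> nat" where idx: "bij_betw idx UNIV {0..<CARD(var)}"
    using ex_bij_betw_finite_nat[OF finite[of "UNIV :: var set"]] by blast
  define B where "B = Suc (Max ((\<lambda>(m, x). lookup m x) ` (K \<times> UNIV)))"
  have B: "lookup m x < B" if "m \<in> K" for m x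
    unfolding B_def less_Suc_eq_le using that K by (intro Max_ge) auto
  define code where "code m = (\<Sum>x\<in>UNIV. lookup m x * B ^ idx x)" for m :: "var \<Rightarrow>\<^sub>0 nat"
  have code: "code m = (\<Sum>i<CARD(var). lookup m (the_inv_into UNIV idx i) * B ^ i)" for m
    unfolding code_def
    by (rule sum.reindex_bij_witness[where i = "the_inv_into UNIV idx" and j = idx])
      (use idx in \<open>auto simp: bij_betw_def the_inv_into_f_f f_the_inv_into_f\<close>)
  have inj: "inj_on code K"
  proof (rule inj_onI)
    fix m n assume mn: "m \<in> K" "n \<in> K" "code m = code n"
    have "\<forall>i<CARD(var). lookup m (the_inv_into UNIV idx i) = lookup n (the_inv_into UNIV idx i)"
      by (rule digits_unique[where B = B]) (use mn B code in auto)
    moreover have "idx x < CARD(var)" "the_inv_into UNIV idx (idx x) = x" for x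
      using idx by (auto simp: bij_betw_def the_inv_into_f_f)
    ultimately show "m = n" by (metis poly_mapping_eqI)
  qed
  define p where "p = (\<Sum>m\<in>K. monom (lookup f m) (code m))"
  obtain m0 where m0: "m0 \<in> K" using K by blast
  have "coeff p (code m0) = (\<Sum>m\<in>K. if m = m0 then lookup f m else 0)"
    unfolding p_def coeff_sum by (rule sum.cong) (use inj m0 in \<open>auto simp: inj_on_def\<close>)
  also have "\<dots> \<noteq> 0" using m0 K by (simp add: K_def in_keys_iff)
  finally have "p \<noteq> 0" by auto
  then obtain t where t: "poly p t \<noteq> 0" by (metis poly_all_0_iff_0)
  have "ev f (\<lambda>x. t ^ (B ^ idx x)) = poly p t"
    by (simp add: ev_eq p_def poly_sum poly_monom code_def power_sum K_def mult_ac flip: power_mult)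
  with t show ?thesis by metis
qed

lemma ev_inject: "(\<And>v. ev f v = ev g v) \<Longrightarrow> f = g"
  using ev_nonzero[of "f - g"] by (auto simp: ev_hom)

section \<open>Polynomial functions and multiprojective closures\<close>

text \<open>A weak form of polynomiality that fixes neither a degree nor a number of variables. It
  suffices for arguments that compare two points, since those take place on a line.\<close>

definition lpoly :: "(('k \<Rightarrow> complex) \<Rightarrow> complex) \<Rightarrow> bool" where
  "lpoly F \<longleftrightarrow> (\<forall>u d. \<exists>p. \<forall>t. F (\<lambda>i. u i + t * d i) = poly p t)"

lemma lpoly_const: "lpoly (\<lambda>z. c)"
  unfolding lpoly_def by (intro allI exI[of _ "[:c:]"]) simp

lemma lpoly_coord: "lpoly (\<lambda>z. z i)"
  unfolding lpoly_def
proof (intro allI)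
  fix u d :: "'a \<Rightarrow> complex"
  show "\<exists>p. \<forall>t. u i + t * d i = poly p t" by (intro exI[of _ "[:u i, d i:]"]) simp
qed

lemma lpoly_add: "lpoly F \<Longrightarrow> lpoly G \<Longrightarrow> lpoly (\<lambda>z. F z + G z)"
  unfolding lpoly_def by (metis poly_add)

lemma lpoly_mult: "lpoly F \<Longrightarrow> lpoly G \<Longrightarrow> lpoly (\<lambda>z. F z * G z)"
  unfolding lpoly_def by (metis poly_mult)

lemma lpoly_sum: "(\<And>i. i \<in> S \<Longrightarrow> lpoly (F i)) \<Longrightarrow> lpoly (\<lambda>z. \<Sum>i\<in>S. F i z)"
  by (induction S rule: infinite_finite_induct) (auto intro: lpoly_const lpoly_add)

lemma lpoly_prod: "(\<And>i. i \<in> S \<Longrightarrow> lpoly (F i)) \<Longrightarrow> lpoly (\<lambda>z. \<Prod>i\<in>S. F i z)"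
  by (induction S rule: infinite_finite_induct) (auto intro: lpoly_const lpoly_mult)

lemma lpoly_power: "lpoly F \<Longrightarrow> lpoly (\<lambda>z. F z ^ n)"
  by (induction n) (auto intro: lpoly_const lpoly_mult)

lemma lpoly_ev: "(\<And>x. lpoly (\<lambda>z. \<Phi> z x)) \<Longrightarrow> lpoly (\<lambda>z. ev f (\<Phi> z))"
  unfolding ev_eq by (intro lpoly_sum lpoly_mult lpoly_const lpoly_prod lpoly_power)

lemma lpoly_reindex: "lpoly F \<Longrightarrow> lpoly (\<lambda>w. F (\<lambda>i. w (g i)))"
  unfolding lpoly_def by metis

text \<open>Restricted to the line through \<open>u\<close> and \<open>w\<close>, both functions are
  nonzero univariate polynomials, and so is their product.\<close>

lemma lpoly_nonzero_both:
  assumes "lpoly F" "lpoly G" "F u \<noteq> 0" "G w \<noteq> 0"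
  shows "\<exists>z. F z \<noteq> 0 \<and> G z \<noteq> 0"
proof -
  define d where "d i = w i - u i" for i
  obtain p where p: "\<And>t. F (\<lambda>i. u i + t * d i) = poly p t" using assms(1) unfolding lpoly_def by metis
  obtain q where q: "\<And>t. G (\<lambda>i. u i + t * d i) = poly q t" using assms(2) unfolding lpoly_def by metis
  have "poly p 0 \<noteq> 0" "poly q 1 \<noteq> 0" using p[of 0] q[of 1] assms(3,4) by (auto simp: d_def)
  then have "p * q \<noteq> 0" by auto
  then obtain t where "poly (p * q) t \<noteq> 0" by (metis poly_all_0_iff_0)
  then show ?thesis using p q by (intro exI[of _ "\<lambda>i. u i + t * d i"]) auto
qed

text \<open>Density of the nonvanishing set of \<open>G\<close>. This is how facts about general
  parameters are extended to all of them.\<close>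

lemma lpoly_eq_0:
  assumes "lpoly F" "lpoly G" "G w \<noteq> 0" "\<forall>z. G z \<noteq> 0 \<longrightarrow> F z = 0"
  shows "\<forall>z. F z = 0"
proof (rule ccontr)
  assume "\<not> ?thesis"
  then obtain z where "F z \<noteq> 0" by blast
  from lpoly_nonzero_both[of F G, OF assms(1,2) this assms(3)] assms(4) show False by auto
qed

text \<open>Unlike \<open>lpoly\<close>, this fixes the number \<open>m\<close> of variables, on
  which the dimension bounds depend.\<close>

inductive polyfun :: "nat \<Rightarrow> ((nat \<Rightarrow> complex) \<Rightarrow> complex) \<Rightarrow> bool" for m where
  polyfun_const: "polyfun m (\<lambda>z. c)"
| polyfun_coord: "i < m \<Longrightarrow> polyfun m (\<lambda>z. z i)"
| polyfun_add: "polyfun m F \<Longrightarrow> polyfun m G \<Longrightarrow> polyfun m (\<lambda>z. F z + G z)"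
| polyfun_mult: "polyfun m F \<Longrightarrow> polyfun m G \<Longrightarrow> polyfun m (\<lambda>z. F z * G z)"

lemma polyfun_lpoly: "polyfun m F \<Longrightarrow> lpoly F"
  by (induction rule: polyfun.induct) (auto intro: lpoly_const lpoly_coord lpoly_add lpoly_mult)

lemma polyfun_uminus: "polyfun m F \<Longrightarrow> polyfun m (\<lambda>z. - F z)"
  using polyfun_mult[OF polyfun_const[of m "-1"], of F] by simp

lemma polyfun_diff: "polyfun m F \<Longrightarrow> polyfun m G \<Longrightarrow> polyfun m (\<lambda>z. F z - G z)"
  using polyfun_add[OF _ polyfun_uminus, of m F G] by simp

lemma polyfun_sum: "(\<And>i. i \<in> S \<Longrightarrow> polyfun m (F i)) \<Longrightarrow> polyfun m (\<lambda>z. \<Sum>i\<in>S. F i z)"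
  by (induction S rule: infinite_finite_induct) (auto intro: polyfun_const polyfun_add)

lemma polyfun_prod: "(\<And>i. i \<in> S \<Longrightarrow> polyfun m (F i)) \<Longrightarrow> polyfun m (\<lambda>z. \<Prod>i\<in>S. F i z)"
  by (induction S rule: infinite_finite_induct) (auto intro: polyfun_const polyfun_mult)

lemma polyfun_power: "polyfun m F \<Longrightarrow> polyfun m (\<lambda>z. F z ^ n)"
  by (induction n) (auto intro: polyfun_const polyfun_mult)

lemmas polyfun_intros = polyfun_const polyfun_coord polyfun_add polyfun_mult polyfun_uminus polyfun_diff polyfun_sum polyfun_prod polyfun_power

lemma polyfun_compose:
  assumes "polyfun m F" "\<And>i. i < m \<Longrightarrow> polyfun k (\<lambda>z. \<phi> z i)"
  shows "polyfun k (\<lambda>z. F (\<phi> z))"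
  using assms by (induction rule: polyfun.induct) (auto intro: polyfun_intros)

lemma polyfun_ev: "(\<And>x. polyfun m (\<lambda>z. \<Phi> z x)) \<Longrightarrow> polyfun m (\<lambda>z. ev f (\<Phi> z))"
  unfolding ev_eq by (intro polyfun_intros)

section \<open>The multigrading and cones over parametrized sets\<close>

definition block :: "var \<Rightarrow> nat" where
  "block x = (case x of Inl _ \<Rightarrow> 0 | Inr (Inl _) \<Rightarrow> 1 | Inr (Inr _) \<Rightarrow> 2)"

lemma block_simps [simp]: "block (Inl i) = 0" "block (Inr (Inl i)) = 1" "block (Inr (Inr i)) = 2"
  by (simp_all add: block_def)

lemma all_var: "(\<forall>x::var. P x) \<longleftrightarrow> (\<forall>i. P (Inl i)) \<and> (\<forall>i. P (Inr (Inl i))) \<and> (\<forall>i. P (Inr (Inr i)))"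
  by (metis sum.exhaust)

lemma ex_var: "(\<exists>x::var. P x) \<longleftrightarrow> (\<exists>i. P (Inl i)) \<or> (\<exists>i. P (Inr (Inl i))) \<or> (\<exists>i. P (Inr (Inr i)))"
  by (metis sum.exhaust)

lemma var_cases:
  fixes x :: var
  obtains "x = Inl 1" | "x = Inl 2" | "x = Inl 3"
  | "x = Inr (Inl 1)" | "x = Inr (Inl 2)" | "x = Inr (Inl 3)"
  | "x = Inr (Inr 1)" | "x = Inr (Inr 2)" | "x = Inr (Inr 3)"
proof -
  consider i where "x = Inl i" | i where "x = Inr (Inl i)" | i where "x = Inr (Inr i)"
    by (metis sum.exhaust)
  then show thesis
  proof cases
    case (1 i)
    then show ?thesis using exhaust_3[of i] that(1-3) by blast
  next
    case (2 i)
    then show ?thesis using exhaust_3[of i] that(4-6) by blast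
  next
    case (3 i)
    then show ?thesis using exhaust_3[of i] that(7-9) by blast
  qed
qed

lemma block_less [simp]: "block x < 3"
  by (cases x rule: var_cases) auto

definition scl :: "(nat \<Rightarrow> complex) \<Rightarrow> (var \<Rightarrow> complex) \<Rightarrow> var \<Rightarrow> complex" where
  "scl s v x = s (block x) * v x"

definition topt :: "(var \<Rightarrow> complex) \<Rightarrow> pt" where
  "topt v = ((\<chi> i. v (Inl i)), (\<chi> i. v (Inr (Inl i))), (\<chi> i. v (Inr (Inr i))))"

lemma asg_simps [simp]: "asg (u, v, w) (Inl i) = u $ i" "asg (u, v, w) (Inr (Inl i)) = v $ i" "asg (u, v, w) (Inr (Inr i)) = w $ i"
  by (simp_all add: asg_def)

lemma asg_topt [simp]: "asg (topt v) = v"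
  by (simp add: fun_eq_iff all_var topt_def)

lemma topt_asg [simp]: "topt (asg p) = p"
  by (cases p) (simp add: topt_def vec_eq_iff)

lemma mvanish_iff:
  "mvanish f p \<longleftrightarrow> (\<forall>s. s 0 \<noteq> 0 \<and> s 1 \<noteq> 0 \<and> s 2 \<noteq> 0 \<longrightarrow> ev f (scl s (asg p)) = 0)"
proof (cases p)
  case (fields u v w)
  have asg: "asg (s 0 *s u, s 1 *s v, s 2 *s w) = scl s (asg p)" for s :: "nat \<Rightarrow> complex"
    by (simp add: fun_eq_iff all_var scl_def fields)
  have "mvanish f p" if *: "\<forall>s. s 0 \<noteq> 0 \<and> s 1 \<noteq> 0 \<and> s 2 \<noteq> 0 \<longrightarrow> ev f (scl s (asg p)) = 0"
    unfolding mvanish_def fields prod.case mpeval_ev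
  proof (intro allI impI)
    fix a b c :: complex assume "a \<noteq> 0 \<and> b \<noteq> 0 \<and> c \<noteq> 0"
    with * show "ev f (asg (a *s u, b *s v, c *s w)) = 0"
      using asg[of "\<lambda>i. if i = 0 then a else if i = 1 then b else c"] by simp
  qed
  moreover have "ev f (scl s (asg p)) = 0" if "mvanish f p" "s 0 \<noteq> 0 \<and> s 1 \<noteq> 0 \<and> s 2 \<noteq> 0" for s
    using that unfolding mvanish_def fields prod.case mpeval_ev asg[unfolded fields, symmetric] by blast
  ultimately show ?thesis by blast
qed

lemma valid_pt_iff: "valid_pt p \<longleftrightarrow> (\<forall>b<3. \<exists>x. block x = b \<and> asg p x \<noteq> 0)"
proof -
  have "(\<forall>b<3. Q b) \<longleftrightarrow> Q 0 \<and> Q 1 \<and> Q 2" for Q :: "nat \<Rightarrow> bool"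
    by (auto simp: less_Suc_eq numeral_3_eq_3 numeral_2_eq_2)
  then show ?thesis by (cases p) (auto simp: valid_pt_def ex_var vec_eq_iff)
qed

text \<open>The scalars may be zero: the cone is then the image of a polynomial map, and vanishing
  at nonzero scalars extends to all of it by density.\<close>

definition coneI :: "('k \<Rightarrow> var \<Rightarrow> complex) \<Rightarrow> mpoly set" where
  "coneI \<Phi> = {f. \<forall>s y. ev f (scl s (\<Phi> y)) = 0}"

definition is_ideal :: "mpoly set \<Rightarrow> bool" where
  "is_ideal J \<longleftrightarrow> 0 \<in> J \<and> (\<forall>f\<in>J. \<forall>g\<in>J. f + g \<in> J) \<and> (\<forall>f\<in>J. \<forall>g. g * f \<in> J)"

definition is_prime :: "mpoly set \<Rightarrow> bool" where
  "is_prime J \<longleftrightarrow> is_ideal J \<and> 1 \<notin> J \<and> (\<forall>f g. f * g \<in> J \<longrightarrow> f \<in> J \<or> g \<in> J)"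

definition zeroI :: "('k \<Rightarrow> var \<Rightarrow> complex) \<Rightarrow> mpoly set" where
  "zeroI \<Phi> = {f. \<forall>z. ev f (\<Phi> z) = 0}"

text \<open>Two polynomials that are each nonzero somewhere on the parametrized set are nonzero at a
  common parameter, and there the product is nonzero too.\<close>

lemma zeroI_prime:
  fixes \<Phi> :: "('k \<Rightarrow> complex) \<Rightarrow> var \<Rightarrow> complex"
  assumes "\<And>x. lpoly (\<lambda>z. \<Phi> z x)"
  shows "is_prime (zeroI \<Phi>)"
proof -
  have l: "lpoly (\<lambda>z. ev f (\<Phi> z))" for f by (rule lpoly_ev) (rule assms)
  have "f \<in> zeroI \<Phi> \<or> g \<in> zeroI \<Phi>" if fg: "f * g \<in> zeroI \<Phi>" for f g
  proof (rule ccontr)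
    assume "\<not> ?thesis"
    then obtain u w where "ev f (\<Phi> u) \<noteq> 0" "ev g (\<Phi> w) \<noteq> 0" unfolding zeroI_def by blast
    then have "\<exists>z. ev f (\<Phi> z) \<noteq> 0 \<and> ev g (\<Phi> z) \<noteq> 0"
      by (rule lpoly_nonzero_both[OF l[of f] l[of g]])
    then obtain z where "ev f (\<Phi> z) \<noteq> 0 \<and> ev g (\<Phi> z) \<noteq> 0" by (elim exE)
    then have "ev (f * g) (\<Phi> z) \<noteq> 0" by (simp add: ev_hom)
    then show False using fg by (simp add: zeroI_def)
  qed
  moreover have "is_ideal (zeroI \<Phi>)" by (simp add: is_ideal_def zeroI_def ev_hom)
  moreover have "1 \<notin> zeroI \<Phi>" by (simp add: zeroI_def ev_hom)
  ultimately show ?thesis unfolding is_prime_def by blast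
qed

text \<open>One parameter sequence for the whole cone: entries 0, 1, 2 are the scalars of the three
  factors, and the parameters of the given map follow, shifted by 3.\<close>

definition conemap :: "((nat \<Rightarrow> complex) \<Rightarrow> var \<Rightarrow> complex) \<Rightarrow> (nat \<Rightarrow> complex) \<Rightarrow> var \<Rightarrow> complex" where
  "conemap \<Phi> w = scl w (\<Phi> (\<lambda>i. w (i + 3)))"

lemma ex_conemap: "\<exists>w. scl s (\<Phi> y) = conemap \<Phi> w"
  by (intro exI[of _ "\<lambda>i. if i < 3 then s i else y (i - 3)"]) (simp add: conemap_def scl_def fun_eq_iff)

lemma coneI_eq: "coneI \<Phi> = zeroI (conemap \<Phi>)"
proof -
  have "ev f (scl s (\<Phi> y)) = 0" if "\<forall>w. ev f (conemap \<Phi> w) = 0" for f s y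
    using ex_conemap[of s \<Phi> y] that by auto
  then show ?thesis by (auto simp: coneI_def zeroI_def conemap_def)
qed

lemma lpoly_conemap:
  assumes "\<And>x. lpoly (\<lambda>z. \<Phi> z x)"
  shows "lpoly (\<lambda>w. conemap \<Phi> w x)"
  unfolding conemap_def scl_def
  using lpoly_mult[OF lpoly_coord[of "block x"] lpoly_reindex[OF assms[of x], of "\<lambda>i. i + 3"]] .

lemma coneI_prime:
  fixes \<Phi> :: "(nat \<Rightarrow> complex) \<Rightarrow> var \<Rightarrow> complex"
  assumes "\<And>x. lpoly (\<lambda>z. \<Phi> z x)"
  shows "is_prime (coneI \<Phi>)"
proof -
  have "lpoly (\<lambda>w. conemap \<Phi> w x)" for x by (rule lpoly_conemap) (rule assms)
  then show ?thesis unfolding coneI_eq by (rule zeroI_prime)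
qed

text \<open>Parameters whose image has a zero factor give no point of the product of planes. They
  lie in the zero set of one nonzero polynomial, so vanishing at the actual points extends to the
  full cone.\<close>

lemma vanI_param:
  fixes \<Phi> :: "(nat \<Rightarrow> complex) \<Rightarrow> var \<Rightarrow> complex"
  assumes \<Phi>: "\<And>x. lpoly (\<lambda>z. \<Phi> z x)" and z0: "valid_pt (topt (\<Phi> z0))"
  shows "vanI {topt (\<Phi> z) | z. valid_pt (topt (\<Phi> z))} = coneI \<Phi>"
proof
  show "coneI \<Phi> \<subseteq> vanI {topt (\<Phi> z) | z. valid_pt (topt (\<Phi> z))}"
    by (auto simp: vanI_def coneI_def mvanish_iff)
  show "vanI {topt (\<Phi> z) | z. valid_pt (topt (\<Phi> z))} \<subseteq> coneI \<Phi>"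
  proof
    fix f assume f: "f \<in> vanI {topt (\<Phi> z) | z. valid_pt (topt (\<Phi> z))}"
    obtain X where X: "\<And>b. b < 3 \<Longrightarrow> block (X b) = b \<and> \<Phi> z0 (X b) \<noteq> 0"
      using z0 unfolding valid_pt_iff asg_topt by metis
    \<comment> \<open>\<open>K\<close> is nonzero only if all three scalars are and each factor has
      a nonzero coordinate, namely the coordinate \<open>X b\<close> that is nonzero at
      \<open>z0\<close>.\<close>
    define K where "K w = (\<Prod>b<3. w b * \<Phi> (\<lambda>i. w (i + 3)) (X b))" for w :: "nat \<Rightarrow> complex"
    have "lpoly (\<lambda>w. \<Phi> (\<lambda>i. w (i + 3)) x)" for x
      using lpoly_reindex[OF \<Phi>[of x], of "\<lambda>i. i + 3"] by simp
    then have K: "lpoly K" unfolding K_def by (intro lpoly_prod lpoly_mult lpoly_coord) auto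
    have K0: "K (\<lambda>i. if i < 3 then 1 else z0 (i - 3)) \<noteq> 0" using X by (auto simp: K_def)
    have van: "\<forall>w. K w \<noteq> 0 \<longrightarrow> ev f (conemap \<Phi> w) = 0"
    proof (intro allI impI)
      fix w assume "K w \<noteq> 0"
      have w: "w b \<noteq> 0 \<and> \<Phi> (\<lambda>i. w (i + 3)) (X b) \<noteq> 0" if "b < 3" for b
        using \<open>K w \<noteq> 0\<close> that by (auto simp: K_def)
      then have "valid_pt (topt (\<Phi> (\<lambda>i. w (i + 3))))" using X unfolding valid_pt_iff by force
      then have "mvanish f (topt (\<Phi> (\<lambda>i. w (i + 3))))" using f unfolding vanI_def by blast
      then show "ev f (conemap \<Phi> w) = 0" using w[of 0] w[of 1] w[of 2] by (simp add: mvanish_iff conemap_def)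
    qed
    have lp: "lpoly (\<lambda>w. ev f (conemap \<Phi> w))"
      by (rule lpoly_ev) (rule lpoly_conemap, rule \<Phi>)
    have "\<forall>w. ev f (conemap \<Phi> w) = 0"
      by (rule lpoly_eq_0[OF lp K K0 van])
    then show "f \<in> coneI \<Phi>" by (simp add: coneI_eq zeroI_def)
  qed
qed

section \<open>Closures and irreducibility\<close>

lemma zclosure_cong: "vanI S = vanI T \<Longrightarrow> zclosure S = zclosure T"
  by (simp add: zclosure_def)

lemma mp_closed_zclosure: "mp_closed (zclosure S)"
  by (auto simp: mp_closed_def zclosure_def)

lemma vanI_antimono: "S \<subseteq> T \<Longrightarrow> vanI T \<subseteq> vanI S"
  by (auto simp: vanI_def)

lemma subset_zclosure:
  assumes "\<And>p. p \<in> S \<Longrightarrow> valid_pt p"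
  shows "S \<subseteq> zclosure S"
proof
  fix p assume "p \<in> S"
  then show "p \<in> zclosure S" using assms[of p] by (simp add: vanI_def zclosure_def Zc_def)
qed

lemma vanI_zclosure:
  assumes "\<And>p. p \<in> S \<Longrightarrow> valid_pt p"
  shows "vanI (zclosure S) = vanI S"
proof
  show "vanI (zclosure S) \<subseteq> vanI S" by (intro vanI_antimono subset_zclosure assms)
  have "mvanish f p" if "f \<in> vanI S" "p \<in> zclosure S" for f p
    using that(2) unfolding zclosure_def Zc_def using that(1) by simp
  then show "vanI S \<subseteq> vanI (zclosure S)" unfolding vanI_def[of "zclosure S"] by simp blast
qed

text \<open>A closed set that does not contain the closure has an equation outside
  \<open>vanI S\<close>. If two such sets covered it, the product of their equations would lie in
  the prime ideal.\<close>

lemma mp_irreducible_zclosure: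
  assumes "S \<noteq> {}" and valid: "\<And>p. p \<in> S \<Longrightarrow> valid_pt p" and prime: "is_prime (vanI S)"
  shows "mp_irreducible (zclosure S)"
  unfolding mp_irreducible_def
proof (intro conjI allI impI)
  show "zclosure S \<noteq> {}" using subset_zclosure[of S] assms by blast
  fix Z1 Z2 assume Z: "mp_closed Z1 \<and> mp_closed Z2 \<and> zclosure S \<subseteq> Z1 \<union> Z2"
  then obtain S1 S2 where S12: "Z1 = Zc S1" "Z2 = Zc S2" by (auto simp: mp_closed_def)
  show "zclosure S \<subseteq> Z1 \<or> zclosure S \<subseteq> Z2"
  proof (rule ccontr)
    assume "\<not> ?thesis"
    then obtain f1 f2 where f: "f1 \<in> S1" "f2 \<in> S2" "f1 \<notin> vanI S" "f2 \<notin> vanI S"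
      unfolding S12 zclosure_def Zc_def by blast
    have "mvanish (f1 * f2) p" if "p \<in> S" for p
    proof -
      have "p \<in> Z1 \<union> Z2" using that Z subset_zclosure[of S] valid by blast
      then show ?thesis using f by (auto simp: S12 Zc_def mvanish_iff ev_hom)
    qed
    then have "f1 * f2 \<in> vanI S" by (auto simp: vanI_def)
    with prime f show False by (auto simp: is_prime_def)
  qed
qed

lemma mp_irreducible_param:
  fixes \<Phi> :: "(nat \<Rightarrow> complex) \<Rightarrow> var \<Rightarrow> complex"
  assumes \<Phi>: "\<And>x. lpoly (\<lambda>z. \<Phi> z x)" and z0: "valid_pt (topt (\<Phi> z0))"
  shows "mp_irreducible (zclosure {topt (\<Phi> z) | z. valid_pt (topt (\<Phi> z))})"
proof (rule mp_irreducible_zclosure)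
  show "{topt (\<Phi> z) | z. valid_pt (topt (\<Phi> z))} \<noteq> {}" using z0 by blast
  show "is_prime (vanI {topt (\<Phi> z) | z. valid_pt (topt (\<Phi> z))})"
    unfolding vanI_param[OF assms] by (rule coneI_prime) (rule \<Phi>)
  fix p assume "p \<in> {topt (\<Phi> z) | z. valid_pt (topt (\<Phi> z))}"
  then obtain z where "p = topt (\<Phi> z)" "valid_pt (topt (\<Phi> z))" by blast
  then show "valid_pt p" by simp
qed

section \<open>Algebraic independence modulo an ideal\<close>

definition expo :: "nat \<Rightarrow> nat \<Rightarrow> (nat \<Rightarrow> nat) set" where
  "expo k n = PiE {..<k} (\<lambda>_. {..<n})"

lemma finite_expo [simp]: "finite (expo k n)"
  by (simp add: expo_def finite_PiE)

lemma card_expo: "card (expo k n) = n ^ k"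
  by (simp add: expo_def card_PiE)

lemma sum_expo_Suc:
  fixes F :: "(nat \<Rightarrow> nat) \<Rightarrow> 'a::comm_monoid_add"
  shows "(\<Sum>\<alpha>\<in>expo (Suc k) n. F \<alpha>) = (\<Sum>j<n. \<Sum>\<beta>\<in>expo k n. F (\<beta>(k := j)))"
proof -
  have eq: "expo (Suc k) n = (\<lambda>(j, \<beta>). \<beta>(k := j)) ` ({..<n} \<times> expo k n)"
    by (simp add: expo_def lessThan_Suc PiE_insert_eq)
  have inj: "inj_on (\<lambda>(j, \<beta>). \<beta>(k := j)) ({..<n} \<times> expo k n)"
    using inj_combinator[of k "{..<k}" "\<lambda>_. {..<n}"] by (simp add: expo_def)
  show ?thesis unfolding eq sum.reindex[OF inj] by (simp add: sum.cartesian_product case_prod_beta comp_def)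
qed

text \<open>Each exponent is bounded by \<open>n\<close> separately, not the total degree: the
  monomials are then indexed by a box with \<open>n ^ k\<close> elements, from which the last
  coordinate can be split off.\<close>

definition algindep :: "nat \<Rightarrow> (nat \<Rightarrow> mpoly) \<Rightarrow> mpoly set \<Rightarrow> bool" where
  "algindep k f J \<longleftrightarrow> (\<forall>n c. (\<Sum>\<alpha>\<in>expo k n. pconst (c \<alpha>) * (\<Prod>i<k. f i ^ \<alpha> i)) \<in> J \<longrightarrow> (\<forall>\<alpha>\<in>expo k n. c \<alpha> = 0))"

lemma algindep_mono: "algindep k f J \<Longrightarrow> I \<subseteq> J \<Longrightarrow> algindep k f I"
  unfolding algindep_def by blast

lemma algindep_0:
  assumes "is_ideal J" "1 \<notin> J"
  shows "algindep 0 f J"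
  unfolding algindep_def
proof (intro allI impI ballI, rule ccontr)
  fix n c \<alpha> assume *: "(\<Sum>\<alpha>\<in>expo 0 n. pconst (c \<alpha>) * (\<Prod>i<0. f i ^ \<alpha> i)) \<in> J" "\<alpha> \<in> expo 0 n" "c \<alpha> \<noteq> 0"
  have "expo 0 n = {\<alpha>}" using *(2) by (auto simp: expo_def)
  with * have "pconst (c \<alpha>) \<in> J" by simp
  then have "pconst (1 / c \<alpha>) * pconst (c \<alpha>) \<in> J" using assms(1) by (simp add: is_ideal_def)
  moreover have "pconst (1 / c \<alpha>) * pconst (c \<alpha>) = 1" using *(3) by (simp add: pconst_def mult_single)
  ultimately show False using assms(2) by simp
qed

text \<open>Lowest-order terms in \<open>g\<close> of a relation modulo \<open>P\<close> give a relation modulo \<open>J\<close>.\<close>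
lemma algindep_Suc:
  assumes P: "is_prime P" and J: "is_ideal J" and g: "g \<in> J" "g \<notin> P" and "P \<subseteq> J" and f: "algindep k f J"
  shows "algindep (Suc k) (f(k := g)) P"
  unfolding algindep_def
proof (intro allI impI)
  fix n c
  assume *: "(\<Sum>\<alpha>\<in>expo (Suc k) n. pconst (c \<alpha>) * (\<Prod>i<Suc k. (f(k := g)) i ^ \<alpha> i)) \<in> P"
  \<comment> \<open>\<open>H j\<close> is the coefficient of \<open>g ^ j\<close> in the
    relation.\<close>
  define H where "H j = (\<Sum>\<beta>\<in>expo k n. pconst (c (\<beta>(k := j))) * (\<Prod>i<k. f i ^ \<beta> i))" for j
  have sum: "(\<Sum>j<n. g ^ j * H j) \<in> P"
  proof -
    have "(\<Prod>i<k. (f(k := g)) i ^ (\<beta>(k := j)) i) = (\<Prod>i<k. f i ^ \<beta> i)" for \<beta> :: "nat \<Rightarrow> nat" and j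
      by (rule prod.cong) auto
    then have "(\<Sum>\<alpha>\<in>expo (Suc k) n. pconst (c \<alpha>) * (\<Prod>i<Suc k. (f(k := g)) i ^ \<alpha> i)) = (\<Sum>j<n. g ^ j * H j)"
      by (simp add: sum_expo_Suc H_def sum_distrib_left mult_ac)
    with * show ?thesis by simp
  qed
  have pow: "g ^ j \<notin> P" for j
    using P g(2) by (induction j) (auto simp: is_prime_def)
  have main: "\<forall>\<beta>\<in>expo k n. c (\<beta>(k := j)) = 0" if "j < n" for j
    using that
  proof (induction j rule: less_induct)
    case (less j)
    have H0: "H i = 0" if "i < j" for i
    proof -
      have "\<forall>\<beta>\<in>expo k n. c (\<beta>(k := i)) = 0"
        using less.IH[OF that] order.strict_trans[OF that less.prems] by blast
      then show ?thesis unfolding H_def by (simp add: pconst_def del: fun_upd_apply)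
    qed
    \<comment> \<open>With the lower coefficients zero, \<open>g ^ j\<close> can be factored out.
      The prime ideal \<open>P\<close> contains no power of \<open>g\<close>, so the cofactor lies
      in \<open>P\<close> and hence in \<open>J\<close>.\<close>
    have "(\<Sum>i<n. g ^ i * H i) = (\<Sum>i\<in>{j..<n}. g ^ i * H i)"
      by (rule sum.mono_neutral_right) (use H0 in auto)
    also have "\<dots> = (\<Sum>i<n - j. g ^ (j + i) * H (j + i))"
      by (rule sum.reindex_bij_witness[where i = "\<lambda>i. j + i" and j = "\<lambda>i. i - j"]) auto
    also have "\<dots> = g ^ j * (\<Sum>i<n - j. g ^ i * H (j + i))"
      by (simp add: sum_distrib_left power_add mult_ac)
    finally have "(\<Sum>i<n - j. g ^ i * H (j + i)) \<in> J"
      using sum P pow[of j] \<open>P \<subseteq> J\<close> by (auto simp: is_prime_def)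
    \<comment> \<open>Modulo \<open>g\<close>, which lies in \<open>J\<close>, only
      \<open>H j\<close> is left of the cofactor.\<close>
    moreover have "(\<Sum>i<n - j. g ^ i * H (j + i)) = H j + (\<Sum>i<n - j - 1. g ^ i * H (j + Suc i)) * g"
    proof -
      obtain r where r: "n - j = Suc r" using less.prems by (metis Suc_diff_Suc)
      show ?thesis unfolding r sum.lessThan_Suc_shift by (simp add: sum_distrib_left mult_ac)
    qed
    ultimately have "H j + (\<Sum>i<n - j - 1. g ^ i * H (j + Suc i)) * g \<in> J"
      "- (\<Sum>i<n - j - 1. g ^ i * H (j + Suc i)) * g \<in> J"
      using J g(1) by (auto simp only: is_ideal_def)
    then have "(H j + (\<Sum>i<n - j - 1. g ^ i * H (j + Suc i)) * g) + - (\<Sum>i<n - j - 1. g ^ i * H (j + Suc i)) * g \<in> J"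
      using J unfolding is_ideal_def by blast
    then have "H j \<in> J" by simp
    then show ?case
      using spec[OF spec[OF f[unfolded algindep_def], of n], of "\<lambda>\<beta>. c (\<beta>(k := j))"]
      unfolding H_def by blast
  qed
  show "\<forall>\<alpha>\<in>expo (Suc k) n. c \<alpha> = 0"
  proof
    fix \<alpha> assume "\<alpha> \<in> expo (Suc k) n"
    then obtain j \<beta> where "j < n" "\<beta> \<in> expo k n" "\<alpha> = \<beta>(k := j)"
      by (auto simp: expo_def lessThan_Suc PiE_insert_eq)
    then show "c \<alpha> = 0" using main by auto
  qed
qed

text \<open>Gaussian elimination by induction on the number of columns: a row with a nonzero entry
  in column \<open>j\<close> is the pivot and clears that column in the other rows.\<close>

lemma linear_dependence:
  fixes M :: "'a \<Rightarrow> 'b \<Rightarrow> complex"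
  assumes "finite J" "finite I" "card J < card I"
  shows "\<exists>c. (\<exists>i\<in>I. c i \<noteq> 0) \<and> (\<forall>j\<in>J. (\<Sum>i\<in>I. c i * M i j) = 0)"
  using assms
proof (induction J arbitrary: I M rule: finite_induct)
  case empty
  then have "I \<noteq> {}" by auto
  then show ?case by (intro exI[of _ "\<lambda>_. 1"]) auto
next
  case (insert j J)
  show ?case
  proof (cases "\<forall>i\<in>I. M i j = 0")
    case True
    obtain c where "\<exists>i\<in>I. c i \<noteq> 0" "\<forall>j\<in>J. (\<Sum>i\<in>I. c i * M i j) = 0"
      using insert.IH[of I M] insert.prems insert.hyps by auto
    then show ?thesis using True by (intro exI[of _ c]) auto
  next
    case False
    then obtain i0 where i0: "i0 \<in> I" "M i0 j \<noteq> 0" by auto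
    define M' where "M' i l = M i l - M i j / M i0 j * M i0 l" for i l
    have "card J < card (I - {i0})" using insert.prems insert.hyps i0 by simp
    then obtain c where c: "\<exists>i\<in>I - {i0}. c i \<noteq> 0" "\<forall>l\<in>J. (\<Sum>i\<in>I - {i0}. c i * M' i l) = 0"
      using insert.IH[of "I - {i0}" M'] insert.prems by auto
    \<comment> \<open>The coefficient of the pivot row is chosen to cancel column
      \<open>j\<close>.\<close>
    define e where "e = c(i0 := - (\<Sum>i\<in>I - {i0}. c i * M i j) / M i0 j)"
    have e: "(\<Sum>i\<in>I. e i * M i l) = (\<Sum>i\<in>I - {i0}. c i * M' i l)" for l
    proof -
      have "(\<Sum>i\<in>I - {i0}. e i * M i l) = (\<Sum>i\<in>I - {i0}. c i * M i l)"
        by (rule sum.cong) (auto simp: e_def)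
      then have "(\<Sum>i\<in>I. e i * M i l) = e i0 * M i0 l + (\<Sum>i\<in>I - {i0}. c i * M i l)"
        using i0 insert.prems by (simp add: sum.remove)
      also have "\<dots> = (\<Sum>i\<in>I - {i0}. c i * M' i l)"
        by (simp add: e_def M'_def algebra_simps sum_subtractf sum_divide_distrib sum_distrib_left)
      finally show ?thesis .
    qed
    have "M' i j = 0" for i using i0 by (simp add: M'_def)
    then have "\<forall>l\<in>insert j J. (\<Sum>i\<in>I. e i * M i l) = 0" using c(2) e by simp
    moreover have "\<exists>i\<in>I. e i \<noteq> 0" using c(1) by (auto simp: e_def)
    ultimately show ?thesis by blast
  qed
qed

section \<open>Counting monomials with bounded exponents\<close>

definition bp :: "nat \<Rightarrow> nat \<Rightarrow> ((nat \<Rightarrow> complex) \<Rightarrow> complex) \<Rightarrow> bool" where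
  "bp m D F \<longleftrightarrow> (\<exists>c. \<forall>z. F z = (\<Sum>\<beta>\<in>expo m (Suc D). c \<beta> * (\<Prod>i<m. z i ^ \<beta> i)))"

text \<open>Admits sums in which an exponent vector occurs repeatedly, as happens when two
  expansions are multiplied; coefficients are grouped by exponent vector.\<close>

lemma bp_collect:
  assumes "finite S" "g ` S \<subseteq> expo m (Suc D)" "\<And>z. F z = (\<Sum>x\<in>S. c x * (\<Prod>i<m. z i ^ g x i))"
  shows "bp m D F"
  unfolding bp_def
proof (intro exI allI)
  fix z
  have "F z = (\<Sum>\<beta>\<in>expo m (Suc D). \<Sum>x | x \<in> S \<and> g x = \<beta>. c x * (\<Prod>i<m. z i ^ g x i))"
    unfolding assms(3) by (rule sum.group[OF assms(1) finite_expo assms(2), symmetric])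
  also have "\<dots> = (\<Sum>\<beta>\<in>expo m (Suc D). (\<Sum>x | x \<in> S \<and> g x = \<beta>. c x) * (\<Prod>i<m. z i ^ \<beta> i))"
    by (intro sum.cong refl) (simp add: sum_distrib_right)
  finally show "F z = \<dots>" .
qed

lemma bp_mono: "bp m D F \<Longrightarrow> D \<le> D' \<Longrightarrow> bp m D' F"
proof -
  assume "bp m D F" and D: "D \<le> D'"
  then obtain c where c: "\<And>z. F z = (\<Sum>\<beta>\<in>expo m (Suc D). c \<beta> * (\<Prod>i<m. z i ^ \<beta> i))" unfolding bp_def by blast
  have "expo m (Suc D) \<subseteq> expo m (Suc D')" unfolding expo_def using D by (intro PiE_mono) auto
  then show ?thesis by (intro bp_collect[where g = "\<lambda>x. x", OF _ _ c]) auto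
qed

lemma bp_const: "bp m D (\<lambda>z. a)"
  by (rule bp_collect[where S = "{()}" and g = "\<lambda>_. restrict (\<lambda>_. 0) {..<m}" and c = "\<lambda>_. a"]) (auto simp: expo_def)

lemma bp_coord: "i < m \<Longrightarrow> bp m 1 (\<lambda>z. z i)"
proof (rule bp_collect[where S = "{()}" and g = "\<lambda>_. restrict (\<lambda>j. if j = i then 1 else 0) {..<m}" and c = "\<lambda>_. 1"])
  fix z :: "nat \<Rightarrow> complex" assume "i < m"
  have "(\<Prod>j<m. z j ^ restrict (\<lambda>j. if j = i then 1 else 0) {..<m} j) = (\<Prod>j<m. if j = i then z j else 1)"
    by (rule prod.cong) auto
  then show "z i = (\<Sum>x\<in>{()}. 1 * (\<Prod>j<m. z j ^ restrict (\<lambda>j. if j = i then 1 else 0) {..<m} j))"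
    using \<open>i < m\<close> by simp
qed (auto simp: expo_def)

lemma bp_add: "bp m D F \<Longrightarrow> bp m D G \<Longrightarrow> bp m D (\<lambda>z. F z + G z)"
proof -
  assume "bp m D F" "bp m D G"
  then obtain c d where "\<And>z. F z = (\<Sum>\<beta>\<in>expo m (Suc D). c \<beta> * (\<Prod>i<m. z i ^ \<beta> i))"
    "\<And>z. G z = (\<Sum>\<beta>\<in>expo m (Suc D). d \<beta> * (\<Prod>i<m. z i ^ \<beta> i))" unfolding bp_def by blast
  then show ?thesis unfolding bp_def
    by (intro exI[of _ "\<lambda>\<beta>. c \<beta> + d \<beta>"]) (simp add: sum.distrib distrib_right)
qed

lemma bp_mult: "bp m D F \<Longrightarrow> bp m D' G \<Longrightarrow> bp m (D + D') (\<lambda>z. F z * G z)"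
proof -
  assume "bp m D F" "bp m D' G"
  then obtain c d where c: "\<And>z. F z = (\<Sum>\<beta>\<in>expo m (Suc D). c \<beta> * (\<Prod>i<m. z i ^ \<beta> i))"
    and d: "\<And>z. G z = (\<Sum>\<beta>\<in>expo m (Suc D'). d \<beta> * (\<Prod>i<m. z i ^ \<beta> i))" unfolding bp_def by blast
  let ?g = "\<lambda>(\<beta>, \<gamma>). restrict (\<lambda>i. \<beta> i + \<gamma> i) {..<m}"
  show ?thesis
  proof (rule bp_collect[where S = "expo m (Suc D) \<times> expo m (Suc D')" and g = ?g and c = "\<lambda>(\<beta>, \<gamma>). c \<beta> * d \<gamma>"])
    show "?g ` (expo m (Suc D) \<times> expo m (Suc D')) \<subseteq> expo m (Suc (D + D'))"
      by (force simp: expo_def PiE_iff less_Suc_eq_le intro!: add_mono)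
    fix z
    show "F z * G z = (\<Sum>x\<in>expo m (Suc D) \<times> expo m (Suc D'). (case x of (\<beta>, \<gamma>) \<Rightarrow> c \<beta> * d \<gamma>) * (\<Prod>i<m. z i ^ ?g x i))"
      unfolding c d sum_product sum.cartesian_product
      by (intro sum.cong refl) (auto simp: power_add prod.distrib mult_ac)
  qed simp
qed

lemma bp_power: "bp m D F \<Longrightarrow> bp m (n * D) (\<lambda>z. F z ^ n)"
  by (induction n) (auto intro: bp_const bp_mult)

lemma bp_prod: "(\<And>i. i < k \<Longrightarrow> bp m D (F i)) \<Longrightarrow> bp m (k * D) (\<lambda>z. \<Prod>i<k. F i z)"
proof (induction k)
  case (Suc k)
  then have "bp m (k * D + D) (\<lambda>z. (\<Prod>i<k. F i z) * F k z)" by (intro bp_mult) auto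
  then show ?case by (simp add: add.commute)
qed (auto intro: bp_const)

lemma polyfun_bp: "polyfun m F \<Longrightarrow> \<exists>D. bp m D F"
proof (induction rule: polyfun.induct)
  case (polyfun_add F G)
  then obtain D D' where "bp m D F" "bp m D' G" by auto
  then have "bp m (max D D') (\<lambda>z. F z + G z)" by (intro bp_add) (auto intro: bp_mono)
  then show ?case by blast
qed (blast intro: bp_const bp_coord bp_mult)+

text \<open>Perron's argument: there are more monomials in \<open>f\<close> than monomials of the same degree in the parameters.\<close>
lemma algindep_bound:
  assumes \<Phi>: "\<And>x. polyfun m (\<lambda>z. \<Phi> z x)" and J: "zeroI \<Phi> \<subseteq> J" and f: "algindep k f J"
  shows "k \<le> m"
proof (rule ccontr)
  assume "\<not> k \<le> m"
  have "\<exists>D. bp m D (\<lambda>z. ev (f i) (\<Phi> z))" for i by (intro polyfun_bp polyfun_ev \<Phi>)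
  then obtain D0 where D0: "\<And>i. bp m (D0 i) (\<lambda>z. ev (f i) (\<Phi> z))" by metis
  define D where "D = (\<Sum>i<k. D0 i)"
  have D: "bp m D (\<lambda>z. ev (f i) (\<Phi> z))" if "i < k" for i
    by (rule bp_mono[OF D0]) (use that in \<open>auto simp: D_def intro: member_le_sum\<close>)
  \<comment> \<open>With this choice (k n D + 1)^m <= ((k D + 1) n)^m < n * n^m <= n^k because k >
    m, so the monomials in \<open>f\<close> outnumber those in the parameters.\<close>
  define n where "n = Suc ((k * D + 1) ^ m)"
  have mon: "bp m (k * (n * D)) (\<lambda>z. \<Prod>i<k. ev (f i) (\<Phi> z) ^ \<alpha> i)" if "\<alpha> \<in> expo k n" for \<alpha>
  proof (intro bp_prod bp_mono[OF bp_power[OF D]])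
    fix i assume "i < k"
    with that have "\<alpha> i < n" by (auto simp: expo_def)
    then show "\<alpha> i * D \<le> n * D" by simp
  qed
  define M where "M = (\<lambda>\<alpha>. SOME c. \<forall>z. (\<Prod>i<k. ev (f i) (\<Phi> z) ^ \<alpha> i)
      = (\<Sum>\<beta>\<in>expo m (Suc (k * (n * D))). c \<beta> * (\<Prod>i<m. z i ^ \<beta> i)))"
  have M: "(\<Prod>i<k. ev (f i) (\<Phi> z) ^ \<alpha> i)
      = (\<Sum>\<beta>\<in>expo m (Suc (k * (n * D))). M \<alpha> \<beta> * (\<Prod>i<m. z i ^ \<beta> i))" if "\<alpha> \<in> expo k n" for \<alpha> z
    using someI_ex[OF mon[OF that, unfolded bp_def]] unfolding M_def by blast
  have "Suc (k * (n * D)) ^ m \<le> ((k * D + 1) * n) ^ m"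
    by (intro power_mono) (auto simp: n_def algebra_simps)
  also have "\<dots> < n * n ^ m"
  proof -
    have "(k * D + 1) ^ m < n" "0 < n ^ m" by (simp_all add: n_def)
    then show ?thesis unfolding power_mult_distrib by (rule mult_strict_right_mono)
  qed
  also have "\<dots> \<le> n ^ k"
    using power_increasing[of "Suc m" k n] \<open>\<not> k \<le> m\<close> by (simp add: n_def)
  finally have "card (expo m (Suc (k * (n * D)))) < card (expo k n)" by (simp add: card_expo)
  from linear_dependence[OF finite_expo finite_expo this, of M]
  obtain c where c: "\<exists>\<alpha>\<in>expo k n. c \<alpha> \<noteq> 0"
    "\<And>\<beta>. \<beta> \<in> expo m (Suc (k * (n * D))) \<Longrightarrow> (\<Sum>\<alpha>\<in>expo k n. c \<alpha> * M \<alpha> \<beta>) = 0" by auto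
  have "ev (\<Sum>\<alpha>\<in>expo k n. pconst (c \<alpha>) * (\<Prod>i<k. f i ^ \<alpha> i)) (\<Phi> z) = 0" for z
  proof -
    have "ev (\<Sum>\<alpha>\<in>expo k n. pconst (c \<alpha>) * (\<Prod>i<k. f i ^ \<alpha> i)) (\<Phi> z)
      = (\<Sum>\<alpha>\<in>expo k n. c \<alpha> * (\<Sum>\<beta>\<in>expo m (Suc (k * (n * D))). M \<alpha> \<beta> * (\<Prod>i<m. z i ^ \<beta> i)))"
      by (simp add: ev_hom M)
    also have "\<dots> = (\<Sum>\<beta>\<in>expo m (Suc (k * (n * D))). \<Sum>\<alpha>\<in>expo k n. c \<alpha> * (M \<alpha> \<beta> * (\<Prod>i<m. z i ^ \<beta> i)))"
      unfolding sum_distrib_left by (rule sum.swap)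
    also have "\<dots> = (\<Sum>\<beta>\<in>expo m (Suc (k * (n * D))). (\<Sum>\<alpha>\<in>expo k n. c \<alpha> * M \<alpha> \<beta>) * (\<Prod>i<m. z i ^ \<beta> i))"
      by (simp add: sum_distrib_right mult.assoc)
    finally show ?thesis using c(2) by simp
  qed
  then have "(\<Sum>\<alpha>\<in>expo k n. pconst (c \<alpha>) * (\<Prod>i<k. f i ^ \<alpha> i)) \<in> J" using J by (auto simp: zeroI_def)
  with f c(1) show False unfolding algindep_def by blast
qed

section \<open>Krull dimension of a charted variety\<close>

text \<open>A point is the image of a constant parametrization, so the results on cones apply to
  it.\<close>

lemma vanI_point:
  assumes "valid_pt p"
  shows "vanI {p} = coneI (\<lambda>_ :: nat \<Rightarrow> complex. asg p)"
proof -
  have "vanI {topt ((\<lambda>_ :: nat \<Rightarrow> complex. asg p) z) | z. valid_pt (topt ((\<lambda>_ :: nat \<Rightarrow> complex. asg p) z))}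
      = coneI (\<lambda>_ :: nat \<Rightarrow> complex. asg p)"
    by (rule vanI_param) (use assms in \<open>auto intro: lpoly_const\<close>)
  then show ?thesis using assms by simp
qed

text \<open>Vanishing at a point means vanishing at every representative. So even at a single point,
  splitting a product requires the ideal of the cone over the point to be prime; only then do the
  zero sets of the two factors cover \<open>Z\<close>.\<close>

lemma is_prime_vanI:
  assumes Z: "mp_closed Z" "mp_irreducible Z"
  shows "is_prime (vanI Z)"
proof -
  have valid: "valid_pt p" if "p \<in> Z" for p using that Z(1) unfolding mp_closed_def Zc_def by blast
  have point: "is_prime (vanI {p})" if "p \<in> Z" for p
    unfolding vanI_point[OF valid[OF that]] by (rule coneI_prime) (rule lpoly_const)
  obtain p0 where p0: "p0 \<in> Z" using Z(2) unfolding mp_irreducible_def by blast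
  have "is_ideal (vanI Z)" unfolding is_ideal_def vanI_def by (simp add: mvanish_iff ev_hom)
  moreover have "1 \<notin> vanI Z" using point[OF p0] p0 unfolding is_prime_def vanI_def by blast
  moreover have "f \<in> vanI Z \<or> g \<in> vanI Z" if fg: "f * g \<in> vanI Z" for f g
  proof -
    have "Z \<subseteq> Zc {f} \<union> Zc {g}"
    proof
      fix p assume p: "p \<in> Z"
      have "f * g \<in> vanI {p}" using fg p unfolding vanI_def by blast
      then have "f \<in> vanI {p} \<or> g \<in> vanI {p}" using point[OF p] unfolding is_prime_def by blast
      then show "p \<in> Zc {f} \<union> Zc {g}" using valid[OF p] unfolding vanI_def Zc_def by simp
    qed
    moreover have "mp_closed (Zc {f})" "mp_closed (Zc {g})" unfolding mp_closed_def by blast+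
    ultimately have "Z \<subseteq> Zc {f} \<or> Z \<subseteq> Zc {g}" using Z(2) unfolding mp_irreducible_def by blast
    then show ?thesis unfolding vanI_def Zc_def by blast
  qed
  ultimately show ?thesis unfolding is_prime_def by blast
qed

text \<open>The three scalars are freed one after the other. \<open>J r\<close> is the ideal of the
  part of the cone where only the first \<open>r\<close> scalars vary. An equation that fixes a
  coordinate of factor \<open>r\<close> is lost once the scalar of that factor is free, which yields
  one more independent polynomial each time.\<close>

lemma algindep_point:
  assumes "valid_pt p"
  shows "\<exists>f. algindep 3 f (vanI {p})"
proof -
  define v where "v = asg p"
  obtain X where X: "\<And>b. b < 3 \<Longrightarrow> block (X b) = b \<and> v (X b) \<noteq> 0"
    using assms unfolding valid_pt_iff v_def by metis
  define J where "J r = zeroI (\<lambda>s :: nat \<Rightarrow> complex. scl (\<lambda>b. if b < r then s b else 1) v)" for r :: nat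
  have prime: "is_prime (J r)" for r
    unfolding J_def
  proof (rule zeroI_prime)
    fix x
    show "lpoly (\<lambda>s :: nat \<Rightarrow> complex. scl (\<lambda>b. if b < r then s b else 1) v x)"
      by (cases "block x < r") (auto simp: scl_def intro!: lpoly_mult lpoly_coord lpoly_const)
  qed
  have step: "\<exists>f. algindep r f (J r)" if "r \<le> 3" for r
    using that
  proof (induction r)
    case 0
    then show ?case using prime[of 0] algindep_0[of "J 0"] unfolding is_prime_def by blast
  next
    case (Suc r)
    then obtain f where f: "algindep r f (J r)" by auto
    define g where "g = pvar (X r) - pconst (v (X r))"
    have r: "block (X r) = r" "v (X r) \<noteq> 0" using X[of r] Suc.prems by auto
    have "g \<in> J r" by (simp add: J_def zeroI_def g_def ev_hom scl_def r)
    \<comment> \<open>Scaling factor \<open>r\<close> by 2 moves its nonzero coordinate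
      \<open>X r\<close> away from the old value.\<close>
    moreover have "g \<notin> J (Suc r)"
      unfolding J_def zeroI_def using r(2) by (auto simp: g_def ev_hom scl_def r(1) intro!: exI[of _ "\<lambda>_. 2"])
    moreover have "J (Suc r) \<subseteq> J r"
    proof
      fix h assume h: "h \<in> J (Suc r)"
      have "ev h (scl (\<lambda>b. if b < r then s b else 1) v) = 0" for s
      proof -
        have "(\<lambda>b. if b < Suc r then (s(r := 1)) b else 1) = (\<lambda>b. if b < r then s b else 1)"
          by auto
        moreover have "ev h (scl (\<lambda>b. if b < Suc r then (s(r := 1)) b else 1) v) = 0"
          using h unfolding J_def zeroI_def by blast
        ultimately show ?thesis by simp
      qed
      then show "h \<in> J r" unfolding J_def zeroI_def by blast
    qed
    ultimately have "algindep (Suc r) (f(r := g)) (J (Suc r))"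
      using prime f by (intro algindep_Suc[of _ "J r"]) (auto simp: is_prime_def)
    then show ?case by blast
  qed
  have "vanI {p} \<subseteq> J 3" unfolding vanI_point[OF assms] J_def coneI_def zeroI_def v_def by blast
  then show ?thesis using step[of 3] algindep_mono by blast
qed

text \<open>A point of \<open>Z 0\<close> contributes three polynomials for the scalars. Each strict
  inclusion contributes one that vanishes on the smaller set but not on the larger.\<close>

lemma algindep_chain:
  assumes "\<forall>i\<le>n. mp_closed (Z i) \<and> mp_irreducible (Z i)" "\<forall>i<n. Z i \<subset> Z (Suc i)"
  shows "\<exists>f. algindep (n + 3) f (vanI (Z n))"
  using assms
proof (induction n)
  case 0
  then obtain p where p: "p \<in> Z 0" unfolding mp_irreducible_def by blast
  then have "valid_pt p" using 0 unfolding mp_closed_def Zc_def by blast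
  from algindep_point[OF this] obtain f where "algindep 3 f (vanI {p})" by blast
  moreover have "vanI (Z 0) \<subseteq> vanI {p}" using p by (intro vanI_antimono) simp
  ultimately have "algindep 3 f (vanI (Z 0))" by (rule algindep_mono)
  then show ?case by auto
next
  case (Suc n)
  then obtain f where f: "algindep (n + 3) f (vanI (Z n))" by auto
  have sub: "Z n \<subset> Z (Suc n)" using Suc.prems by blast
  then obtain p where p: "p \<in> Z (Suc n)" "p \<notin> Z n" by blast
  obtain S where S: "Z n = Zc S" using Suc.prems unfolding mp_closed_def by (metis le_SucI order_refl)
  have "valid_pt p" using p(1) Suc.prems unfolding mp_closed_def Zc_def by blast
  then obtain g where g: "g \<in> S" "\<not> mvanish g p" using p(2) unfolding S Zc_def by blast
  have "g \<in> vanI (Z n)" using g(1) unfolding S vanI_def Zc_def by blast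
  moreover have "g \<notin> vanI (Z (Suc n))" using g(2) p(1) unfolding vanI_def by blast
  moreover have "is_prime (vanI (Z (Suc n)))" using Suc.prems by (intro is_prime_vanI) auto
  moreover have "is_ideal (vanI (Z n))" using is_prime_vanI[of "Z n"] Suc.prems unfolding is_prime_def by auto
  ultimately have "algindep (Suc (n + 3)) (f(n + 3 := g)) (vanI (Z (Suc n)))"
    using f sub by (intro algindep_Suc[of _ "vanI (Z n)"] vanI_antimono) auto
  then show ?case by auto
qed

text \<open>The polynomials \<open>g i\<close> read the parameters off a point of the cone, up to
  the scalar of one factor. They separate the sets obtained by setting parameters to zero.\<close>

definition chart :: "nat \<Rightarrow> ((nat \<Rightarrow> complex) \<Rightarrow> var \<Rightarrow> complex) \<Rightarrow> bool" where
  "chart d \<psi> \<longleftrightarrow> (\<forall>x. polyfun d (\<lambda>y. \<psi> y x)) \<and> (\<forall>y. valid_pt (topt (\<psi> y))) \<and>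
     (\<exists>g b. \<forall>i<d. b i < 3 \<and> (\<forall>s y. ev (g i) (scl s (\<psi> y)) = s (b i) * y i))"

lemma vanI_range:
  fixes \<psi> :: "(nat \<Rightarrow> complex) \<Rightarrow> var \<Rightarrow> complex"
  assumes "\<And>x. lpoly (\<lambda>y. \<psi> y x)" "\<And>y. valid_pt (topt (\<psi> y))"
  shows "vanI (range (\<lambda>y. topt (\<psi> y))) = coneI \<psi>"
proof -
  have "range (\<lambda>y. topt (\<psi> y)) = {topt (\<psi> y) | y. valid_pt (topt (\<psi> y))}" using assms(2) by blast
  then show ?thesis using vanI_param[of \<psi>, OF assms(1) assms(2)] by simp
qed

text \<open>The cone has \<open>d + 3\<close> polynomial parameters, three of them scalars, against
  the \<open>n + 3\<close> independent polynomials of a chain.\<close>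

lemma mp_dim_chart_upper:
  assumes \<psi>: "\<And>x. polyfun d (\<lambda>y. \<psi> y x)" and sub: "coneI \<psi> \<subseteq> vanI Y"
    and Z: "\<forall>i\<le>n. mp_closed (Z i) \<and> mp_irreducible (Z i) \<and> Z i \<subseteq> Y" "\<forall>i<n. Z i \<subset> Z (Suc i)"
  shows "n \<le> d"
proof -
  obtain f where f: "algindep (n + 3) f (vanI (Z n))" using algindep_chain[of n Z] Z by blast
  have "vanI Y \<subseteq> vanI (Z n)" using Z by (intro vanI_antimono) auto
  then have J: "zeroI (conemap \<psi>) \<subseteq> vanI (Z n)" using sub unfolding coneI_eq by (rule order_trans[rotated])
  have "polyfun (d + 3) (\<lambda>w. conemap \<psi> w x)" for x
    unfolding conemap_def scl_def
  proof (intro polyfun_mult polyfun_coord)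
    show "block x < d + 3" using block_less[of x] by linarith
    show "polyfun (d + 3) (\<lambda>z. \<psi> (\<lambda>i. z (i + 3)) x)"
      using polyfun_compose[of d "\<lambda>y. \<psi> y x" "d + 3" "\<lambda>z i. z (i + 3)", OF \<psi>] polyfun_coord by auto
  qed
  from algindep_bound[OF this J f] show ?thesis by simp
qed

text \<open>The chain for the lower bound lets one chart coordinate vary after the other.\<close>
lemma mp_dim_chart_lower:
  assumes "chart d \<psi>"
  defines "Z \<equiv> \<lambda>k. zclosure (range (\<lambda>y. topt (\<psi> (\<lambda>i. if i < k then y i else 0))))"
  shows "(\<forall>i\<le>d. mp_closed (Z i) \<and> mp_irreducible (Z i) \<and> Z i \<subseteq> zclosure (range (\<lambda>y. topt (\<psi> y)))) \<and>
    (\<forall>i<d. Z i \<subset> Z (Suc i))"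
proof -
  define \<psi>' where "\<psi>' k y = \<psi> (\<lambda>i. if i < k then y i else 0)" for k and y :: "nat \<Rightarrow> complex"
  have polyfun: "polyfun d (\<lambda>y. \<psi> y x)" for x using assms unfolding chart_def by blast
  have valid: "valid_pt (topt (\<psi>' k y))" for k y using assms unfolding chart_def \<psi>'_def by blast
  obtain g b where gb: "\<And>i s y. i < d \<Longrightarrow> b i < 3 \<and> ev (g i) (scl s (\<psi> y)) = s (b i) * y i"
    using assms unfolding chart_def by metis
  have lp: "lpoly (\<lambda>y. \<psi>' k y x)" for k x
  proof -
    have "polyfun d (\<lambda>y. \<psi>' k y x)"
      unfolding \<psi>'_def
    proof (rule polyfun_compose[OF polyfun])
      fix i assume "i < d"
      then show "polyfun d (\<lambda>y. if i < k then y i else 0)" by (cases "i < k") (simp_all add: polyfun_const polyfun_coord)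
    qed
    then show ?thesis by (rule polyfun_lpoly)
  qed
  have van: "vanI (range (\<lambda>y. topt (\<psi>' k y))) = coneI (\<psi>' k)" for k
    by (rule vanI_range) (rule lp, rule valid)
  have irr: "mp_irreducible (Z k)" for k
    unfolding Z_def \<psi>'_def[symmetric]
  proof (rule mp_irreducible_zclosure)
    show "is_prime (vanI (range (\<lambda>y. topt (\<psi>' k y))))" unfolding van by (rule coneI_prime) (rule lp)
  qed (use valid in auto)
  have mono: "zclosure S \<subseteq> zclosure T" if "S \<subseteq> T" for S T
    using vanI_antimono[OF that] unfolding zclosure_def Zc_def by blast
  have le: "Z k \<subseteq> zclosure (range (\<lambda>y. topt (\<psi> y)))" for k
    unfolding Z_def by (rule mono) auto
  have strict: "Z k \<subset> Z (Suc k)" if k: "k < d" for k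
  proof
    show "Z k \<subseteq> Z (Suc k)"
      unfolding Z_def
    proof (rule mono, rule image_subsetI)
      fix y :: "nat \<Rightarrow> complex"
      have "(\<lambda>i. if i < k then y i else 0) = (\<lambda>i. if i < Suc k then (if i < k then y i else 0) else 0)" by auto
      from arg_cong[OF this, of "\<lambda>z. topt (\<psi> z)"]
      show "topt (\<psi> (\<lambda>i. if i < k then y i else 0)) \<in> range (\<lambda>y. topt (\<psi> (\<lambda>i. if i < Suc k then y i else 0)))"
        by (rule range_eqI[where x = "\<lambda>i. if i < k then y i else 0"])
    qed
    \<comment> \<open>Parameter \<open>k\<close> is zero on the set that defines \<open>Z k\<close>,
      so \<open>g k\<close> vanishes on the closure; at the point with all parameters equal to 1 it
      takes the value 1.\<close>
    have "g k \<in> vanI (range (\<lambda>y. topt (\<psi>' k y)))"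
      unfolding van coneI_def using gb[OF k] by (simp add: \<psi>'_def)
    then have gz: "mvanish (g k) p" if "p \<in> Z k" for p
      using that unfolding Z_def \<psi>'_def[symmetric] zclosure_def Zc_def by blast
    let ?p = "topt (\<psi>' (Suc k) (\<lambda>_. 1))"
    have "range (\<lambda>y. topt (\<psi>' (Suc k) y)) \<subseteq> Z (Suc k)"
      unfolding Z_def \<psi>'_def[symmetric] by (rule subset_zclosure) (use valid in blast)
    then have "?p \<in> Z (Suc k)" by blast
    moreover have "\<not> mvanish (g k) ?p"
      unfolding mvanish_iff using gb[OF k] by (auto simp: \<psi>'_def intro!: exI[of _ "\<lambda>_. 1"])
    ultimately show "Z k \<noteq> Z (Suc k)" using gz by blast
  qed
  show ?thesis using irr le strict mp_closed_zclosure unfolding Z_def by blast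
qed

theorem mp_dim_chart:
  assumes \<psi>: "chart d \<psi>" and S: "vanI S = coneI \<psi>"
  shows "mp_dim (zclosure S) = enat d"
proof -
  have polyfun: "polyfun d (\<lambda>y. \<psi> y x)" and valid: "valid_pt (topt (\<psi> y))" for x y using \<psi> unfolding chart_def by blast+
  have van: "vanI (range (\<lambda>y. topt (\<psi> y))) = coneI \<psi>"
    by (rule vanI_range) (rule polyfun_lpoly, rule polyfun, rule valid)
  have eq: "zclosure S = zclosure (range (\<lambda>y. topt (\<psi> y)))"
    by (rule zclosure_cong) (simp add: S van)
  let ?C = "\<lambda>n Z. (\<forall>i\<le>n. mp_closed (Z i) \<and> mp_irreducible (Z i) \<and> Z i \<subseteq> zclosure S) \<and> (\<forall>i<n. Z i \<subset> Z (Suc i))"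
  have "coneI \<psi> \<subseteq> vanI (zclosure S)"
    unfolding eq van[symmetric] by (rule equalityD2, rule vanI_zclosure) (use valid in blast)
  then have upper: "n \<le> d" if "?C n Z" for n Z
    using mp_dim_chart_upper[of d \<psi> "zclosure S" n Z] polyfun that by blast
  have lower: "\<exists>Z. ?C d Z" unfolding eq by (rule exI) (rule mp_dim_chart_lower[OF \<psi>])
  show ?thesis
    unfolding mp_dim_def
  proof (rule antisym)
    show "Sup {enat n | n. \<exists>Z. ?C n Z} \<le> enat d"
    proof (rule Sup_least)
      fix e assume "e \<in> {enat n | n. \<exists>Z. ?C n Z}"
      then obtain n Z where "e = enat n" "?C n Z" by blast
      then show "e \<le> enat d" using upper[of n Z] by simp
    qed
    show "enat d \<le> Sup {enat n | n. \<exists>Z. ?C n Z}"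
      by (rule Sup_upper, rule CollectI, rule exI[of _ d], rule conjI, rule refl, rule lower)
  qed
qed

section \<open>Ideals by degeneration to coordinate subspaces\<close>

lemma is_ideal_ideal_gen: "is_ideal (ideal_gen G)"
  unfolding is_ideal_def
proof (intro conjI ballI allI)
  show "0 \<in> ideal_gen G" unfolding ideal_gen_def by (auto intro!: exI[of _ "{}"])
next
  fix f g assume "f \<in> ideal_gen G" "g \<in> ideal_gen G"
  then obtain F1 c1 F2 c2 where 1: "finite F1" "F1 \<subseteq> G" "f = (\<Sum>g\<in>F1. c1 g * g)"
    and 2: "finite F2" "F2 \<subseteq> G" "g = (\<Sum>g\<in>F2. c2 g * g)" unfolding ideal_gen_def by auto
  define c where "c h = (if h \<in> F1 then c1 h else 0) + (if h \<in> F2 then c2 h else 0)" for h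
  have "(\<Sum>h\<in>F1 \<union> F2. c h * h) = (\<Sum>h\<in>F1 \<union> F2. if h \<in> F1 then c1 h * h else 0) + (\<Sum>h\<in>F1 \<union> F2. if h \<in> F2 then c2 h * h else 0)"
    unfolding sum.distrib[symmetric] by (rule sum.cong) (auto simp: c_def distrib_right)
  also have "\<dots> = f + g" using 1 2 by (simp add: sum.inter_restrict[symmetric] Int_absorb1 Int_commute)
  finally show "f + g \<in> ideal_gen G"
    unfolding ideal_gen_def using 1 2 by (intro CollectI exI[of _ "F1 \<union> F2"] exI[of _ c]) simp
next
  fix f g assume "f \<in> ideal_gen G"
  then obtain F c where F: "finite F" "F \<subseteq> G" "f = (\<Sum>g\<in>F. c g * g)" unfolding ideal_gen_def by auto
  then show "g * f \<in> ideal_gen G"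
    unfolding ideal_gen_def
    by (intro CollectI exI[of _ F] exI[of _ "\<lambda>h. g * c h"]) (simp add: sum_distrib_left mult.assoc)
qed

lemma ideal_sum: "is_ideal J \<Longrightarrow> (\<And>i. i \<in> S \<Longrightarrow> f i \<in> J) \<Longrightarrow> (\<Sum>i\<in>S. f i) \<in> J"
  by (induction S rule: infinite_finite_induct) (auto simp: is_ideal_def)

lemma ideal_uminus: "is_ideal J \<Longrightarrow> f \<in> J \<Longrightarrow> - f \<in> J"
  unfolding is_ideal_def by (metis mult_minus1)

lemma ideal_diff: "is_ideal J \<Longrightarrow> f \<in> J \<Longrightarrow> g \<in> J \<Longrightarrow> f - g \<in> J"
  using ideal_uminus[of J g] unfolding is_ideal_def by (metis add_uminus_conv_diff)

lemma ideal_gen_least: "is_ideal J \<Longrightarrow> G \<subseteq> J \<Longrightarrow> ideal_gen G \<subseteq> J"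
  unfolding ideal_gen_def by (auto intro!: ideal_sum simp: is_ideal_def)

lemma ideal_gen_base: "g \<in> G \<Longrightarrow> g \<in> ideal_gen G"
  unfolding ideal_gen_def by (intro CollectI exI[of _ "{g}"] exI[of _ "\<lambda>_. 1"]) simp

lemma is_ideal_coneI: "is_ideal (coneI \<Phi>)"
  by (simp add: is_ideal_def coneI_def ev_hom)

section \<open>Weights and reduction to standard monomials\<close>

definition wt :: "(var \<Rightarrow> nat) \<Rightarrow> (var \<Rightarrow>\<^sub>0 nat) \<Rightarrow> nat" where
  "wt w m = (\<Sum>x\<in>UNIV. w x * lookup m x)"

lemma wt_add: "wt w (m + n) = wt w m + wt w n"
  by (simp add: wt_def lookup_add distrib_left sum.distrib)

definition wb :: "(var \<Rightarrow> nat) \<Rightarrow> mpoly \<Rightarrow> nat \<Rightarrow> bool" where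
  "wb w f n \<longleftrightarrow> (\<forall>m\<in>keys f. wt w m \<le> n)"

lemma wb_pvar: "wb w (pvar x) (w x)"
proof -
  have "(\<Sum>y\<in>UNIV. w y * lookup (single x (Suc 0)) y) = (\<Sum>y\<in>UNIV. if y = x then w y else 0)"
    by (rule sum.cong) (auto simp: lookup_single when_def)
  then show ?thesis by (simp add: wb_def pvar_def wt_def)
qed

lemma wb_mult: "wb w f a \<Longrightarrow> wb w g b \<Longrightarrow> wb w (f * g) (a + b)"
  unfolding wb_def using keys_mult[of f g] by (fastforce simp: wt_add intro: add_mono)

lemma wb_add: "wb w f a \<Longrightarrow> wb w g b \<Longrightarrow> wb w (f + g) (max a b)"
  unfolding wb_def using Poly_Mapping.keys_add[of f g] by fastforce

lemma wb_uminus: "wb w f a \<Longrightarrow> wb w (- f) a"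
  unfolding wb_def by (simp add: in_keys_iff)

lemma wb_diff: "wb w f a \<Longrightarrow> wb w g b \<Longrightarrow> wb w (f - g) (max a b)"
  using wb_add[of w f a "- g" b] wb_uminus[of w g b] by simp

lemmas wb_intros = wb_add wb_diff wb_uminus wb_mult wb_pvar

definition sqf :: "var set \<Rightarrow> var \<Rightarrow>\<^sub>0 nat" where
  "sqf S = (\<Sum>x\<in>S. single x 1)"

lemma lookup_sqf: "lookup (sqf S) x = (if x \<in> S then 1 else 0)"
proof -
  have "(\<Sum>y\<in>S. lookup (single y (1::nat)) x) = (\<Sum>y\<in>S. if y = x then 1 else 0)"
    by (rule sum.cong) (auto simp: lookup_single when_def)
  then show ?thesis by (simp add: sqf_def lookup_sum)
qed

lemma prod_pvar: "(\<Prod>x\<in>S. pvar x) = single (sqf S) 1"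
  unfolding sqf_def
  by (induction S rule: infinite_finite_induct) (auto simp: pvar_def mult_single)

lemma wt_sqf: "wt w (sqf S) = (\<Sum>x\<in>S. w x)"
  by (simp add: wt_def lookup_sqf if_distrib sum.If_cases cong: if_cong)

definition std :: "var set set \<Rightarrow> (var \<Rightarrow>\<^sub>0 nat) \<Rightarrow> bool" where
  "std L m \<longleftrightarrow> (\<forall>S\<in>L. \<exists>x\<in>S. lookup m x = 0)"

text \<open>The strict inequality makes the product over \<open>S\<close> the only term of top
  weight, so that a weight can do the work of a monomial order.\<close>

definition lead :: "mpoly set \<Rightarrow> (var \<Rightarrow> nat) \<Rightarrow> var set \<Rightarrow> bool" where
  "lead I w S \<longleftrightarrow> (\<exists>r n. (\<Prod>x\<in>S. pvar x) + r \<in> I \<and> wb w r n \<and> n < (\<Sum>x\<in>S. w x))"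

lemma leadI: "(\<Prod>x\<in>S. pvar x) + r \<in> H \<Longrightarrow> wb w r n \<Longrightarrow> n < (\<Sum>x\<in>S. w x) \<Longrightarrow> lead (ideal_gen H) w S"
  unfolding lead_def using ideal_gen_base by blast

text \<open>Replacing a multiple of a leading monomial by the negated rest lowers the weight, so the
  process stops. It yields existence of a remainder; that a remainder on which the cone vanishes
  must be 0 comes from \<open>degenerates_std_zero\<close>.\<close>

lemma std_reduction:
  assumes I: "is_ideal I"
    and L: "\<forall>S\<in>L. lead I w S"
  shows "\<exists>r. f - r \<in> I \<and> (\<forall>k\<in>keys r. std L k)"
proof -
  define P where "P f \<longleftrightarrow> (\<exists>r. f - r \<in> I \<and> (\<forall>k\<in>keys r. std L k))" for f
  have P_add: "P (f + g)" if fg: "P f" "P g" for f g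
  proof -
    obtain r s where rs: "f - r \<in> I" "\<forall>k\<in>keys r. std L k" "g - s \<in> I" "\<forall>k\<in>keys s. std L k"
      using fg unfolding P_def by blast
    have "(f + g) - (r + s) = (f - r) + (g - s)" by simp
    also have "\<dots> \<in> I" using rs I unfolding is_ideal_def by blast
    finally show ?thesis unfolding P_def using rs Poly_Mapping.keys_add[of r s] by (intro exI[of _ "r + s"]) blast
  qed
  have P_mult: "P (pconst c * f)" if Pf: "P f" for c f
  proof -
    obtain r where r: "f - r \<in> I" "\<forall>k\<in>keys r. std L k" using Pf unfolding P_def by blast
    have "pconst c * (f - r) \<in> I" using r I unfolding is_ideal_def by blast
    moreover have "keys (pconst c * r) \<subseteq> keys r"
      using keys_mult[of "pconst c" r] by (auto simp: pconst_def split: if_splits)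
    ultimately show ?thesis unfolding P_def using r by (intro exI[of _ "pconst c * r"]) (auto simp: algebra_simps)
  qed
  have P_sum: "P (\<Sum>m\<in>K. single m (c m))" if "\<forall>m\<in>K. P (single m 1)" "finite K" for K c
    using that(2,1)
  proof (induction K rule: finite_induct)
    case empty
    have "P 0" unfolding P_def using I by (intro exI[of _ 0]) (simp add: is_ideal_def)
    then show ?case by simp
  next
    case (insert m K)
    have "P (pconst (c m) * single m 1)" using insert by (intro P_mult) auto
    then have "P (single m (c m))" by (simp add: pconst_def mult_single)
    then show ?case using insert by (simp add: P_add)
  qed
  have mon: "P (single m 1)" for m
  proof (induction "wt w m" arbitrary: m rule: less_induct)
    case less
    show ?case
    proof (cases "std L m")
      case True
      then show ?thesis unfolding P_def using I by (intro exI[of _ "single m 1"]) (simp add: is_ideal_def)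
    next
      case False
      then obtain S where S: "S \<in> L" "\<forall>x\<in>S. lookup m x \<noteq> 0"
        unfolding std_def by auto
      obtain r n where r: "(\<Prod>x\<in>S. pvar x) + r \<in> I" "wb w r n" "n < (\<Sum>x\<in>S. w x)" using L S(1) unfolding lead_def by blast
      define m' where "m' = m - sqf S"
      have m: "m = m' + sqf S"
        using S(2) by (intro poly_mapping_eqI) (auto simp: m'_def lookup_add lookup_minus lookup_sqf)
      define h where "h = single m' 1 * r"
      have "P (single k 1)" if "k \<in> keys h" for k
      proof -
        have "\<exists>k'. k = m' + k' \<and> k' \<in> keys r"
          using that keys_mult[of "single m' 1" r] unfolding h_def by auto
        then obtain k' where k': "k = m' + k'" "k' \<in> keys r" by blast
        have "wt w k' \<le> n" using r(2) k'(2) unfolding wb_def by blast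
        then have "wt w k < wt w m" using r(3) by (simp add: k' m wt_add wt_sqf)
        then show ?thesis by (rule less)
      qed
      then have "P h" using P_sum[of "keys h" "lookup h"] sum_single_keys[of h] by simp
      then obtain s where s: "h - s \<in> I" "\<forall>k\<in>keys s. std L k" unfolding P_def by blast
      have "single m' 1 * ((\<Prod>x\<in>S. pvar x) + r) \<in> I" using r(1) I unfolding is_ideal_def by blast
      moreover have "single m' 1 * ((\<Prod>x\<in>S. pvar x) + r) = single m 1 + h"
        by (simp add: prod_pvar h_def distrib_left mult_single m)
      ultimately have "(single m 1 + h) - (h - s) \<in> I" using ideal_diff[OF I] s(1) by metis
      then have "single m 1 - (- s) \<in> I" by (simp add: algebra_simps)
      moreover have "\<forall>k\<in>keys (- s). std L k" using s(2) by (simp add: in_keys_iff)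
      ultimately show ?thesis unfolding P_def by blast
    qed
  qed
  have "P (\<Sum>m\<in>keys f. single m (lookup f m))"
    by (rule P_sum) (use mon in auto)
  then show ?thesis using sum_single_keys[of f] unfolding P_def by simp
qed

text \<open>\<open>N\<close> is the set of coordinates that vanish on one component of the degeneration of the cone under
  the weight \<open>w\<close>; the sequence \<open>p\<close> tends to a general point of that component.\<close>
definition degenerates :: "mpoly set \<Rightarrow> (var \<Rightarrow> nat) \<Rightarrow> var set \<Rightarrow> bool" where
  "degenerates J w N \<longleftrightarrow> (\<exists>h. h \<noteq> 0 \<and> (\<forall>v. ev h v \<noteq> 0 \<longrightarrow>
     (\<exists>p. (\<forall>x. (\<lambda>n. p n x / of_nat n ^ w x) \<longlonglongrightarrow> (if x \<in> N then 0 else v x)) \<and>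
          (\<forall>\<^sub>F n in sequentially. \<forall>f\<in>J. ev f (p n) = 0))))"

text \<open>Take a monomial of top weight \<open>D\<close> in \<open>r\<close> and a component on
  which it survives. Along the sequence \<open>p\<close>, the value of \<open>r\<close> divided by
  \<open>n ^ D\<close> tends to the value of the surviving top part \<open>g\<close> at a general
  point, which is nonzero; but \<open>r\<close> vanishes along the sequence.\<close>

lemma degenerates_std_zero:
  assumes r: "r \<in> J" and deg: "\<And>k. k \<in> keys r \<Longrightarrow> \<exists>N. degenerates J w N \<and> (\<forall>x\<in>N. lookup k x = 0)"
  shows "r = 0"
proof (rule ccontr)
  assume "r \<noteq> 0"
  define K where "K = keys r"
  have K: "finite K" "K \<noteq> {}" using \<open>r \<noteq> 0\<close> by (auto simp: K_def)
  define D where "D = Max (wt w ` K)"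
  have "D \<in> wt w ` K" unfolding D_def using K by (intro Max_in) auto
  then obtain m0 where m0: "m0 \<in> K" "wt w m0 = D" by blast
  have D: "wt w m \<le> D" if "m \<in> K" for m unfolding D_def using that K by auto
  obtain N where N: "degenerates J w N" "\<forall>x\<in>N. lookup m0 x = 0" using deg m0 unfolding K_def by blast
  \<comment> \<open>The monomials that survive in the limit: those of top weight without a variable
    from \<open>N\<close>.\<close>
  define T where "T = {m \<in> K. wt w m = D \<and> (\<forall>x\<in>N. lookup m x = 0)}"
  have T: "finite T" "T \<subseteq> K" "m0 \<in> T" using K m0 N(2) by (auto simp: T_def)
  define g where "g = (\<Sum>m\<in>T. single m (lookup r m))"
  have "lookup g m0 = (\<Sum>m\<in>T. if m = m0 then lookup r m else 0)"
    unfolding g_def lookup_sum by (rule sum.cong) (auto simp: lookup_single when_def)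
  also have "\<dots> \<noteq> 0" using T m0 by (simp add: K_def in_keys_iff)
  finally have "g \<noteq> 0" by auto
  obtain h where h: "h \<noteq> 0" "\<And>v. ev h v \<noteq> 0 \<Longrightarrow>
     \<exists>p. (\<forall>x. (\<lambda>n. p n x / of_nat n ^ w x) \<longlonglongrightarrow> (if x \<in> N then 0 else v x)) \<and>
          (\<forall>\<^sub>F n in sequentially. \<forall>f\<in>J. ev f (p n) = 0)"
    using N(1) unfolding degenerates_def by blast
  obtain u u' where u: "ev g u \<noteq> 0" "ev h u' \<noteq> 0" using ev_nonzero[OF \<open>g \<noteq> 0\<close>] ev_nonzero[OF h(1)] by blast
  have lp: "lpoly (\<lambda>v. ev f v)" for f by (rule lpoly_ev) (rule lpoly_coord)
  from lpoly_nonzero_both[OF lp[of g] lp[of h], of u u'] u obtain v where v: "ev g v \<noteq> 0" "ev h v \<noteq> 0" by blast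
  obtain p where p: "\<And>x. (\<lambda>n. p n x / of_nat n ^ w x) \<longlonglongrightarrow> (if x \<in> N then 0 else v x)"
    "\<forall>\<^sub>F n in sequentially. \<forall>f\<in>J. ev f (p n) = 0" using h(2)[OF v(2)] by blast
  define q where "q n x = p n x / of_nat n ^ w x" for n x
  \<comment> \<open>For positive \<open>n\<close> this is \<open>r\<close> at \<open>p n\<close>
    divided by \<open>n ^ D\<close>; a monomial of weight below \<open>D\<close> keeps a positive
    power of 1/n.\<close>
  define R where "R n = (\<Sum>m\<in>K. lookup r m * inverse (of_nat n) ^ (D - wt w m) * (\<Prod>x\<in>UNIV. q n x ^ lookup m x))" for n
  have "R \<longlonglongrightarrow> (\<Sum>m\<in>K. lookup r m * 0 ^ (D - wt w m) * (\<Prod>x\<in>UNIV. (if x \<in> N then 0 else v x) ^ lookup m x))"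
    unfolding R_def q_def by (intro tendsto_intros p lim_inverse_n)
  also have "(\<Sum>m\<in>K. lookup r m * 0 ^ (D - wt w m) * (\<Prod>x\<in>UNIV. (if x \<in> N then 0 else v x) ^ lookup m x))
    = (\<Sum>m\<in>K. if m \<in> T then lookup r m * (\<Prod>x\<in>UNIV. v x ^ lookup m x) else 0)"
  proof (rule sum.cong)
    fix m assume m: "m \<in> K"
    consider "m \<in> T" | "wt w m < D" | x where "x \<in> N" "lookup m x \<noteq> 0"
      using D[OF m] m unfolding T_def by force
    then show "lookup r m * 0 ^ (D - wt w m) * (\<Prod>x\<in>UNIV. (if x \<in> N then 0 else v x) ^ lookup m x)
      = (if m \<in> T then lookup r m * (\<Prod>x\<in>UNIV. v x ^ lookup m x) else 0)"
    proof cases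
      case 1
      then have "(\<Prod>x\<in>UNIV. (if x \<in> N then 0 else v x) ^ lookup m x) = (\<Prod>x\<in>UNIV. v x ^ lookup m x)"
        by (intro prod.cong) (auto simp: T_def)
      with 1 show ?thesis by (simp add: T_def)
    next
      case 2
      then show ?thesis by (auto simp: T_def)
    next
      case 3
      then have "(\<Prod>x\<in>UNIV. (if x \<in> N then 0 else v x) ^ lookup m x) = 0"
        by (intro prod_zero) auto
      with 3 show ?thesis by (auto simp: T_def)
    qed
  qed simp
  also have "\<dots> = ev g v"
    using T K by (simp add: g_def ev_hom ev_def[of _ v] peval_single[OF scalar_hom_id] peval_sum[OF scalar_hom_id] sum.If_cases Int_absorb1)
  finally have "R \<longlonglongrightarrow> ev g v" .
  moreover have "R \<longlonglongrightarrow> 0"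
  proof (rule tendsto_eventually)
    show "\<forall>\<^sub>F n in sequentially. R n = 0"
      using p(2) eventually_gt_at_top[of 0]
    proof eventually_elim
      case (elim n)
      have n: "of_nat n \<noteq> (0::complex)" using elim by simp
      have "R n = (\<Sum>m\<in>K. lookup r m * (\<Prod>x\<in>UNIV. p n x ^ lookup m x)) / of_nat n ^ D"
        unfolding R_def sum_divide_distrib
      proof (rule sum.cong)
        fix m assume m: "m \<in> K"
        have "(\<Prod>x\<in>UNIV. q n x ^ lookup m x) = (\<Prod>x\<in>UNIV. p n x ^ lookup m x) / of_nat n ^ wt w m"
          by (simp add: q_def power_divide prod_dividef wt_def power_sum power_mult)
        moreover have "(of_nat n :: complex) ^ D = of_nat n ^ (D - wt w m) * of_nat n ^ wt w m"
          using D[OF m] by (simp flip: power_add)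
        ultimately show "lookup r m * inverse (of_nat n) ^ (D - wt w m) * (\<Prod>x\<in>UNIV. q n x ^ lookup m x)
          = lookup r m * (\<Prod>x\<in>UNIV. p n x ^ lookup m x) / of_nat n ^ D"
          using n by (simp add: field_simps)
      qed simp
      also have "\<dots> = 0" using elim r by (simp add: ev_eq K_def)
      finally show ?case .
    qed
  qed
  ultimately show False using v(1) LIMSEQ_unique by blast
qed

text \<open>The remainder of an element of \<open>J\<close> modulo \<open>I\<close> lies in
  \<open>J\<close> and is a combination of standard monomials. Each of them is visible on a subspace
  from \<open>F\<close>, so the remainder is zero.\<close>

theorem ideal_eq_by_degeneration:
  assumes "is_ideal I" "is_ideal J" "I \<subseteq> J"
    and L: "\<forall>S\<in>L. lead I w S"
    and F: "\<And>m. std L m \<Longrightarrow> \<exists>N\<in>F. \<forall>x\<in>N. lookup m x = 0"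
    and deg: "\<And>N. N \<in> F \<Longrightarrow> degenerates J w N"
  shows "J = I"
proof
  show "J \<subseteq> I"
  proof
    fix f assume f: "f \<in> J"
    obtain r where r: "f - r \<in> I" "\<forall>k\<in>keys r. std L k" using std_reduction[OF assms(1) L] by blast
    have "f - (f - r) \<in> J" using ideal_diff[OF assms(2) f, of "f - r"] r(1) assms(3) by blast
    then have "r = 0" using r(2) F deg by (intro degenerates_std_zero[of r J w]) (simp, blast)
    then show "f \<in> I" using r(1) by simp
  qed
qed (rule assms)

section \<open>Coordinate changes on the product of image planes\<close>

definition Es :: "(var \<Rightarrow> mpoly) \<Rightarrow> (var \<Rightarrow> complex) \<Rightarrow> var \<Rightarrow> complex" where
  "Es \<sigma> v = (\<lambda>x. ev (\<sigma> x) v)"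

lemma ev_subst_Es: "ev (subst \<sigma> f) v = ev f (Es \<sigma> v)"
  by (simp add: ev_subst Es_def)

text \<open>The three factors may be permuted: the involution \<open>\<pi>\<close> records which
  scalar acts where. The identity serves for new bases of the planes, a transposition for exchanging
  two views.\<close>

definition coord_change :: "(var \<Rightarrow> mpoly) \<Rightarrow> (var \<Rightarrow> mpoly) \<Rightarrow> (nat \<Rightarrow> nat) \<Rightarrow> bool" where
  "coord_change \<sigma> \<tau> \<pi> \<longleftrightarrow> (\<forall>v. Es \<sigma> (Es \<tau> v) = v) \<and> (\<forall>v. Es \<tau> (Es \<sigma> v) = v) \<and>
     (\<forall>s v. scl s (Es \<sigma> v) = Es \<sigma> (scl (s \<circ> \<pi>) v)) \<and> (\<forall>b. \<pi> (\<pi> b) = b) \<and> (\<forall>b<3. \<pi> b < 3) \<and>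
     (\<forall>v. valid_pt (topt v) \<longrightarrow> valid_pt (topt (Es \<sigma> v)))"

lemma coneI_coord_change:
  assumes "coord_change \<sigma> \<tau> \<pi>"
  shows "f \<in> coneI (\<lambda>y. Es \<sigma> (\<phi> y)) \<longleftrightarrow> subst \<sigma> f \<in> coneI \<phi>"
proof -
  have 1: "scl s (Es \<sigma> v) = Es \<sigma> (scl (s \<circ> \<pi>) v)" for s v using assms unfolding coord_change_def by blast
  have 2: "Es \<sigma> (scl s v) = scl (s \<circ> \<pi>) (Es \<sigma> v)" for s v
  proof -
    have "(s \<circ> \<pi>) \<circ> \<pi> = s" using assms unfolding coord_change_def by (simp add: fun_eq_iff)
    then show ?thesis using 1[of "s \<circ> \<pi>" v] by simp
  qed
  have "(\<forall>s y. ev f (scl s (Es \<sigma> (\<phi> y))) = 0) \<longleftrightarrow> (\<forall>s y. ev f (Es \<sigma> (scl s (\<phi> y))) = 0)"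
    by (metis 1 2)
  then show ?thesis by (simp add: coneI_def ev_subst_Es)
qed

lemma coneI_coord_change_ideal:
  assumes c: "coord_change \<sigma> \<tau> \<pi>" and G: "coneI \<phi> = ideal_gen G"
  shows "coneI (\<lambda>y. Es \<sigma> (\<phi> y)) = ideal_gen (subst \<tau> ` G)"
proof -
  have inv: "subst \<sigma> (subst \<tau> f) = f" "subst \<tau> (subst \<sigma> f) = f" for f
    using c unfolding coord_change_def by (auto intro!: ev_inject simp: ev_subst_Es)
  show ?thesis
  proof
    show "ideal_gen (subst \<tau> ` G) \<subseteq> coneI (\<lambda>y. Es \<sigma> (\<phi> y))"
    proof (rule ideal_gen_least[OF is_ideal_coneI], safe)
      fix g assume "g \<in> G"
      then show "subst \<tau> g \<in> coneI (\<lambda>y. Es \<sigma> (\<phi> y))"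
        unfolding coneI_coord_change[OF c] inv G by (rule ideal_gen_base)
    qed
    show "coneI (\<lambda>y. Es \<sigma> (\<phi> y)) \<subseteq> ideal_gen (subst \<tau> ` G)"
    proof
      fix f assume "f \<in> coneI (\<lambda>y. Es \<sigma> (\<phi> y))"
      then have "subst \<sigma> f \<in> ideal_gen G" unfolding coneI_coord_change[OF c] G .
      then obtain F k where F: "finite F" "F \<subseteq> G" "subst \<sigma> f = (\<Sum>g\<in>F. k g * g)" unfolding ideal_gen_def by auto
      have "f = subst \<tau> (\<Sum>g\<in>F. k g * g)" using F(3) inv(2) by metis
      also have "\<dots> = (\<Sum>g\<in>F. subst \<tau> (k g) * subst \<tau> g)" by (simp add: subst_hom)
      also have "\<dots> \<in> ideal_gen (subst \<tau> ` G)"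
      proof (rule ideal_sum[OF is_ideal_ideal_gen])
        fix g assume "g \<in> F"
        then have "subst \<tau> g \<in> ideal_gen (subst \<tau> ` G)" using F(2) by (intro ideal_gen_base) blast
        then show "subst \<tau> (k g) * subst \<tau> g \<in> ideal_gen (subst \<tau> ` G)"
          using is_ideal_ideal_gen unfolding is_ideal_def by blast
      qed
      finally show "f \<in> ideal_gen (subst \<tau> ` G)" .
    qed
  qed
qed

lemma chart_coord_change:
  assumes c: "coord_change \<sigma> \<tau> \<pi>" and \<phi>: "chart d \<phi>"
  shows "chart d (\<lambda>y. Es \<sigma> (\<phi> y))"
proof -
  have polyfun: "polyfun d (\<lambda>y. \<phi> y x)" and valid: "valid_pt (topt (\<phi> y))" for x y using \<phi> unfolding chart_def by blast+
  obtain g b where gb: "\<And>i s y. i < d \<Longrightarrow> b i < 3 \<and> ev (g i) (scl s (\<phi> y)) = s (b i) * y i"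
    using \<phi> unfolding chart_def by metis
  have "polyfun d (\<lambda>y. Es \<sigma> (\<phi> y) x)" for x unfolding Es_def by (rule polyfun_ev) (rule polyfun)
  moreover have "valid_pt (topt (Es \<sigma> (\<phi> y)))" for y using c valid unfolding coord_change_def by blast
  moreover have "\<pi> (b i) < 3 \<and> (\<forall>s y. ev (subst \<tau> (g i)) (scl s (Es \<sigma> (\<phi> y))) = s (\<pi> (b i)) * y i)" if "i < d" for i
  proof -
    have "ev (subst \<tau> (g i)) (scl s (Es \<sigma> (\<phi> y))) = s (\<pi> (b i)) * y i" for s y
    proof -
      have "Es \<tau> (scl s (Es \<sigma> (\<phi> y))) = scl (s \<circ> \<pi>) (\<phi> y)" using c unfolding coord_change_def by metis
      then show ?thesis using gb[OF that] by (simp add: ev_subst_Es)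
    qed
    then show ?thesis using gb[OF that] c unfolding coord_change_def by blast
  qed
  ultimately show ?thesis unfolding chart_def
    by (intro conjI allI exI[of _ "\<lambda>i. subst \<tau> (g i)"] exI[of _ "\<lambda>i. \<pi> (b i)"]) blast+
qed

section \<open>The four normal forms\<close>

text \<open>In normal coordinates the three cameras forget the coordinates 1, 2 and 3 of \<open>P^3\<close>. The digit in
  the name of a variable is the coordinate of \<open>P^3\<close> that it records.\<close>
abbreviation (input) va2 :: var where "va2 \<equiv> Inl 1"
abbreviation (input) va3 :: var where "va3 \<equiv> Inl 2"
abbreviation (input) va4 :: var where "va4 \<equiv> Inl 3"
abbreviation (input) vb1 :: var where "vb1 \<equiv> Inr (Inl 1)"
abbreviation (input) vb3 :: var where "vb3 \<equiv> Inr (Inl 2)"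
abbreviation (input) vb4 :: var where "vb4 \<equiv> Inr (Inl 3)"
abbreviation (input) vc1 :: var where "vc1 \<equiv> Inr (Inr 1)"
abbreviation (input) vc2 :: var where "vc2 \<equiv> Inr (Inr 2)"
abbreviation (input) vc4 :: var where "vc4 \<equiv> Inr (Inr 3)"

definition mkv where
  "mkv a a' a'' b b' b'' c c' c'' = asg (vector [a, a', a''], vector [b, b', b''], vector [c, c', c''])"

lemma mkv_simps [simp]:
  "mkv a a' a'' b b' b'' c c' c'' va2 = a" "mkv a a' a'' b b' b'' c c' c'' va3 = a'" "mkv a a' a'' b b' b'' c c' c'' va4 = a''"
  "mkv a a' a'' b b' b'' c c' c'' vb1 = b" "mkv a a' a'' b b' b'' c c' c'' vb3 = b'" "mkv a a' a'' b b' b'' c c' c'' vb4 = b''"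
  "mkv a a' a'' b b' b'' c c' c'' vc1 = c" "mkv a a' a'' b b' b'' c c' c'' vc2 = c'" "mkv a a' a'' b b' b'' c c' c'' vc4 = c''"
  by (simp_all add: mkv_def vector_3)

lemma all_vars: "(\<forall>x::var. P x) \<longleftrightarrow> P va2 \<and> P va3 \<and> P va4 \<and> P vb1 \<and> P vb3 \<and> P vb4 \<and> P vc1 \<and> P vc2 \<and> P vc4"
  by (simp add: all_var forall_3)

lemma neq_3 [simp]: "(1::3) \<noteq> 2" "(2::3) \<noteq> 1" "(1::3) \<noteq> 3" "(3::3) \<noteq> 1" "(2::3) \<noteq> 3" "(3::3) \<noteq> 2"
  by auto

lemma eventually_at_0_nonzero:
  fixes D :: "complex \<Rightarrow> complex"
  assumes "isCont D 0" "D 0 \<noteq> 0"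
  shows "\<forall>\<^sub>F e in at 0. e \<noteq> 0 \<and> D e \<noteq> 0"
  using tendsto_imp_eventually_ne[of D "D 0" "at 0" 0] assms
  by (auto simp: isCont_def eventually_conj_iff eventually_neq_at_within)

text \<open>The sequence is a curve sampled at e = 1/n. Dividing by \<open>e ^ w x\<close> cancels
  the weighted scaling in the definition, so the limit is just the value of \<open>q\<close> at
  0.\<close>

lemma degeneratesI:
  assumes h: "h \<noteq> 0"
    and curve: "\<And>v. \<forall>x. v x \<noteq> 0 \<Longrightarrow> ev h v \<noteq> 0 \<Longrightarrow>
      \<exists>q. (\<forall>x. isCont (\<lambda>e. q e x) 0) \<and> (\<forall>x. q 0 x = (if x \<in> N then 0 else v x)) \<and>
        (\<forall>\<^sub>F e in at 0. \<forall>f\<in>J. ev f (\<lambda>x. q e x / e ^ w x) = 0)"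
  shows "degenerates J w N"
proof -
  \<comment> \<open>The extra factor restricts general points to those without a zero coordinate, so
    the curves may divide by coordinates.\<close>
  define h' where "h' = (\<Prod>x\<in>UNIV. pvar x) * h"
  obtain u where u: "ev h u \<noteq> 0" using ev_nonzero[OF h] by blast
  have lp: "lpoly (\<lambda>v. ev f v)" for f by (rule lpoly_ev) (rule lpoly_coord)
  have one: "ev (\<Prod>x\<in>UNIV. pvar x) (\<lambda>_. 1) \<noteq> 0" by (simp add: ev_hom)
  obtain v0 where "ev (\<Prod>x\<in>UNIV. pvar x) v0 \<noteq> 0 \<and> ev h v0 \<noteq> 0"
    using lpoly_nonzero_both[OF lp[of "\<Prod>x\<in>UNIV. pvar x"] lp[of h], of "\<lambda>_. 1" u] one u by blast
  then have "ev h' v0 \<noteq> 0" by (simp add: h'_def ev_hom)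
  then have "h' \<noteq> 0" by (auto simp: ev_hom)
  moreover have "\<exists>p. (\<forall>x. (\<lambda>n. p n x / of_nat n ^ w x) \<longlonglongrightarrow> (if x \<in> N then 0 else v x)) \<and>
          (\<forall>\<^sub>F n in sequentially. \<forall>f\<in>J. ev f (p n) = 0)" if v: "ev h' v \<noteq> 0" for v
  proof -
    obtain q where q: "\<And>x. isCont (\<lambda>e. q e x) 0" "\<And>x. q 0 x = (if x \<in> N then 0 else v x)"
        "\<forall>\<^sub>F e in at 0. \<forall>f\<in>J. ev f (\<lambda>x. q e x / e ^ w x) = 0"
      using curve[of v] v by (auto simp: h'_def ev_hom)
    define e where "e n = (inverse (of_nat n) :: complex)" for n
    have e0: "e \<longlonglongrightarrow> 0" unfolding e_def by (rule lim_inverse_n)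
    have ne: "\<forall>\<^sub>F n in sequentially. e n \<noteq> 0"
      using eventually_gt_at_top[of 0] by eventually_elim (simp add: e_def)
    have lim: "filterlim e (at 0) sequentially" using e0 ne by (simp add: filterlim_at)
    define p where "p n x = q (e n) x / e n ^ w x" for n x
    have "(\<lambda>n. p n x / of_nat n ^ w x) \<longlonglongrightarrow> (if x \<in> N then 0 else v x)" for x
    proof (rule Lim_transform_eventually)
      show "(\<lambda>n. q (e n) x) \<longlonglongrightarrow> (if x \<in> N then 0 else v x)"
        using isCont_tendsto_compose[OF q(1) e0, of x] q(2) by simp
      show "\<forall>\<^sub>F n in sequentially. q (e n) x = p n x / of_nat n ^ w x"
        using eventually_gt_at_top[of 0]
        by eventually_elim (simp add: p_def e_def power_inverse divide_inverse)
    qed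
    moreover have "\<forall>\<^sub>F n in sequentially. \<forall>f\<in>J. ev f (p n) = 0"
      using eventually_compose_filterlim[OF q(3) lim] unfolding p_def .
    ultimately show ?thesis by blast
  qed
  ultimately show ?thesis unfolding degenerates_def by blast
qed

text \<open>\<open>D v\<close> collects the denominators of the curve that depend on e; being
  nonzero at 0, it is nonzero nearby. The polynomial \<open>h\<close> excludes further special
  values of \<open>v\<close>.\<close>

lemma degenerates_curve:
  fixes D :: "(var \<Rightarrow> complex) \<Rightarrow> complex \<Rightarrow> complex"
  assumes "ev h u \<noteq> 0"
    and "\<And>v. \<forall>x. v x \<noteq> 0 \<Longrightarrow> ev h v \<noteq> 0 \<Longrightarrow> \<forall>x. isCont (\<lambda>e. q v e x) 0"
    and "\<And>v. \<forall>x. v x \<noteq> 0 \<Longrightarrow> ev h v \<noteq> 0 \<Longrightarrow> \<forall>x. q v 0 x = (if x \<in> N then 0 else v x)"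
    and "\<And>v. \<forall>x. v x \<noteq> 0 \<Longrightarrow> ev h v \<noteq> 0 \<Longrightarrow> isCont (D v) 0 \<and> D v 0 \<noteq> 0"
    and "\<And>v e f. \<forall>x. v x \<noteq> 0 \<Longrightarrow> ev h v \<noteq> 0 \<Longrightarrow> e \<noteq> 0 \<Longrightarrow> D v e \<noteq> 0 \<Longrightarrow> f \<in> J \<Longrightarrow>
      ev f (\<lambda>x. q v e x / e ^ w x) = 0"
  shows "degenerates J w N"
proof (rule degeneratesI[where h = h])
  show "h \<noteq> 0" using assms(1) by (auto simp: ev_hom)
  fix v :: "var \<Rightarrow> complex" assume v: "\<forall>x. v x \<noteq> 0" "ev h v \<noteq> 0"
  have "\<forall>\<^sub>F e in at 0. e \<noteq> 0 \<and> D v e \<noteq> 0"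
    using assms(4)[OF v] by (intro eventually_at_0_nonzero) auto
  then have "\<forall>\<^sub>F e in at 0. \<forall>f\<in>J. ev f (\<lambda>x. q v e x / e ^ w x) = 0"
    by (rule eventually_mono) (use assms(5)[OF v] in blast)
  then show "\<exists>q. (\<forall>x. isCont (\<lambda>e. q e x) 0) \<and> (\<forall>x. q 0 x = (if x \<in> N then 0 else v x)) \<and>
        (\<forall>\<^sub>F e in at 0. \<forall>f\<in>J. ev f (\<lambda>x. q e x / e ^ w x) = 0)"
    using assms(2,3)[OF v] by (intro exI[of _ "q v"]) blast
qed

lemma coneI_ev: "f \<in> coneI \<phi> \<Longrightarrow> v = scl s (\<phi> y) \<Longrightarrow> ev f v = 0"
  by (simp add: coneI_def)

lemma less_3_iff: "(\<forall>b<3. Q b) \<longleftrightarrow> Q 0 \<and> Q 1 \<and> Q (2::nat)"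
  by (auto simp: less_Suc_eq numeral_3_eq_3 numeral_2_eq_2)

lemmas degenerates_polynomial_curve =
  degenerates_curve[where h = 1 and u = "\<lambda>_. 1" and D = "\<lambda>v e. 1"]

section \<open>Three lines\<close>

definition chart_LLL :: "(nat \<Rightarrow> complex) \<Rightarrow> var \<Rightarrow> complex" where
  "chart_LLL y = mkv 1 (- y 2 * y 0) (y 3 - y 2 * y 1) 1 (y 0) (y 1) (y 2) 1 (y 3)"

text \<open>Origin of the chart: l' = (1, y0, y1) and l'' = (y2, 1, y3) back-project to the planes
  (1, 0, y0, y1) and (y2, 1, 0, y3). The second minus y2 times the first is (0, 1, - y2 y0, y3 - y2
  y1), the plane of their pencil through the center of \<open>A0\<close>; it determines l.\<close>

lemma chart_LLL: "chart 4 chart_LLL"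
  unfolding chart_def
proof (intro conjI)
  show "\<forall>x. polyfun 4 (\<lambda>y. chart_LLL y x)"
    by (simp add: all_vars chart_LLL_def polyfun_intros)
  have "chart_LLL y va2 \<noteq> 0" "chart_LLL y vb1 \<noteq> 0" "chart_LLL y vc2 \<noteq> 0" for y
    by (simp_all add: chart_LLL_def)
  then show "\<forall>y. valid_pt (topt (chart_LLL y))"
    unfolding valid_pt_iff asg_topt less_3_iff by (metis block_simps)
  show "\<exists>g b. \<forall>i<4. b i < 3 \<and> (\<forall>s y. ev (g i) (scl s (chart_LLL y)) = s (b i) * y i)"
    by (rule exI[of _ "\<lambda>i. pvar ([vb3, vb4, vc1, vc4] ! i)"], rule exI[of _ "\<lambda>i. [1, 1, 2, 2] ! i"])
      (auto simp: ev_hom scl_def chart_LLL_def less_Suc_eq numeral_eq_Suc)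
qed

text \<open>Where the three normalized coordinates are nonzero, two equations determine l from l'
  and l''. This is the membership test for the cone, applied both to the degenerating curves and to
  flags.\<close>

lemma cone_LLL:
  assumes "f \<in> coneI chart_LLL" "v va2 \<noteq> 0" "v vb1 \<noteq> 0" "v vc2 \<noteq> 0"
    "v va4 * v vb1 * v vc2 = v va2 * (v vb1 * v vc4 - v vc1 * v vb4)" "v va3 * v vb1 * v vc2 = - v vc1 * v va2 * v vb3"
  shows "ev f v = 0"
proof -
  have "v = scl (\<lambda>b. if b = 0 then v va2 else if b = 1 then v vb1 else v vc2)
      (chart_LLL (\<lambda>i. if i = 0 then v vb3 / v vb1 else if i = 1 then v vb4 / v vb1 else if i = 2 then v vc1 / v vc2 else v vc4 / v vc2))"
    using assms(2-) by (simp add: fun_eq_iff all_vars scl_def chart_LLL_def field_simps)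
  then show ?thesis by (rule coneI_ev[OF assms(1)])
qed

text \<open>In \<open>gens_LLL\<close> and its analogues below the leading monomial for the weight is written first; the sets
  of vanishing coordinates are the minimal sets meeting all leading monomials.\<close>
definition w_LLL :: "var \<Rightarrow> nat" where
  "w_LLL x = (if x = va3 then 1 else if x = va4 then 2 else 0)"

definition faces_LLL :: "var set set" where
  "faces_LLL = {{va4, vb1}, {va4, vc2}, {va3, va4}, {vb3, vb1}, {vb3, vc2}, {vc1, vc2}}"

text \<open>Each \<open>N\<close> has two elements, the codimension of the cone. The equations of
  \<open>cone_LLL\<close>, written for the coordinates divided by \<open>e ^ w_LLL x\<close>, are
  solved for the coordinates in \<open>N\<close>; the solutions tend to 0 with e, and the other
  coordinates stay free.\<close>

lemma degenerates_LLL: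
  assumes "N \<in> faces_LLL"
  shows "degenerates (coneI chart_LLL) w_LLL N"
proof -
  note s = all_vars ev_hom w_LLL_def
  consider "N = {va4, vb1}" | "N = {va4, vc2}" | "N = {va3, va4}" | "N = {vb3, vb1}" | "N = {vb3, vc2}" | "N = {vc1, vc2}" using assms by (auto simp: faces_LLL_def)
  then show ?thesis
  proof cases
    case 1
    show ?thesis unfolding 1
      by (rule degenerates_polynomial_curve[where q = "\<lambda>v e. v(va4 := e^2 * v va2 * v vc4 / v vc2 + e * v vb4 * v va3 / v vb3, vb1 := - e * v vc1 * v va2 * v vb3 / (v vc2 * v va3))"])
        (auto intro!: cone_LLL simp: s; (simp add: divide_simps)?; (simp add: algebra_simps power2_eq_square power3_eq_cube)?)+
  next
    case 2
    show ?thesis unfolding 2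
      by (rule degenerates_polynomial_curve[where q = "\<lambda>v e. v(va4 := - e * v va3 * (v vb1 * v vc4 - v vc1 * v vb4) / (v vc1 * v vb3), vc2 := - e * v vc1 * v va2 * v vb3 / (v vb1 * v va3))"])
        (auto intro!: cone_LLL simp: s; (simp add: divide_simps)?; (simp add: algebra_simps power2_eq_square power3_eq_cube)?)+
  next
    case 3
    show ?thesis unfolding 3
      by (rule degenerates_polynomial_curve[where q = "\<lambda>v e. v(va3 := - e * v vc1 * v va2 * v vb3 / (v vb1 * v vc2), va4 := e^2 * v va2 * (v vb1 * v vc4 - v vc1 * v vb4) / (v vb1 * v vc2))"])
        (auto intro!: cone_LLL simp: s; (simp add: divide_simps)?; (simp add: algebra_simps power2_eq_square power3_eq_cube)?)+
  next
    case 4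
    show ?thesis unfolding 4
      by (rule degenerates_curve[where h = "1" and u = "\<lambda>_. 1" and D = "\<lambda>v e. v va4 * v vc2 - e^2 * v va2 * v vc4" and
          q = "\<lambda>v e. v(vb3 := e * v va3 * v vc2 * v vb4 / (v va4 * v vc2 - e^2 * v va2 * v vc4), vb1 := - (e^2) * v va2 * v vc1 * v vb4 / (v va4 * v vc2 - e^2 * v va2 * v vc4))"])
        (auto intro!: cone_LLL simp: s; (simp add: divide_simps)?; (simp add: algebra_simps power2_eq_square power3_eq_cube)?)+
  next
    case 5
    \<comment> \<open>Here \<open>h\<close> keeps the entry at \<open>vc2\<close> nonzero along the
      curve, as \<open>cone_LLL\<close> demands.\<close>
    show ?thesis unfolding 5
      by (rule degenerates_curve[where h = "pvar vb1 * pvar vc4 - pvar vc1 * pvar vb4" and u = "mkv 1 1 1 1 1 1 1 1 2" and D = "\<lambda>v e. 1" and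
          q = "\<lambda>v e. v(vb3 := - e * v va3 * (v vb1 * v vc4 - v vc1 * v vb4) / (v va4 * v vc1), vc2 := e^2 * v va2 * (v vb1 * v vc4 - v vc1 * v vb4) / (v va4 * v vb1))"])
        (auto intro!: cone_LLL simp: s; (simp add: divide_simps)?; (simp add: algebra_simps power2_eq_square power3_eq_cube)?)+
  next
    case 6
    show ?thesis unfolding 6
      by (rule degenerates_curve[where h = "1" and u = "\<lambda>_. 1" and D = "\<lambda>v e. v va4 * v vb3 - e * v va3 * v vb4" and
          q = "\<lambda>v e. v(vc1 := - e * v va3 * v vb1 * v vc4 / (v va4 * v vb3 - e * v va3 * v vb4), vc2 := e^2 * v va2 * v vc4 * v vb3 / (v va4 * v vb3 - e * v va3 * v vb4))"])
        (auto intro!: cone_LLL simp: s; (simp add: divide_simps)?; (simp add: algebra_simps power2_eq_square power3_eq_cube)?)+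
  qed
qed

text \<open>Up to sign, the maximal minors of the matrix with columns (0, a2, a3, a4), (b1, 0, b3,
  b4) and (c1, c2, 0, c4); the i-th generator omits row i.\<close>

definition gens_LLL :: "mpoly set" where
  "gens_LLL = {pvar vb3 * pvar vc2 * pvar va4 - pvar va2 * pvar vb3 * pvar vc4 - pvar vc2 * pvar va3 * pvar vb4,
     pvar vb3 * pvar vc1 * pvar va4 + pvar vb1 * pvar va3 * pvar vc4 - pvar vc1 * pvar va3 * pvar vb4,
     pvar vb1 * pvar vc2 * pvar va4 - pvar vb1 * pvar va2 * pvar vc4 + pvar vc1 * pvar va2 * pvar vb4,
     pvar vb1 * pvar vc2 * pvar va3 + pvar vc1 * pvar va2 * pvar vb3}"

lemma coneI_LLL: "coneI chart_LLL = ideal_gen gens_LLL"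
proof (rule ideal_eq_by_degeneration[OF is_ideal_ideal_gen is_ideal_coneI, where w = w_LLL
      and L = "{{vb3, vc2, va4}, {vb3, vc1, va4}, {vb1, vc2, va4}, {vb1, vc2, va3}}"])
  show "ideal_gen gens_LLL \<subseteq> coneI chart_LLL"
    by (rule ideal_gen_least[OF is_ideal_coneI])
      (auto simp: gens_LLL_def coneI_def ev_hom scl_def chart_LLL_def algebra_simps)
  have "lead (ideal_gen gens_LLL) w_LLL {vb3, vc2, va4}"
    by (rule leadI[where r = "- pvar va2 * pvar vb3 * pvar vc4 - pvar vc2 * pvar va3 * pvar vb4"], simp add: gens_LLL_def algebra_simps, (rule wb_intros)+) (simp add: w_LLL_def)
  moreover have "lead (ideal_gen gens_LLL) w_LLL {vb3, vc1, va4}"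
    by (rule leadI[where r = "pvar vb1 * pvar va3 * pvar vc4 - pvar vc1 * pvar va3 * pvar vb4"], simp add: gens_LLL_def algebra_simps, (rule wb_intros)+) (simp add: w_LLL_def)
  moreover have "lead (ideal_gen gens_LLL) w_LLL {vb1, vc2, va4}"
    by (rule leadI[where r = "- pvar vb1 * pvar va2 * pvar vc4 + pvar vc1 * pvar va2 * pvar vb4"], simp add: gens_LLL_def algebra_simps, (rule wb_intros)+) (simp add: w_LLL_def)
  moreover have "lead (ideal_gen gens_LLL) w_LLL {vb1, vc2, va3}"
    by (rule leadI[where r = "pvar vc1 * pvar va2 * pvar vb3"], simp add: gens_LLL_def algebra_simps, (rule wb_intros)+) (simp add: w_LLL_def)
  ultimately show "\<forall>S\<in>{{vb3, vc2, va4}, {vb3, vc1, va4}, {vb1, vc2, va4}, {vb1, vc2, va3}}. lead (ideal_gen gens_LLL) w_LLL S" by simp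
  fix m assume "std {{vb3, vc2, va4}, {vb3, vc1, va4}, {vb1, vc2, va4}, {vb1, vc2, va3}} m"
  then show "\<exists>N\<in>faces_LLL. \<forall>x\<in>N. lookup m x = 0"
    by (auto simp: std_def faces_LLL_def)
qed (rule degenerates_LLL)

section \<open>Two points and a line\<close>

definition chart_PPL :: "(nat \<Rightarrow> complex) \<Rightarrow> var \<Rightarrow> complex" where
  "chart_PPL y = mkv (y 0) 1 (y 1) (- (y 2 * y 0 + y 3 * y 1)) 1 (y 1) 1 (y 2) (y 3)"

text \<open>Origin of the chart: the point X = (- (y2 y0 + y3 y1), y0, 1, y1), whose first
  coordinate is forced by incidence of its third image with l'' = (1, y2, y3).\<close>

lemma chart_PPL: "chart 4 chart_PPL"
  unfolding chart_def
proof (intro conjI)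
  show "\<forall>x. polyfun 4 (\<lambda>y. chart_PPL y x)"
    by (simp add: all_vars chart_PPL_def polyfun_intros)
  have "chart_PPL y va3 \<noteq> 0" "chart_PPL y vb3 \<noteq> 0" "chart_PPL y vc1 \<noteq> 0" for y
    by (simp_all add: chart_PPL_def)
  then show "\<forall>y. valid_pt (topt (chart_PPL y))"
    unfolding valid_pt_iff asg_topt less_3_iff by (metis block_simps)
  show "\<exists>g b. \<forall>i<4. b i < 3 \<and> (\<forall>s y. ev (g i) (scl s (chart_PPL y)) = s (b i) * y i)"
    by (rule exI[of _ "\<lambda>i. pvar ([va2, va4, vc2, vc4] ! i)"], rule exI[of _ "\<lambda>i. [0, 0, 2, 2] ! i"])
      (auto simp: ev_hom scl_def chart_PPL_def less_Suc_eq numeral_eq_Suc)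
qed

lemma cone_PPL:
  assumes "f \<in> coneI chart_PPL" "v va3 \<noteq> 0" "v vb3 \<noteq> 0" "v vc1 \<noteq> 0"
    "v vb4 * v va3 = v va4 * v vb3" "v vc1 * v vb1 * v va3 = - (v vc2 * v va2 + v vc4 * v va4) * v vb3"
  shows "ev f v = 0"
proof -
  have "v = scl (\<lambda>b. if b = 0 then v va3 else if b = 1 then v vb3 else v vc1)
      (chart_PPL (\<lambda>i. if i = 0 then v va2 / v va3 else if i = 1 then v va4 / v va3 else if i = 2 then v vc2 / v vc1 else v vc4 / v vc1))"
    using assms(2-) by (simp add: fun_eq_iff all_vars scl_def chart_PPL_def field_simps)
  then show ?thesis by (rule coneI_ev[OF assms(1)])
qed

definition w_PPL :: "var \<Rightarrow> nat" where
  "w_PPL x = (if x = va3 then 1 else if x = vb1 then 1 else 0)"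

definition faces_PPL :: "var set set" where
  "faces_PPL = {{va3, vb1}, {va3, vc1}, {va3, va4}, {vb4, vb1}, {vb4, vc1}}"

text \<open>The curves again solve the equations of the cone for the coordinates in
  \<open>N\<close>. Where \<open>N\<close> contains \<open>vc1\<close>, the polynomial
  \<open>h\<close> keeps that coordinate nonzero along the curve.\<close>

lemma degenerates_PPL:
  assumes "N \<in> faces_PPL"
  shows "degenerates (coneI chart_PPL) w_PPL N"
proof -
  note s = all_vars ev_hom w_PPL_def
  consider "N = {va3, vb1}" | "N = {va3, vc1}" | "N = {va3, va4}" | "N = {vb4, vb1}" | "N = {vb4, vc1}" using assms by (auto simp: faces_PPL_def)
  then show ?thesis
  proof cases
    case 1
    show ?thesis unfolding 1
      by (rule degenerates_polynomial_curve[where q = "\<lambda>v e. v(va3 := e * v va4 * v vb3 / v vb4, vb1 := - e * (v vc2 * v va2 + v vc4 * v va4) * v vb4 / (v vc1 * v va4))"])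
        (auto intro!: cone_PPL simp: s; (simp add: divide_simps)?; (simp add: algebra_simps power2_eq_square power3_eq_cube)?)+
  next
    case 2
    show ?thesis unfolding 2
      by (rule degenerates_curve[where h = "pvar vc2 * pvar va2 + pvar vc4 * pvar va4" and u = "\<lambda>_. 1" and D = "\<lambda>v e. 1" and
          q = "\<lambda>v e. v(va3 := e * v va4 * v vb3 / v vb4, vc1 := - e * (v vc2 * v va2 + v vc4 * v va4) * v vb4 / (v vb1 * v va4))"])
        (auto intro!: cone_PPL simp: s; (simp add: divide_simps)?; (simp add: algebra_simps power2_eq_square power3_eq_cube)?)+
  next
    case 3
    show ?thesis unfolding 3
      by (rule degenerates_curve[where h = "1" and u = "\<lambda>_. 1" and D = "\<lambda>v e. v vc1 * v vb1 + e * v vc4 * v vb4" and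
          q = "\<lambda>v e. v(va3 := - (e^2) * v vc2 * v va2 * v vb3 / (v vc1 * v vb1 + e * v vc4 * v vb4), va4 := - e * v vc2 * v va2 * v vb4 / (v vc1 * v vb1 + e * v vc4 * v vb4))"])
        (auto intro!: cone_PPL simp: s; (simp add: divide_simps)?; (simp add: algebra_simps power2_eq_square power3_eq_cube)?)+
  next
    case 4
    show ?thesis unfolding 4
      by (rule degenerates_polynomial_curve[where q = "\<lambda>v e. v(vb4 := e * v va4 * v vb3 / v va3, vb1 := - (e^2) * (v vc2 * v va2 + v vc4 * v va4) * v vb3 / (v vc1 * v va3))"])
        (auto intro!: cone_PPL simp: s; (simp add: divide_simps)?; (simp add: algebra_simps power2_eq_square power3_eq_cube)?)+
  next
    case 5
    show ?thesis unfolding 5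
      by (rule degenerates_curve[where h = "pvar vc2 * pvar va2 + pvar vc4 * pvar va4" and u = "\<lambda>_. 1" and D = "\<lambda>v e. 1" and
          q = "\<lambda>v e. v(vb4 := e * v va4 * v vb3 / v va3, vc1 := - (e^2) * (v vc2 * v va2 + v vc4 * v va4) * v vb3 / (v vb1 * v va3))"])
        (auto intro!: cone_PPL simp: s; (simp add: divide_simps)?; (simp add: algebra_simps power2_eq_square power3_eq_cube)?)+
  qed
qed

text \<open>The first generator compares the two recordings of coordinates 3 and 4. The others
  express that X lies on the plane of l'', the scales of the two views being matched by coordinate 3
  or by coordinate 4.\<close>

definition gens_PPL :: "mpoly set" where
  "gens_PPL = {pvar va3 * pvar vb4 - pvar va4 * pvar vb3,
     pvar vc1 * pvar vb1 * pvar va3 + pvar vc2 * pvar va2 * pvar vb3 + pvar vc4 * pvar va4 * pvar vb3,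
     pvar vc1 * pvar vb1 * pvar va4 + pvar vc2 * pvar va2 * pvar vb4 + pvar vc4 * pvar va4 * pvar vb4}"

lemma coneI_PPL: "coneI chart_PPL = ideal_gen gens_PPL"
proof (rule ideal_eq_by_degeneration[OF is_ideal_ideal_gen is_ideal_coneI, where w = w_PPL
      and L = "{{va3, vb4}, {vc1, vb1, va3}, {vc1, vb1, va4}}"])
  show "ideal_gen gens_PPL \<subseteq> coneI chart_PPL"
    by (rule ideal_gen_least[OF is_ideal_coneI])
      (auto simp: gens_PPL_def coneI_def ev_hom scl_def chart_PPL_def algebra_simps)
  have "lead (ideal_gen gens_PPL) w_PPL {va3, vb4}"
    by (rule leadI[where r = "- pvar va4 * pvar vb3"], simp add: gens_PPL_def algebra_simps, (rule wb_intros)+) (simp add: w_PPL_def)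
  moreover have "lead (ideal_gen gens_PPL) w_PPL {vc1, vb1, va3}"
    by (rule leadI[where r = "pvar vc2 * pvar va2 * pvar vb3 + pvar vc4 * pvar va4 * pvar vb3"], simp add: gens_PPL_def algebra_simps, (rule wb_intros)+) (simp add: w_PPL_def)
  moreover have "lead (ideal_gen gens_PPL) w_PPL {vc1, vb1, va4}"
    by (rule leadI[where r = "pvar vc2 * pvar va2 * pvar vb4 + pvar vc4 * pvar va4 * pvar vb4"], simp add: gens_PPL_def algebra_simps, (rule wb_intros)+) (simp add: w_PPL_def)
  ultimately show "\<forall>S\<in>{{va3, vb4}, {vc1, vb1, va3}, {vc1, vb1, va4}}. lead (ideal_gen gens_PPL) w_PPL S" by simp
  fix m assume "std {{va3, vb4}, {vc1, vb1, va3}, {vc1, vb1, va4}} m"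
  then show "\<exists>N\<in>faces_PPL. \<forall>x\<in>N. lookup m x = 0"
    by (auto simp: std_def faces_PPL_def)
qed (rule degenerates_PPL)

section \<open>Three points\<close>

definition chart_PPP :: "(nat \<Rightarrow> complex) \<Rightarrow> var \<Rightarrow> complex" where
  "chart_PPP y = mkv (y 1) (y 2) 1 (y 0) (y 2) 1 (y 0) (y 1) 1"

lemma chart_PPP: "chart 3 chart_PPP"
  unfolding chart_def
proof (intro conjI)
  show "\<forall>x. polyfun 3 (\<lambda>y. chart_PPP y x)"
    by (simp add: all_vars chart_PPP_def polyfun_intros)
  have "chart_PPP y va4 \<noteq> 0" "chart_PPP y vb4 \<noteq> 0" "chart_PPP y vc4 \<noteq> 0" for y
    by (simp_all add: chart_PPP_def)
  then show "\<forall>y. valid_pt (topt (chart_PPP y))"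
    unfolding valid_pt_iff asg_topt less_3_iff by (metis block_simps)
  show "\<exists>g b. \<forall>i<3. b i < 3 \<and> (\<forall>s y. ev (g i) (scl s (chart_PPP y)) = s (b i) * y i)"
    by (rule exI[of _ "\<lambda>i. pvar ([vb1, va2, va3] ! i)"], rule exI[of _ "\<lambda>i. [1, 0, 0] ! i"])
      (auto simp: ev_hom scl_def chart_PPP_def less_Suc_eq numeral_eq_Suc)
qed

lemma cone_PPP:
  assumes "f \<in> coneI chart_PPP" "v va4 \<noteq> 0" "v vb4 \<noteq> 0" "v vc4 \<noteq> 0"
    "v va3 * v vb4 = v va4 * v vb3" "v vb1 * v vc4 = v vb4 * v vc1" "v vc2 * v va4 = v va2 * v vc4"
  shows "ev f v = 0"
proof -
  have "v = scl (\<lambda>b. if b = 0 then v va4 else if b = 1 then v vb4 else v vc4)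
      (chart_PPP (\<lambda>i. if i = 0 then v vb1 / v vb4 else if i = 1 then v va2 / v va4 else v va3 / v va4))"
    using assms(2-) by (simp add: fun_eq_iff all_vars scl_def chart_PPP_def field_simps)
  then show ?thesis by (rule coneI_ev[OF assms(1)])
qed

definition w_PPP :: "var \<Rightarrow> nat" where
  "w_PPP x = (if x = va3 then 1 else if x = vb1 then 1 else if x = vc2 then 1 else 0)"

definition faces_PPP :: "var set set" where
  "faces_PPP = {{va3, vb1, vc2}, {vb4, vb1, vc2}, {va3, vc4, vc2}, {va3, vb1, va4}, {vb4, vc4, vc2}, {va3, vc4, va4}, {vb4, vb1, va4}}"

text \<open>All equations of \<open>cone_PPP\<close> are binomial, so every curve has entries that
  are monomials in e.\<close>

lemma degenerates_PPP:
  assumes "N \<in> faces_PPP"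
  shows "degenerates (coneI chart_PPP) w_PPP N"
proof -
  note s = all_vars ev_hom w_PPP_def
  consider "N = {va3, vb1, vc2}" | "N = {vb4, vb1, vc2}" | "N = {va3, vc4, vc2}" | "N = {va3, vb1, va4}" | "N = {vb4, vc4, vc2}" | "N = {va3, vc4, va4}" | "N = {vb4, vb1, va4}" using assms by (auto simp: faces_PPP_def)
  then show ?thesis
  proof cases
    case 1
    show ?thesis unfolding 1
      by (rule degenerates_polynomial_curve[where q = "\<lambda>v e. v(va3 := e * v va4 * v vb3 / v vb4, vb1 := e * v vb4 * v vc1 / v vc4, vc2 := e * v va2 * v vc4 / v va4)"])
        (auto intro!: cone_PPP simp: s; (simp add: divide_simps)?; (simp add: algebra_simps power2_eq_square power3_eq_cube)?)+
  next
    case 2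
    show ?thesis unfolding 2
      by (rule degenerates_polynomial_curve[where q = "\<lambda>v e. v(vb4 := e * v va4 * v vb3 / v va3, vb1 := e^2 * v va4 * v vb3 * v vc1 / (v va3 * v vc4), vc2 := e * v va2 * v vc4 / v va4)"])
        (auto intro!: cone_PPP simp: s; (simp add: divide_simps)?; (simp add: algebra_simps power2_eq_square power3_eq_cube)?)+
  next
    case 3
    show ?thesis unfolding 3
      by (rule degenerates_polynomial_curve[where q = "\<lambda>v e. v(va3 := e * v va4 * v vb3 / v vb4, vc4 := e * v vb4 * v vc1 / v vb1, vc2 := e^2 * v va2 * v vb4 * v vc1 / (v vb1 * v va4))"])
        (auto intro!: cone_PPP simp: s; (simp add: divide_simps)?; (simp add: algebra_simps power2_eq_square power3_eq_cube)?)+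
  next
    case 4
    show ?thesis unfolding 4
      by (rule degenerates_polynomial_curve[where q = "\<lambda>v e. v(va3 := e^2 * v va2 * v vc4 * v vb3 / (v vc2 * v vb4), vb1 := e * v vb4 * v vc1 / v vc4, va4 := e * v va2 * v vc4 / v vc2)"])
        (auto intro!: cone_PPP simp: s; (simp add: divide_simps)?; (simp add: algebra_simps power2_eq_square power3_eq_cube)?)+
  next
    case 5
    show ?thesis unfolding 5
      by (rule degenerates_polynomial_curve[where q = "\<lambda>v e. v(vb4 := e * v va4 * v vb3 / v va3, vc4 := e^2 * v va4 * v vb3 * v vc1 / (v va3 * v vb1), vc2 := e^3 * v va2 * v vb3 * v vc1 / (v va3 * v vb1))"])
        (auto intro!: cone_PPP simp: s; (simp add: divide_simps)?; (simp add: algebra_simps power2_eq_square power3_eq_cube)?)+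
  next
    case 6
    show ?thesis unfolding 6
      by (rule degenerates_polynomial_curve[where q = "\<lambda>v e. v(va3 := e^3 * v va2 * v vc1 * v vb3 / (v vb1 * v vc2), vc4 := e * v vb4 * v vc1 / v vb1, va4 := e^2 * v va2 * v vb4 * v vc1 / (v vb1 * v vc2))"])
        (auto intro!: cone_PPP simp: s; (simp add: divide_simps)?; (simp add: algebra_simps power2_eq_square power3_eq_cube)?)+
  next
    case 7
    show ?thesis unfolding 7
      by (rule degenerates_polynomial_curve[where q = "\<lambda>v e. v(vb4 := e^2 * v va2 * v vc4 * v vb3 / (v vc2 * v va3), vb1 := e^3 * v va2 * v vb3 * v vc1 / (v vc2 * v va3), va4 := e * v va2 * v vc4 / v vc2)"])
        (auto intro!: cone_PPP simp: s; (simp add: divide_simps)?; (simp add: algebra_simps power2_eq_square power3_eq_cube)?)+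
  qed
qed

text \<open>The quadrics compare the pair of coordinates shared by two views. The cubic closes the
  cycle through coordinates 1, 2, 3; it is a new condition where all the fourth coordinates
  vanish.\<close>

definition gens_PPP :: "mpoly set" where
  "gens_PPP = {pvar va3 * pvar vb4 - pvar va4 * pvar vb3,
     pvar vb1 * pvar vc4 - pvar vb4 * pvar vc1,
     pvar vc2 * pvar va4 - pvar va2 * pvar vc4,
     pvar va3 * pvar vb1 * pvar vc2 - pvar va2 * pvar vb3 * pvar vc1}"

lemma coneI_PPP: "coneI chart_PPP = ideal_gen gens_PPP"
proof (rule ideal_eq_by_degeneration[OF is_ideal_ideal_gen is_ideal_coneI, where w = w_PPP
      and L = "{{va3, vb4}, {vb1, vc4}, {vc2, va4}, {va3, vb1, vc2}}"])
  show "ideal_gen gens_PPP \<subseteq> coneI chart_PPP"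
    by (rule ideal_gen_least[OF is_ideal_coneI])
      (auto simp: gens_PPP_def coneI_def ev_hom scl_def chart_PPP_def algebra_simps)
  have "lead (ideal_gen gens_PPP) w_PPP {va3, vb4}"
    by (rule leadI[where r = "- pvar va4 * pvar vb3"], simp add: gens_PPP_def algebra_simps, (rule wb_intros)+) (simp add: w_PPP_def)
  moreover have "lead (ideal_gen gens_PPP) w_PPP {vb1, vc4}"
    by (rule leadI[where r = "- pvar vb4 * pvar vc1"], simp add: gens_PPP_def algebra_simps, (rule wb_intros)+) (simp add: w_PPP_def)
  moreover have "lead (ideal_gen gens_PPP) w_PPP {vc2, va4}"
    by (rule leadI[where r = "- pvar va2 * pvar vc4"], simp add: gens_PPP_def algebra_simps, (rule wb_intros)+) (simp add: w_PPP_def)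
  moreover have "lead (ideal_gen gens_PPP) w_PPP {va3, vb1, vc2}"
    by (rule leadI[where r = "- pvar va2 * pvar vb3 * pvar vc1"], simp add: gens_PPP_def algebra_simps, (rule wb_intros)+) (simp add: w_PPP_def)
  ultimately show "\<forall>S\<in>{{va3, vb4}, {vb1, vc4}, {vc2, va4}, {va3, vb1, vc2}}. lead (ideal_gen gens_PPP) w_PPP S" by simp
  fix m assume "std {{va3, vb4}, {vb1, vc4}, {vc2, va4}, {va3, vb1, vc2}} m"
  then show "\<exists>N\<in>faces_PPP. \<forall>x\<in>N. lookup m x = 0"
    by (auto simp: std_def faces_PPP_def)
qed (rule degenerates_PPP)

section \<open>One point and two lines\<close>

definition chart_PLL :: "(nat \<Rightarrow> complex) \<Rightarrow> var \<Rightarrow> complex" where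
  "chart_PLL y = mkv (y 2 * (y 0 * y 4 + y 1) - y 3) (y 4) 1 1 (y 0) (y 1) (y 2) 1 (y 3)"

text \<open>Origin of the chart: X has third and fourth coordinates y4 and 1. Incidence with l' =
  (1, y0, y1) gives its first coordinate - (y0 y4 + y1), and incidence with l'' = (y2, 1, y3) then
  gives the second.\<close>

lemma chart_PLL: "chart 5 chart_PLL"
  unfolding chart_def
proof (intro conjI)
  show "\<forall>x. polyfun 5 (\<lambda>y. chart_PLL y x)"
    by (simp add: all_vars chart_PLL_def polyfun_intros)
  have "chart_PLL y va4 \<noteq> 0" "chart_PLL y vb1 \<noteq> 0" "chart_PLL y vc2 \<noteq> 0" for y
    by (simp_all add: chart_PLL_def)
  then show "\<forall>y. valid_pt (topt (chart_PLL y))"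
    unfolding valid_pt_iff asg_topt less_3_iff by (metis block_simps)
  show "\<exists>g b. \<forall>i<5. b i < 3 \<and> (\<forall>s y. ev (g i) (scl s (chart_PLL y)) = s (b i) * y i)"
    by (rule exI[of _ "\<lambda>i. pvar ([vb3, vb4, vc1, vc4, va3] ! i)"], rule exI[of _ "\<lambda>i. [1, 1, 2, 2, 0] ! i"])
      (auto simp: ev_hom scl_def chart_PLL_def less_Suc_eq numeral_eq_Suc)
qed

lemma cone_PLL:
  assumes "f \<in> coneI chart_PLL" "v va4 \<noteq> 0" "v vb1 \<noteq> 0" "v vc2 \<noteq> 0"
    "v va2 = (v vc1 * (v vb3 * v va3 + v vb4 * v va4) / v vb1 - v vc4 * v va4) / v vc2"
  shows "ev f v = 0"
proof -
  have "v = scl (\<lambda>b. if b = 0 then v va4 else if b = 1 then v vb1 else v vc2)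
      (chart_PLL (\<lambda>i. if i = 0 then v vb3 / v vb1 else if i = 1 then v vb4 / v vb1 else if i = 2 then v vc1 / v vc2 else if i = 3 then v vc4 / v vc2 else v va3 / v va4))"
    using assms(2-4) by (simp add: fun_eq_iff all_vars scl_def chart_PLL_def assms(5) field_simps)
  then show ?thesis by (rule coneI_ev[OF assms(1)])
qed

definition w_PLL :: "var \<Rightarrow> nat" where
  "w_PLL x = (if x = va3 then 1 else 0)"

definition faces_PLL :: "var set set" where
  "faces_PLL = {{vc1}, {vb3}, {va3}}"

text \<open>The cone is a hypersurface, and its equation is solved for one factor of the leading
  monomial at a time.\<close>

lemma degenerates_PLL:
  assumes "N \<in> faces_PLL"
  shows "degenerates (coneI chart_PLL) w_PLL N"
proof -
  note s = all_vars ev_hom w_PLL_def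
  consider "N = {vc1}" | "N = {vb3}" | "N = {va3}" using assms by (auto simp: faces_PLL_def)
  then show ?thesis
  proof cases
    case 1
    show ?thesis unfolding 1
      by (rule degenerates_curve[where h = "1" and u = "\<lambda>_. 1" and D = "\<lambda>v e. v vb3 * v va3 + e * v vb4 * v va4" and
          q = "\<lambda>v e. v(vc1 := e * v vb1 * (v vc2 * v va2 + v vc4 * v va4) / (v vb3 * v va3 + e * v vb4 * v va4))"])
        (auto intro!: cone_PLL simp: s; (simp add: divide_simps)?; (simp add: algebra_simps power2_eq_square power3_eq_cube)?)+
  next
    case 2
    show ?thesis unfolding 2
      by (rule degenerates_polynomial_curve[where q = "\<lambda>v e. v(vb3 := e * (v vb1 * (v vc2 * v va2 + v vc4 * v va4) / v vc1 - v vb4 * v va4) / v va3)"])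
        (auto intro!: cone_PLL simp: s; (simp add: divide_simps)?; (simp add: algebra_simps power2_eq_square power3_eq_cube)?)+
  next
    case 3
    show ?thesis unfolding 3
      by (rule degenerates_polynomial_curve[where q = "\<lambda>v e. v(va3 := e * (v vb1 * (v vc2 * v va2 + v vc4 * v va4) / v vc1 - v vb4 * v va4) / v vb3)"])
        (auto intro!: cone_PLL simp: s; (simp add: divide_simps)?; (simp add: algebra_simps power2_eq_square power3_eq_cube)?)+
  qed
qed

definition gens_PLL :: "mpoly set" where
  "gens_PLL = {pvar vc1 * pvar vb3 * pvar va3 + pvar vc1 * pvar vb4 * pvar va4 - pvar vb1 * pvar vc2 * pvar va2 - pvar vb1 * pvar vc4 * pvar va4}"

lemma coneI_PLL: "coneI chart_PLL = ideal_gen gens_PLL"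
proof (rule ideal_eq_by_degeneration[OF is_ideal_ideal_gen is_ideal_coneI, where w = w_PLL
      and L = "{{vc1, vb3, va3}}"])
  show "ideal_gen gens_PLL \<subseteq> coneI chart_PLL"
    by (rule ideal_gen_least[OF is_ideal_coneI])
      (auto simp: gens_PLL_def coneI_def ev_hom scl_def chart_PLL_def algebra_simps)
  have "lead (ideal_gen gens_PLL) w_PLL {vc1, vb3, va3}"
    by (rule leadI[where r = "pvar vc1 * pvar vb4 * pvar va4 - pvar vb1 * pvar vc2 * pvar va2 - pvar vb1 * pvar vc4 * pvar va4"], simp add: gens_PLL_def algebra_simps, (rule wb_intros)+) (simp add: w_PLL_def)
  then show "\<forall>S\<in>{{vc1, vb3, va3}}. lead (ideal_gen gens_PLL) w_PLL S" by simp
  fix m assume "std {{vc1, vb3, va3}} m"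
  then show "\<exists>N\<in>faces_PLL. \<forall>x\<in>N. lookup m x = 0"
    by (auto simp: std_def faces_PLL_def)
qed (rule degenerates_PLL)

section \<open>Cameras\<close>

text \<open>A nontrivial relation would put one row into the span of the other two and bound the
  rank by 2.\<close>

lemma camera_right_inverse:
  assumes "camera A"
  shows "\<exists>R. A ** R = mat 1"
  unfolding matrix_right_invertible_independent_rows
proof (intro allI impI, rule ccontr)
  fix c i0 assume c: "(\<Sum>i\<in>UNIV. c i *s row i A) = 0" "c i0 \<noteq> 0"
  define W where "W = (\<lambda>i. row i A) ` (UNIV - {i0})"
  have "(\<Sum>i\<in>UNIV. c i *s row i A) = c i0 *s row i0 A + (\<Sum>i\<in>UNIV - {i0}. c i *s row i A)"
    by (simp add: sum.remove)
  then have "c i0 *s row i0 A = - (\<Sum>i\<in>UNIV - {i0}. c i *s row i A)"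
    using c(1) by (simp add: eq_neg_iff_add_eq_0)
  also have "\<dots> \<in> vec.span W"
    unfolding W_def by (intro vec.span_neg vec.span_sum vec.span_scale vec.span_base) auto
  finally have "(1 / c i0) *s (c i0 *s row i0 A) \<in> vec.span W" by (rule vec.span_scale)
  then have "row i0 A \<in> vec.span W" using c(2) by (simp add: vector_smult_assoc)
  then have "rows A \<subseteq> vec.span W"
    unfolding rows_def W_def by (auto intro: vec.span_base)
  then have "vec.dim (rows A) \<le> card W" by (rule vec.dim_le_card) (simp add: W_def)
  also have "\<dots> \<le> card (UNIV - {i0})" unfolding W_def by (rule card_image_le) simp
  also have "\<dots> = 2" by (simp add: card_Diff_singleton)
  finally show False using assms by (simp add: camera_def row_rank_def_gen)
qed

lemma camera_surj:
  assumes "camera A"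
  obtains X where "A *v X = x"
  using camera_right_inverse[OF assms] matrix_right_invertible_surjective[of A] by (metis surjD)

lemma matrix_kernel_4_3:
  fixes M :: "complex^4^3"
  shows "\<exists>x. x \<noteq> 0 \<and> M *v x = 0"
proof -
  obtain c where c: "\<exists>i. c i \<noteq> 0" "\<forall>j. (\<Sum>i\<in>UNIV. c i * M $ j $ i) = 0"
    using linear_dependence[of "UNIV :: 3 set" "UNIV :: 4 set" "\<lambda>i j. M $ j $ i"] by auto
  then show ?thesis
    by (intro exI[of _ "\<chi> i. c i"]) (auto simp: vec_eq_iff matrix_vector_mult_def mult.commute)
qed

definition A0 :: "complex^4^3" where
  "A0 = vector [vector [0, 1, 0, 0], vector [0, 0, 1, 0], vector [0, 0, 0, 1]]"
definition B0 :: "complex^4^3" where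
  "B0 = vector [vector [1, 0, 0, 0], vector [0, 0, 1, 0], vector [0, 0, 0, 1]]"
definition C0 :: "complex^4^3" where
  "C0 = vector [vector [1, 0, 0, 0], vector [0, 1, 0, 0], vector [0, 0, 0, 1]]"

lemma vector_4_nth [simp]:
  "(vector [a, b, c, d] :: 'a::zero^4) $ 1 = a" "(vector [a, b, c, d] :: 'a::zero^4) $ 2 = b"
  "(vector [a, b, c, d] :: 'a::zero^4) $ 3 = c" "(vector [a, b, c, d] :: 'a::zero^4) $ 4 = d"
  by (simp_all add: vector_def)

lemma std_camera_nth [simp]:
  "A0 $ 1 = vector [0, 1, 0, 0]" "A0 $ 2 = vector [0, 0, 1, 0]" "A0 $ 3 = vector [0, 0, 0, 1]"
  "B0 $ 1 = vector [1, 0, 0, 0]" "B0 $ 2 = vector [0, 0, 1, 0]" "B0 $ 3 = vector [0, 0, 0, 1]"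
  "C0 $ 1 = vector [1, 0, 0, 0]" "C0 $ 2 = vector [0, 1, 0, 0]" "C0 $ 3 = vector [0, 0, 0, 1]"
  by (simp_all add: A0_def B0_def C0_def vector_3)

lemma std_camera_mult [simp]:
  "A0 *v Y = vector [Y $ 2, Y $ 3, Y $ 4]" "B0 *v Y = vector [Y $ 1, Y $ 3, Y $ 4]" "C0 *v Y = vector [Y $ 1, Y $ 2, Y $ 4]"
  by (simp_all add: vec_eq_iff forall_3 matrix_vector_mult_def sum_4 vector_3)

definition inverse_pair :: "complex^'n^'n \<Rightarrow> complex^'n^'n \<Rightarrow> bool" where
  "inverse_pair N N' \<longleftrightarrow> N ** N' = mat 1 \<and> N' ** N = mat 1"

lemma inverse_pair_transpose: "inverse_pair N N' \<Longrightarrow> inverse_pair (transpose N') (transpose N)"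
  by (simp add: inverse_pair_def transpose_mat flip: matrix_transpose_mul)

lemma inverse_pair_sym: "inverse_pair N N' \<Longrightarrow> inverse_pair N' N"
  by (simp add: inverse_pair_def)

lemma inverse_pair_det: "inverse_pair N N' \<Longrightarrow> det N \<noteq> 0"
  unfolding inverse_pair_def by (metis det_I det_mul mult_eq_0_iff one_neq_zero)

lemma inverse_pair_vec: "inverse_pair N N' \<Longrightarrow> N *v (N' *v x) = x"
  by (simp add: inverse_pair_def matrix_vector_mul_assoc)

text \<open>\<open>A ** G\<close> is surjective because \<open>A\<close> and \<open>G\<close> are,
  and it factors through the square matrix \<open>N\<close>, which therefore has a right
  inverse.\<close>

lemma normal_form_column_drop:
  fixes A K0 :: "complex^4^3" and G :: "complex^4^4"
  assumes "camera A" and G: "inverse_pair G Gi" and AG: "A ** G = N ** K0"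
  shows "\<exists>N'. inverse_pair N N'"
proof -
  obtain R where "A ** R = mat 1" using camera_right_inverse[OF assms(1)] by blast
  then have "(A ** G) ** (Gi ** R) = mat 1"
    using G by (metis inverse_pair_def matrix_mul_assoc matrix_mul_lid)
  then have "N ** (K0 ** (Gi ** R)) = mat 1" by (simp add: AG matrix_mul_assoc)
  then show ?thesis unfolding inverse_pair_def using matrix_left_right_inverse by blast
qed

text \<open>The columns of \<open>G\<close> are the three centers and a fourth vector.
  \<open>A\<close> kills the first column, \<open>B\<close> the second, \<open>C\<close> the third;
  the images of the other three columns form the new basis of each image plane.\<close>

lemma normal_form:
  assumes cam: "camera A" "camera B" "camera C" and indep: "indep_centers A B C"
  obtains G Gi :: "complex^4^4" and N1 N1i N2 N2i N3 N3i :: "complex^3^3"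
  where "inverse_pair G Gi" "inverse_pair N1 N1i" "inverse_pair N2 N2i" "inverse_pair N3 N3i"
    "A ** G = N1 ** A0" "B ** G = N2 ** B0" "C ** G = N3 ** C0"
proof -
  obtain a b c where abc: "a \<noteq> 0" "A *v a = 0" "b \<noteq> 0" "B *v b = 0" "c \<noteq> 0" "C *v c = 0"
    using matrix_kernel_4_3 by metis
  have ind: "s = 0 \<and> t = 0 \<and> u = 0" if "s *s a + t *s b + u *s c = 0" for s t u
    using indep abc that unfolding indep_centers_def by blast
  \<comment> \<open>\<open>l\<close> is a linear form vanishing on the three centers. A unit vector
    on which it is nonzero completes them to a basis.\<close>
  obtain l where l: "l \<noteq> 0" "(vector [a, b, c] :: complex^4^3) *v l = 0" using matrix_kernel_4_3 by metis
  then obtain i0 where i0: "l $ i0 \<noteq> 0" by (auto simp: vec_eq_iff)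
  define g :: "complex^4" where "g = axis i0 1"
  define G :: "complex^4^4" where "G = transpose (vector [a, b, c, g])"
  have G: "G *v x = x $ 1 *s a + x $ 2 *s b + x $ 3 *s c + x $ 4 *s g" for x
    by (simp add: G_def vec_eq_iff matrix_vector_mult_def transpose_def sum_4 mult.commute)
  have la: "(\<Sum>k\<in>UNIV. l $ k * a $ k) = 0" "(\<Sum>k\<in>UNIV. l $ k * b $ k) = 0" "(\<Sum>k\<in>UNIV. l $ k * c $ k) = 0"
    using l(2) by (simp_all add: vec_eq_iff forall_3 matrix_vector_mult_def vector_3 mult.commute)
  have lg: "(\<Sum>k\<in>UNIV. l $ k * g $ k) = l $ i0"
    by (simp add: g_def axis_def if_distrib cong: if_cong)
  have ker: "x = 0" if "G *v x = 0" for x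
  proof -
    have "(\<Sum>k\<in>UNIV. l $ k * (G *v x) $ k) = x $ 1 * (\<Sum>k\<in>UNIV. l $ k * a $ k) + x $ 2 * (\<Sum>k\<in>UNIV. l $ k * b $ k)
      + x $ 3 * (\<Sum>k\<in>UNIV. l $ k * c $ k) + x $ 4 * (\<Sum>k\<in>UNIV. l $ k * g $ k)"
      unfolding G by (simp add: sum_4 algebra_simps)
    then have "x $ 4 = 0" using that la lg i0 by simp
    then have "x $ 1 *s a + x $ 2 *s b + x $ 3 *s c = 0" using that G[of x] by simp
    from ind[OF this] show ?thesis using \<open>x $ 4 = 0\<close> by (simp add: vec_eq_iff[of x] forall_4)
  qed
  then obtain Gi where "Gi ** G = mat 1" using matrix_left_invertible_ker[of G] by blast
  then have inv: "inverse_pair G Gi" unfolding inverse_pair_def using matrix_left_right_inverse by blast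
  have col: "K ** G = transpose (vector [K *v a, K *v b, K *v c, K *v g])" for K :: "complex^4^3"
    by (simp add: G_def vec_eq_iff forall_4 matrix_matrix_mult_def matrix_vector_mult_def transpose_def)
  define N1 :: "complex^3^3" where "N1 = transpose (vector [A *v b, A *v c, A *v g])"
  define N2 :: "complex^3^3" where "N2 = transpose (vector [B *v a, B *v c, B *v g])"
  define N3 :: "complex^3^3" where "N3 = transpose (vector [C *v a, C *v b, C *v g])"
  have AG: "A ** G = N1 ** A0"
    unfolding col by (simp add: N1_def abc vec_eq_iff forall_4 matrix_matrix_mult_def transpose_def sum_3 vector_3)
  have BG: "B ** G = N2 ** B0"
    unfolding col by (simp add: N2_def abc vec_eq_iff forall_4 matrix_matrix_mult_def transpose_def sum_3 vector_3)
  have CG: "C ** G = N3 ** C0"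
    unfolding col by (simp add: N3_def abc vec_eq_iff forall_4 matrix_matrix_mult_def transpose_def sum_3 vector_3)
  show thesis
    using that[OF inv _ _ _ AG BG CG] normal_form_column_drop[OF cam(1) inv AG]
      normal_form_column_drop[OF cam(2) inv BG] normal_form_column_drop[OF cam(3) inv CG] by blast
qed

section \<open>Line coordinates and images of flags\<close>

lemma cross3c_nth [simp]:
  "cross3c u v $ 1 = u $ 2 * v $ 3 - u $ 3 * v $ 2" "cross3c u v $ 2 = u $ 3 * v $ 1 - u $ 1 * v $ 3"
  "cross3c u v $ 3 = u $ 1 * v $ 2 - u $ 2 * v $ 1"
  by (simp_all add: cross3c_def vector_3)

lemma transpose_mult_cross3c: "transpose N *v cross3c (N *v u) (N *v v) = det N *s cross3c u v"
  by (simp add: vec_eq_iff forall_3 matrix_vector_mult_def transpose_def sum_3 det_3 algebra_simps)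

text \<open>Lines transform by the cofactor matrix, which is det N times the inverse
  transpose.\<close>

lemma cross3c_mult:
  assumes "inverse_pair N N'"
  shows "cross3c (N *v u) (N *v v) = det N *s (transpose N' *v cross3c u v)"
proof -
  have "transpose N' *v (transpose N *v cross3c (N *v u) (N *v v)) = cross3c (N *v u) (N *v v)"
    using inverse_pair_vec[OF inverse_pair_transpose[OF assms]] .
  then show ?thesis unfolding transpose_mult_cross3c by (simp add: vector_scalar_commute)
qed

text \<open>A flag is packed into one sequence: entries 0 to 3 and 4 to 7 are points P and Q
  spanning the line, entries 8 and 9 the coefficients of X in them. All five maps thus share one
  polynomial parametrization.\<close>

definition V4 :: "(nat \<Rightarrow> complex) \<Rightarrow> nat \<Rightarrow> complex^4" where
  "V4 z k = vector [z k, z (k + 1), z (k + 2), z (k + 3)]"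

definition ptm :: "complex^4^3 \<Rightarrow> (nat \<Rightarrow> complex) \<Rightarrow> complex^3" where
  "ptm A z = A *v (z 8 *s V4 z 0 + z 9 *s V4 z 4)"

definition lnm :: "complex^4^3 \<Rightarrow> (nat \<Rightarrow> complex) \<Rightarrow> complex^3" where
  "lnm A z = cross3c (A *v V4 z 0) (A *v V4 z 4)"

text \<open>\<open>True\<close> selects the image of the point of a flag, \<open>False\<close> that of its line.\<close>
definition flm :: "bool \<Rightarrow> complex^4^3 \<Rightarrow> (nat \<Rightarrow> complex) \<Rightarrow> complex^3" where
  "flm b A z = (if b then ptm A z else lnm A z)"

definition flags :: "bool \<Rightarrow> bool \<Rightarrow> bool \<Rightarrow> complex^4^3 \<Rightarrow> complex^4^3 \<Rightarrow> complex^4^3 \<Rightarrow> (nat \<Rightarrow> complex) \<Rightarrow> var \<Rightarrow> complex" where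
  "flags b1 b2 b3 A B C z = asg (flm b1 A z, flm b2 B z, flm b3 C z)"

definition img :: "bool \<Rightarrow> bool \<Rightarrow> bool \<Rightarrow> complex^4^3 \<Rightarrow> complex^4^3 \<Rightarrow> complex^4^3 \<Rightarrow> pt set" where
  "img b1 b2 b3 A B C = {topt (flags b1 b2 b3 A B C z) | z. valid_pt (topt (flags b1 b2 b3 A B C z))}"

lemma ex_V4: "\<exists>z. V4 z 0 = P \<and> V4 z 4 = Q \<and> z 8 = s \<and> z 9 = t"
  by (rule exI[of _ "\<lambda>i. [P $ 1, P $ 2, P $ 3, P $ 4, Q $ 1, Q $ 2, Q $ 3, Q $ 4, s, t] ! i"])
    (simp add: V4_def vec_eq_iff forall_4 numeral_eq_Suc)

text \<open>A relation between P and Q carries over to their images, and either coefficient times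
  the cross product is a combination of the coordinates of that relation. So a nonzero line image
  certifies an honest flag, and the parameters may include dependent P and Q.\<close>

lemma indep2_if_cross3c: "cross3c (B *v P) (B *v Q) \<noteq> 0 \<Longrightarrow> indep2 P Q"
  unfolding indep2_def
proof (intro allI impI)
  fix s t assume nz: "cross3c (B *v P) (B *v Q) \<noteq> 0" and st: "s *s P + t *s Q = 0"
  have "B *v (s *s P + t *s Q) = 0" unfolding st by simp
  then have "s *s (B *v P) + t *s (B *v Q) = 0"
    by (simp add: vec_eq_iff forall_3 matrix_vector_mult_def sum_4 algebra_simps)
  then have e: "s * (B *v P) $ i + t * (B *v Q) $ i = 0" for i by (simp add: vec_eq_iff)
  define p q where "p = B *v P" and "q = B *v Q"
  have "s * cross3c p q $ 1 = q $ 3 * (s * p $ 2 + t * q $ 2) - q $ 2 * (s * p $ 3 + t * q $ 3)"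
    "s * cross3c p q $ 2 = q $ 1 * (s * p $ 3 + t * q $ 3) - q $ 3 * (s * p $ 1 + t * q $ 1)"
    "s * cross3c p q $ 3 = q $ 2 * (s * p $ 1 + t * q $ 1) - q $ 1 * (s * p $ 2 + t * q $ 2)"
    "t * cross3c p q $ 1 = p $ 2 * (s * p $ 3 + t * q $ 3) - p $ 3 * (s * p $ 2 + t * q $ 2)"
    "t * cross3c p q $ 2 = p $ 3 * (s * p $ 1 + t * q $ 1) - p $ 1 * (s * p $ 3 + t * q $ 3)"
    "t * cross3c p q $ 3 = p $ 1 * (s * p $ 2 + t * q $ 2) - p $ 2 * (s * p $ 1 + t * q $ 1)"
    by (simp_all add: algebra_simps)
  moreover have "s * p $ i + t * q $ i = 0" for i using e unfolding p_def q_def .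
  ultimately have *: "\<forall>i. s * cross3c p q $ i = 0 \<and> t * cross3c p q $ i = 0"
    unfolding forall_3 by (simp del: cross3c_nth)
  obtain i where "cross3c p q $ i \<noteq> 0" using nz unfolding p_def q_def vec_eq_iff by auto
  then show "s = 0 \<and> t = 0" using * by (metis mult_eq_0_iff)
qed

definition flag_img :: "bool \<Rightarrow> complex^4^3 \<Rightarrow> complex^4 \<Rightarrow> complex^4 \<Rightarrow> complex \<Rightarrow> complex \<Rightarrow> complex^3" where
  "flag_img b A P Q s t = (if b then A *v (s *s P + t *s Q) else cross3c (A *v P) (A *v Q))"

lemma in_img_iff:
  "p \<in> img b1 b2 b3 A B C \<longleftrightarrow> (\<exists>P Q s t. p = (flag_img b1 A P Q s t, flag_img b2 B P Q s t, flag_img b3 C P Q s t) \<and>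
    flag_img b1 A P Q s t \<noteq> 0 \<and> flag_img b2 B P Q s t \<noteq> 0 \<and> flag_img b3 C P Q s t \<noteq> 0)" (is "_ \<longleftrightarrow> ?R")
proof -
  have flm: "flm b A z = flag_img b A (V4 z 0) (V4 z 4) (z 8) (z 9)" for b A z
    by (simp add: flm_def ptm_def lnm_def flag_img_def)
  show ?thesis
  proof
    assume "p \<in> img b1 b2 b3 A B C"
    then show ?R unfolding img_def flags_def topt_asg flm valid_pt_def by auto
  next
    assume ?R
    then obtain P Q s t where p: "p = (flag_img b1 A P Q s t, flag_img b2 B P Q s t, flag_img b3 C P Q s t)"
      "flag_img b1 A P Q s t \<noteq> 0" "flag_img b2 B P Q s t \<noteq> 0" "flag_img b3 C P Q s t \<noteq> 0" by blast
    obtain z where "V4 z 0 = P \<and> V4 z 4 = Q \<and> z 8 = s \<and> z 9 = t" using ex_V4 by blast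
    with p show "p \<in> img b1 b2 b3 A B C"
      unfolding img_def flags_def topt_asg flm valid_pt_def by (intro CollectI exI[of _ z]) simp
  qed
qed

lemma img_PLL_eq: "img_PLL A B C = img True False False A B C"
  unfolding set_eq_iff in_img_iff img_PLL_def flag_img_def by simp (blast intro: indep2_if_cross3c)

lemma img_LLL_eq: "img_LLL A B C = img False False False A B C"
  unfolding set_eq_iff in_img_iff img_LLL_def flag_img_def by simp (blast intro: indep2_if_cross3c)

lemma img_PPL_eq: "img_PPL A B C = img True True False A B C"
  unfolding set_eq_iff in_img_iff img_PPL_def flag_img_def by simp (blast intro: indep2_if_cross3c)

lemma img_PLP_eq: "img_PLP A B C = img True False True A B C"
  unfolding set_eq_iff in_img_iff img_PLP_def flag_img_def by simp (blast intro: indep2_if_cross3c)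

lemma img_PPP_eq: "img_PPP A B C = img True True True A B C"
proof (rule set_eqI)
  have X: "X = 1 *s X + 0 *s 0" for X :: "complex^4" by simp
  show "p \<in> img_PPP A B C \<longleftrightarrow> p \<in> img True True True A B C" for p
    unfolding in_img_iff img_PPP_def flag_img_def by simp (metis X)
qed

lemma lpoly_diff: "lpoly F \<Longrightarrow> lpoly G \<Longrightarrow> lpoly (\<lambda>z. F z - G z)"
  using lpoly_add[OF _ lpoly_mult[OF lpoly_const[of "-1"]], of F G] by simp

lemma lpoly_flm: "lpoly (\<lambda>z. flm b A z $ i)"
proof -
  have V: "lpoly (\<lambda>z. V4 z k $ j)" for k j
    using exhaust_4[of j] by (auto simp: V4_def intro: lpoly_coord)
  have "lpoly (\<lambda>z. ptm A z $ i)"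
    unfolding ptm_def matrix_vector_mult_def
    by (simp add: sum_4) (intro lpoly_add lpoly_mult lpoly_const lpoly_coord V)
  moreover have "lpoly (\<lambda>z. (A *v V4 z k) $ j)" for k j
    unfolding matrix_vector_mult_def by (simp add: sum_4) (intro lpoly_add lpoly_mult lpoly_const lpoly_coord V)
  then have "lpoly (\<lambda>z. lnm A z $ i)"
    unfolding lnm_def using exhaust_3[of i] by (auto intro!: lpoly_diff lpoly_mult)
  ultimately show ?thesis by (cases b) (simp_all add: flm_def)
qed

lemma lpoly_flags: "lpoly (\<lambda>z. flags b1 b2 b3 A B C z x)"
  unfolding flags_def by (cases x rule: var_cases) (simp_all add: lpoly_flm)

lemma flm_nonzero:
  assumes "camera A"
  shows "\<exists>z. flm b A z $ 1 \<noteq> 0"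
proof (cases b)
  case True
  obtain X where X: "A *v X = axis 1 1" using camera_surj[OF assms] .
  obtain z where "V4 z 0 = X \<and> V4 z 4 = 0 \<and> z 8 = 1 \<and> z 9 = 0" using ex_V4 by blast
  with X True show ?thesis by (intro exI[of _ z]) (simp add: flm_def ptm_def axis_def)
next
  case False
  \<comment> \<open>Preimages of e2 and e3 are used because the cross product of these is
    e1.\<close>
  obtain P where P: "A *v P = axis 2 1" using camera_surj[OF assms] .
  obtain Q where Q: "A *v Q = axis 3 1" using camera_surj[OF assms] .
  obtain z where "V4 z 0 = P \<and> V4 z 4 = Q \<and> z 8 = 0 \<and> z 9 = 0" using ex_V4 by blast
  with P Q False show ?thesis by (intro exI[of _ z]) (simp add: flm_def lnm_def axis_def)
qed

text \<open>The first coordinates of the three images are polynomial functions, each nonzero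
  somewhere, hence nonzero at a common parameter. So the rational maps are defined somewhere for any
  three cameras.\<close>

lemma flags_valid:
  assumes "camera A" "camera B" "camera C"
  shows "\<exists>z. valid_pt (topt (flags b1 b2 b3 A B C z))"
proof -
  obtain z1 z2 z3 where z: "flm b1 A z1 $ 1 \<noteq> 0" "flm b2 B z2 $ 1 \<noteq> 0" "flm b3 C z3 $ 1 \<noteq> 0"
    using flm_nonzero assms by meson
  obtain z12 where z12: "flm b1 A z12 $ 1 \<noteq> 0 \<and> flm b2 B z12 $ 1 \<noteq> 0"
    using lpoly_nonzero_both[OF lpoly_flm[of b1 A 1] lpoly_flm[of b2 B 1], of z1 z2] z by blast
  have "lpoly (\<lambda>z. flm b1 A z $ 1 * flm b2 B z $ 1)" by (rule lpoly_mult[OF lpoly_flm lpoly_flm])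
  from lpoly_nonzero_both[OF this lpoly_flm[of b3 C 1], of z12 z3] z12 z
  obtain z where "flm b1 A z $ 1 * flm b2 B z $ 1 \<noteq> 0 \<and> flm b3 C z $ 1 \<noteq> 0" by auto
  then have "flm b1 A z \<noteq> 0" "flm b2 B z \<noteq> 0" "flm b3 C z \<noteq> 0" by auto
  then show ?thesis by (intro exI[of _ z]) (simp add: flags_def valid_pt_def)
qed

lemma vanI_img:
  assumes "camera A" "camera B" "camera C"
  shows "vanI (img b1 b2 b3 A B C) = coneI (flags b1 b2 b3 A B C)"
proof -
  obtain z0 where z0: "valid_pt (topt (flags b1 b2 b3 A B C z0))" using flags_valid[OF assms] by blast
  show ?thesis unfolding img_def by (rule vanI_param) (rule lpoly_flags, rule z0)
qed

lemma mp_irreducible_img: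
  assumes "camera A" "camera B" "camera C"
  shows "mp_irreducible (zclosure (img b1 b2 b3 A B C))"
proof -
  obtain z0 where z0: "valid_pt (topt (flags b1 b2 b3 A B C z0))" using flags_valid[OF assms] by blast
  show ?thesis unfolding img_def by (rule mp_irreducible_param) (rule lpoly_flags, rule z0)
qed

lemma vanI_zclosure_img: "vanI (zclosure (img b1 b2 b3 A B C)) = vanI (img b1 b2 b3 A B C)"
  by (rule vanI_zclosure) (unfold img_def, blast)

section \<open>Parametrizations and charts\<close>

definition bsub :: "complex^3^3 \<Rightarrow> complex^3^3 \<Rightarrow> complex^3^3 \<Rightarrow> var \<Rightarrow> mpoly" where
  "bsub E1 E2 E3 x = (case x of Inl i \<Rightarrow> \<Sum>j\<in>UNIV. pconst (E1 $ i $ j) * pvar (Inl j)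
     | Inr (Inl i) \<Rightarrow> \<Sum>j\<in>UNIV. pconst (E2 $ i $ j) * pvar (Inr (Inl j))
     | Inr (Inr i) \<Rightarrow> \<Sum>j\<in>UNIV. pconst (E3 $ i $ j) * pvar (Inr (Inr j)))"

lemma scl_asg: "scl s (asg (u, v, w)) = asg (s 0 *s u, s 1 *s v, s 2 *s w)"
  by (simp add: fun_eq_iff all_var scl_def)

lemma Es_bsub: "Es (bsub E1 E2 E3) (asg (u, v, w)) = asg (E1 *v u, E2 *v v, E3 *v w)"
  by (simp add: fun_eq_iff all_var Es_def bsub_def ev_hom matrix_vector_mult_def)

lemma ex_asg: "\<exists>u v w. f = asg (u, v, w)"
  by (metis asg_topt prod_cases3)

lemma coord_change_bsub:
  assumes "inverse_pair E1 F1" "inverse_pair E2 F2" "inverse_pair E3 F3"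
  shows "coord_change (bsub E1 E2 E3) (bsub F1 F2 F3) id"
  unfolding coord_change_def
proof (intro conjI allI impI)
  fix f :: "var \<Rightarrow> complex"
  obtain u v w where f: "f = asg (u, v, w)" using ex_asg by blast
  show "Es (bsub E1 E2 E3) (Es (bsub F1 F2 F3) f) = f" "Es (bsub F1 F2 F3) (Es (bsub E1 E2 E3) f) = f"
    using assms by (simp_all add: f Es_bsub inverse_pair_vec inverse_pair_sym)
  show "scl s (Es (bsub E1 E2 E3) f) = Es (bsub E1 E2 E3) (scl (s \<circ> id) f)" for s
    by (simp add: f Es_bsub scl_asg vector_scalar_commute)
  assume "valid_pt (topt f)"
  then have "u \<noteq> 0" "v \<noteq> 0" "w \<noteq> 0" by (simp_all add: f valid_pt_def)
  moreover have "E *v x \<noteq> 0" if "inverse_pair E F" "x \<noteq> 0" for E F :: "complex^3^3" and x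
  proof
    assume "E *v x = 0"
    then have "F *v (E *v x) = 0" by simp
    then show False using that inverse_pair_vec[OF inverse_pair_sym[OF that(1)]] by simp
  qed
  ultimately show "valid_pt (topt (Es (bsub E1 E2 E3) f))"
    using assms unfolding f Es_bsub topt_asg valid_pt_def prod.case by blast
qed auto

definition emat :: "bool \<Rightarrow> complex^3^3 \<Rightarrow> complex^3^3 \<Rightarrow> complex^3^3" where
  "emat b N N' = (if b then N else transpose N')"

lemma inverse_pair_emat: "inverse_pair N N' \<Longrightarrow> inverse_pair (emat b N N') (emat b N' N)"
  by (simp add: emat_def inverse_pair_transpose)

lemma flm_normal:
  assumes AG: "A ** G = N ** K" and N: "inverse_pair N N'"
    and z: "V4 z 0 = G *v V4 z' 0" "V4 z 4 = G *v V4 z' 4" "z 8 = z' 8" "z 9 = z' 9"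
  shows "flm b A z = (if b then 1 else det N) *s (emat b N N' *v flm b K z')"
proof -
  have AG': "A *v (G *v Y) = N *v (K *v Y)" for Y by (simp add: matrix_vector_mul_assoc AG)
  have "ptm A z = N *v ptm K z'"
  proof -
    have "z 8 *s V4 z 0 + z 9 *s V4 z 4 = G *v (z' 8 *s V4 z' 0 + z' 9 *s V4 z' 4)"
      by (simp add: z matrix_vector_right_distrib vector_scalar_commute)
    then show ?thesis by (simp add: ptm_def AG')
  qed
  moreover have "lnm A z = det N *s (transpose N' *v lnm K z')"
    by (simp add: lnm_def z AG' cross3c_mult[OF N])
  ultimately show ?thesis by (simp add: flm_def emat_def)
qed

text \<open>\<open>G\<close> only permutes the flags of space, and the factors det N produced by
  cross products are nonzero scalars, which the cone absorbs.\<close>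

lemma coneI_flags_normal:
  assumes G: "inverse_pair G Gi" and N: "inverse_pair N1 N1i" "inverse_pair N2 N2i" "inverse_pair N3 N3i"
    and K: "A ** G = N1 ** K1" "B ** G = N2 ** K2" "C ** G = N3 ** K3"
  shows "coneI (flags b1 b2 b3 A B C)
    = coneI (\<lambda>z. Es (bsub (emat b1 N1 N1i) (emat b2 N2 N2i) (emat b3 N3 N3i)) (flags b1 b2 b3 K1 K2 K3 z))"
proof -
  define \<sigma> where "\<sigma> = bsub (emat b1 N1 N1i) (emat b2 N2 N2i) (emat b3 N3 N3i)"
  define c where "c i = (if i = 0 then if b1 then 1 else det N1 else if i = 1 then if b2 then 1 else det N2 else if b3 then 1 else det N3)" for i :: nat
  have c0: "c i \<noteq> 0" for i using N by (auto simp: c_def dest: inverse_pair_det)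
  have fl: "flags b1 b2 b3 A B C z = scl c (Es \<sigma> (flags b1 b2 b3 K1 K2 K3 z'))"
    if z: "V4 z 0 = G *v V4 z' 0" "V4 z 4 = G *v V4 z' 4" "z 8 = z' 8" "z 9 = z' 9" for z z'
    unfolding flags_def \<sigma>_def Es_bsub scl_asg
    using flm_normal[OF K(1) N(1) z, of b1] flm_normal[OF K(2) N(2) z, of b2] flm_normal[OF K(3) N(3) z, of b3]
    by (simp add: c_def)
  show ?thesis
    unfolding \<sigma>_def[symmetric]
  proof (rule set_eqI, rule iffI)
    fix f assume f: "f \<in> coneI (flags b1 b2 b3 A B C)"
    show "f \<in> coneI (\<lambda>z. Es \<sigma> (flags b1 b2 b3 K1 K2 K3 z))"
      unfolding coneI_def
    proof (intro CollectI allI)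
      fix s and z' :: "nat \<Rightarrow> complex"
      obtain z where z: "V4 z 0 = G *v V4 z' 0" "V4 z 4 = G *v V4 z' 4" "z 8 = z' 8" "z 9 = z' 9" using ex_V4 by blast
      have "scl s (Es \<sigma> (flags b1 b2 b3 K1 K2 K3 z')) = scl (\<lambda>i. s i / c i) (flags b1 b2 b3 A B C z)"
        unfolding fl[OF z] using c0 by (simp add: scl_def fun_eq_iff)
      then show "ev f (scl s (Es \<sigma> (flags b1 b2 b3 K1 K2 K3 z'))) = 0" using f unfolding coneI_def by simp
    qed
  next
    fix f assume f: "f \<in> coneI (\<lambda>z. Es \<sigma> (flags b1 b2 b3 K1 K2 K3 z))"
    show "f \<in> coneI (flags b1 b2 b3 A B C)"
      unfolding coneI_def
    proof (intro CollectI allI)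
      fix s z
      obtain z' where "V4 z' 0 = Gi *v V4 z 0" "V4 z' 4 = Gi *v V4 z 4" "z' 8 = z 8" "z' 9 = z 9" using ex_V4 by blast
      then have z: "V4 z 0 = G *v V4 z' 0" "V4 z 4 = G *v V4 z' 4" "z 8 = z' 8" "z 9 = z' 9"
        by (simp_all add: inverse_pair_vec[OF G])
      have "scl s (flags b1 b2 b3 A B C z) = scl (\<lambda>i. s i * c i) (Es \<sigma> (flags b1 b2 b3 K1 K2 K3 z'))"
        unfolding fl[OF z] by (simp add: scl_def fun_eq_iff)
      then show "ev f (scl s (flags b1 b2 b3 A B C z)) = 0" using f unfolding coneI_def by simp
    qed
  qed
qed

text \<open>Two parametrizations of one cone need to be compared only generically.
  \<open>hit\<close> lifts a general chart point; \<open>cov\<close> treats the points where the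
  three normalized coordinates are nonzero; density does the rest.\<close>

lemma coneI_eqI:
  fixes \<Phi> \<phi> :: "(nat \<Rightarrow> complex) \<Rightarrow> var \<Rightarrow> complex"
  assumes \<Phi>: "\<And>x. lpoly (\<lambda>z. \<Phi> z x)" and \<phi>: "\<And>x. lpoly (\<lambda>z. \<phi> z x)"
    and hit: "\<And>y. y k \<noteq> 0 \<Longrightarrow> \<exists>z s. (\<forall>b. s b \<noteq> 0) \<and> \<Phi> z = scl s (\<phi> y)"
    and cov: "\<And>f z s. f \<in> coneI \<phi> \<Longrightarrow> scl s (\<Phi> z) n0 \<noteq> 0 \<Longrightarrow> scl s (\<Phi> z) n1 \<noteq> 0 \<Longrightarrow> scl s (\<Phi> z) n2 \<noteq> 0 \<Longrightarrow>
      ev f (scl s (\<Phi> z)) = 0"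
    and nz: "\<phi> (\<lambda>_. 1) n0 \<noteq> 0" "\<phi> (\<lambda>_. 1) n1 \<noteq> 0" "\<phi> (\<lambda>_. 1) n2 \<noteq> 0"
  shows "coneI \<Phi> = coneI \<phi>"
proof
  have lp: "lpoly (\<lambda>w. ev f (conemap \<phi> w))" "lpoly (\<lambda>w. ev f (conemap \<Phi> w))" for f
    by (rule lpoly_ev, rule lpoly_conemap, rule \<phi>) (rule lpoly_ev, rule lpoly_conemap, rule \<Phi>)
  show "coneI \<Phi> \<subseteq> coneI \<phi>"
  proof
    fix f assume f: "f \<in> coneI \<Phi>"
    have "\<forall>w. w (k + 3) \<noteq> 0 \<longrightarrow> ev f (conemap \<phi> w) = 0"
    proof (intro allI impI)
      fix w :: "nat \<Rightarrow> complex" assume "w (k + 3) \<noteq> 0"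
      then obtain z s where s: "\<forall>b. s b \<noteq> 0" "\<Phi> z = scl s (\<phi> (\<lambda>i. w (i + 3)))" using hit[of "\<lambda>i. w (i + 3)"] by auto
      then have "conemap \<phi> w = scl (\<lambda>b. w b / s b) (\<Phi> z)"
        by (simp add: conemap_def scl_def fun_eq_iff)
      then show "ev f (conemap \<phi> w) = 0" using f unfolding coneI_def by simp
    qed
    with lpoly_eq_0[OF lp(1)[of f] lpoly_coord[of "k + 3"], of "\<lambda>_. 1"] have "\<forall>w. ev f (conemap \<phi> w) = 0" by simp
    then show "f \<in> coneI \<phi>" by (simp add: coneI_eq zeroI_def)
  qed
  show "coneI \<phi> \<subseteq> coneI \<Phi>"
  proof
    fix f assume f: "f \<in> coneI \<phi>"
    define K where "K w = conemap \<Phi> w n0 * conemap \<Phi> w n1 * conemap \<Phi> w n2" for w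
    have c: "lpoly (\<lambda>w. conemap \<Phi> w x)" for x by (rule lpoly_conemap, rule \<Phi>)
    have K: "lpoly K" unfolding K_def by (rule lpoly_mult[OF lpoly_mult[OF c c] c])
    obtain z s where s: "\<forall>b. s b \<noteq> 0" "\<Phi> z = scl s (\<phi> (\<lambda>_. 1))" using hit[of "\<lambda>_. 1"] by auto
    obtain w where w: "scl (\<lambda>_. 1) (\<Phi> z) = conemap \<Phi> w" using ex_conemap by blast
    have K0: "K w \<noteq> 0" using s nz unfolding K_def w[symmetric] by (simp add: scl_def)
    have "\<forall>w. K w \<noteq> 0 \<longrightarrow> ev f (conemap \<Phi> w) = 0"
      using cov[OF f] by (auto simp: K_def conemap_def)
    with lpoly_eq_0[OF lp(2)[of f] K K0] have "\<forall>w. ev f (conemap \<Phi> w) = 0" by simp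
    then show "f \<in> coneI \<Phi>" by (simp add: coneI_eq zeroI_def)
  qed
qed

lemma chart_lpoly: "chart d \<phi> \<Longrightarrow> lpoly (\<lambda>y. \<phi> y x)"
  unfolding chart_def by (blast intro: polyfun_lpoly)

lemma V4_nth [simp]: "V4 z k $ 1 = z k" "V4 z k $ 2 = z (k + 1)" "V4 z k $ 3 = z (k + 2)" "V4 z k $ 4 = z (k + 3)"
  by (simp_all add: V4_def)

lemma vector_3_nth [simp]:
  "(vector [a, b, c] :: 'a::zero^3) $ 1 = a" "(vector [a, b, c] :: 'a::zero^3) $ 2 = b" "(vector [a, b, c] :: 'a::zero^3) $ 3 = c"
  by (simp_all add: vector_3)

lemmas flags_simps = flags_def flm_def ptm_def lnm_def scl_def

lemma flags_LLL: "coneI (flags False False False A0 B0 C0) = coneI chart_LLL"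
proof (rule coneI_eqI[where k = 0 and ?n0.0 = va2 and ?n1.0 = vb1 and ?n2.0 = vc2])
  fix y :: "nat \<Rightarrow> complex" assume "y 0 \<noteq> 0"
  \<comment> \<open>The common line of the planes of l' and l'', spanned by its points with fourth
    and third coordinate 0. Its image under \<open>C0\<close> comes out as y0 times l'', whence the
    condition on \<open>y 0\<close>.\<close>
  obtain z where z: "V4 z 0 = vector [- y 0, y 2 * y 0, 1, 0] \<and> V4 z 4 = vector [- y 1, y 2 * y 1 - y 3, 0, 1] \<and> z 8 = 0 \<and> z 9 = 0"
    using ex_V4 by blast
  have "flags False False False A0 B0 C0 z = scl (\<lambda>b. if b = 2 then y 0 else 1) (chart_LLL y)"
    by (simp add: flags_simps z fun_eq_iff all_vars chart_LLL_def algebra_simps)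
  then show "\<exists>z s. (\<forall>b. s b \<noteq> 0) \<and> flags False False False A0 B0 C0 z = scl s (chart_LLL y)"
    using \<open>y 0 \<noteq> 0\<close> by (intro exI[of _ z] exI[of _ "\<lambda>b. if b = 2 then y 0 else 1"]) simp
next
  fix f z s assume "f \<in> coneI chart_LLL" "scl s (flags False False False A0 B0 C0 z) va2 \<noteq> 0"
    "scl s (flags False False False A0 B0 C0 z) vb1 \<noteq> 0" "scl s (flags False False False A0 B0 C0 z) vc2 \<noteq> 0"
  then show "ev f (scl s (flags False False False A0 B0 C0 z)) = 0"
    by (intro cone_LLL) (assumption | simp add: flags_simps algebra_simps)+
qed (rule lpoly_flags chart_lpoly[OF chart_LLL] | simp add: chart_LLL_def)+

lemma flags_PLL: "coneI (flags True False False A0 B0 C0) = coneI chart_PLL"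
proof (rule coneI_eqI[where k = 0 and ?n0.0 = va4 and ?n1.0 = vb1 and ?n2.0 = vc2])
  fix y :: "nat \<Rightarrow> complex" assume "y 0 \<noteq> 0"
  \<comment> \<open>The same line, with the point y4 P + Q, whose third and fourth coordinates are
    y4 and 1.\<close>
  obtain z where z: "V4 z 0 = vector [- y 0, y 2 * y 0, 1, 0] \<and> V4 z 4 = vector [- y 1, y 2 * y 1 - y 3, 0, 1] \<and> z 8 = y 4 \<and> z 9 = 1"
    using ex_V4 by blast
  have "flags True False False A0 B0 C0 z = scl (\<lambda>b. if b = 2 then y 0 else 1) (chart_PLL y)"
    by (simp add: flags_simps z fun_eq_iff all_vars chart_PLL_def algebra_simps)
  then show "\<exists>z s. (\<forall>b. s b \<noteq> 0) \<and> flags True False False A0 B0 C0 z = scl s (chart_PLL y)"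
    using \<open>y 0 \<noteq> 0\<close> by (intro exI[of _ z] exI[of _ "\<lambda>b. if b = 2 then y 0 else 1"]) simp
next
  fix f z s assume *: "f \<in> coneI chart_PLL" "scl s (flags True False False A0 B0 C0 z) va4 \<noteq> 0"
    "scl s (flags True False False A0 B0 C0 z) vb1 \<noteq> 0" "scl s (flags True False False A0 B0 C0 z) vc2 \<noteq> 0"
  define v where "v = scl s (flags True False False A0 B0 C0 z)"
  have "v va2 * v vb1 * v vc2 + v vb1 * v vc4 * v va4 = v vc1 * (v vb3 * v va3 + v vb4 * v va4)"
    by (simp add: v_def flags_simps algebra_simps)
  then have "v va2 = (v vc1 * (v vb3 * v va3 + v vb4 * v va4) / v vb1 - v vc4 * v va4) / v vc2"
    using * unfolding v_def[symmetric] by (simp add: field_simps)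
  then show "ev f (scl s (flags True False False A0 B0 C0 z)) = 0"
    using * unfolding v_def[symmetric] by (intro cone_PLL)
qed (rule lpoly_flags chart_lpoly[OF chart_PLL] | simp add: chart_PLL_def)+

lemma flags_PPL: "coneI (flags True True False A0 B0 C0) = coneI chart_PPL"
proof (rule coneI_eqI[where k = 1 and ?n0.0 = va3 and ?n1.0 = vb3 and ?n2.0 = vc1])
  fix y :: "nat \<Rightarrow> complex" assume "y 1 \<noteq> 0"
  \<comment> \<open>P is the point of the chart and Q a second point whose third image lies on l'' =
    (1, y2, y3). The cross product of the two images is - y1 times l''.\<close>
  obtain z where z: "V4 z 0 = vector [- (y 2 * y 0 + y 3 * y 1), y 0, 1, y 1] \<and> V4 z 4 = vector [- y 2, 1, 0, 0] \<and> z 8 = 1 \<and> z 9 = 0"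
    using ex_V4 by blast
  have "flags True True False A0 B0 C0 z = scl (\<lambda>b. if b = 2 then - y 1 else 1) (chart_PPL y)"
    by (simp add: flags_simps z fun_eq_iff all_vars chart_PPL_def algebra_simps)
  then show "\<exists>z s. (\<forall>b. s b \<noteq> 0) \<and> flags True True False A0 B0 C0 z = scl s (chart_PPL y)"
    using \<open>y 1 \<noteq> 0\<close> by (intro exI[of _ z] exI[of _ "\<lambda>b. if b = 2 then - y 1 else 1"]) simp
next
  fix f z s assume "f \<in> coneI chart_PPL" "scl s (flags True True False A0 B0 C0 z) va3 \<noteq> 0"
    "scl s (flags True True False A0 B0 C0 z) vb3 \<noteq> 0" "scl s (flags True True False A0 B0 C0 z) vc1 \<noteq> 0"
  then show "ev f (scl s (flags True True False A0 B0 C0 z)) = 0"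
    by (intro cone_PPL) (assumption | simp add: flags_simps algebra_simps)+
qed (rule lpoly_flags chart_lpoly[OF chart_PPL] | simp add: chart_PPL_def)+

lemma flags_PPP: "coneI (flags True True True A0 B0 C0) = coneI chart_PPP"
proof (rule coneI_eqI[where k = 0 and ?n0.0 = va4 and ?n1.0 = vb4 and ?n2.0 = vc4])
  fix y :: "nat \<Rightarrow> complex"
  obtain z where z: "V4 z 0 = vector [y 0, y 1, y 2, 1] \<and> V4 z 4 = 0 \<and> z 8 = 1 \<and> z 9 = 0"
    using ex_V4 by blast
  have "flags True True True A0 B0 C0 z = scl (\<lambda>b. 1) (chart_PPP y)"
    by (simp add: flags_simps z fun_eq_iff all_vars chart_PPP_def)
  then show "\<exists>z s. (\<forall>b. s b \<noteq> 0) \<and> flags True True True A0 B0 C0 z = scl s (chart_PPP y)"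
    by (intro exI[of _ z] exI[of _ "\<lambda>b. 1"]) simp
next
  fix f z s assume "f \<in> coneI chart_PPP" "scl s (flags True True True A0 B0 C0 z) va4 \<noteq> 0"
    "scl s (flags True True True A0 B0 C0 z) vb4 \<noteq> 0" "scl s (flags True True True A0 B0 C0 z) vc4 \<noteq> 0"
  then show "ev f (scl s (flags True True True A0 B0 C0 z)) = 0"
    by (intro cone_PPP) (assumption | simp add: flags_simps algebra_simps)+
qed (rule lpoly_flags chart_lpoly[OF chart_PPP] | simp add: chart_PPP_def)+

lemma coneI_flags_chart:
  assumes cc: "coord_change \<sigma> \<tau> \<pi>" and eq: "coneI \<Phi> = coneI \<phi>"
  shows "coneI (\<lambda>z. Es \<sigma> (\<Phi> z)) = coneI (\<lambda>y. Es \<sigma> (\<phi> y))"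
  by (rule set_eqI) (simp add: coneI_coord_change[OF cc] eq)

section \<open>Minors\<close>

text \<open>The Cauchy-Binet expansion before terms are grouped by sets of rows.\<close>

lemma det_matrix_mult_rows:
  fixes R :: "'a::comm_ring_1^'r^'c" and M :: "'a^'c^'r"
  shows "det (R ** M) = (\<Sum>f\<in>UNIV. (\<Prod>i\<in>UNIV. R $ i $ f i) * det (\<chi> i. M $ f i))"
proof -
  have "(\<Prod>i\<in>UNIV. (R ** M) $ i $ p i) = (\<Sum>f\<in>UNIV. (\<Prod>i\<in>UNIV. R $ i $ f i) * (\<Prod>i\<in>UNIV. M $ f i $ p i))" for p
  proof -
    have "(\<Prod>i\<in>UNIV. (R ** M) $ i $ p i) = (\<Prod>i\<in>UNIV. \<Sum>k\<in>UNIV. R $ i $ k * M $ k $ p i)"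
      by (simp add: matrix_matrix_mult_def)
    also have "\<dots> = (\<Sum>f\<in>PiE UNIV (\<lambda>_. UNIV). \<Prod>i\<in>UNIV. R $ i $ f i * M $ f i $ p i)"
      by (rule prod_sum_PiE) auto
    finally show ?thesis by (simp add: prod.distrib)
  qed
  then have "det (R ** M) = (\<Sum>p | p permutes UNIV. of_int (sign p) *
      (\<Sum>f\<in>UNIV. (\<Prod>i\<in>UNIV. R $ i $ f i) * (\<Prod>i\<in>UNIV. M $ f i $ p i)))"
    by (simp add: det_def)
  also have "\<dots> = (\<Sum>f\<in>UNIV. \<Sum>p | p permutes UNIV. of_int (sign p) * ((\<Prod>i\<in>UNIV. R $ i $ f i) * (\<Prod>i\<in>UNIV. M $ f i $ p i)))"
    unfolding sum_distrib_left by (rule sum.swap)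
  finally show ?thesis by (simp add: det_def sum_distrib_left mult_ac)
qed

text \<open>Choices that repeat a row contribute a zero determinant, and the injective ones
  contribute maximal minors.\<close>

lemma det_mult_in_maxminors:
  fixes R :: "mpoly^'r^'c" and M :: "mpoly^'c^'r"
  shows "det (R ** M) \<in> ideal_gen (maxminors M)"
  unfolding det_matrix_mult_rows
proof (rule ideal_sum[OF is_ideal_ideal_gen])
  fix f :: "'c \<Rightarrow> 'r"
  show "(\<Prod>i\<in>UNIV. R $ i $ f i) * det (\<chi> i. M $ f i) \<in> ideal_gen (maxminors M)"
  proof (cases "inj f")
    case True
    then have "det (\<chi> i. M $ f i) \<in> ideal_gen (maxminors M)"
      by (intro ideal_gen_base) (auto simp: maxminors_def)
    then show ?thesis using is_ideal_ideal_gen unfolding is_ideal_def by blast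
  next
    case False
    then obtain i j where "i \<noteq> j" "f i = f j" by (auto simp: inj_on_def)
    then have "det (\<chi> i. M $ f i) = 0" by (intro det_identical_rows[of i j]) (simp_all add: row_def)
    then show ?thesis using is_ideal_ideal_gen unfolding is_ideal_def by simp
  qed
qed

definition evm :: "mpoly^'c^'r \<Rightarrow> (var \<Rightarrow> complex) \<Rightarrow> complex^'c^'r" where
  "evm M v = (\<chi> i j. ev (M $ i $ j) v)"

definition pcm :: "complex^'c^'r \<Rightarrow> mpoly^'c^'r" where
  "pcm R = (\<chi> i j. pconst (R $ i $ j))"

lemma evm_mult: "evm (R ** M) v = evm R v ** evm M v"
  by (simp add: evm_def matrix_matrix_mult_def vec_eq_iff ev_hom)

lemma evm_pcm: "evm (pcm R) v = R"
  by (simp add: evm_def pcm_def vec_eq_iff ev_hom)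

lemma ev_det_evm: "ev (det M) v = det (evm M v)"
  by (simp add: ev_det evm_def)

text \<open>Constant matrices on either side do not lead out of the ideal of maximal minors, so a
  minor computed in normal coordinates certifies membership in the original ideal.\<close>

lemma minor_transfer:
  fixes M :: "mpoly^'c^'r" and R :: "complex^'r^'r" and K :: "complex^'c^'c" and r :: "'c \<Rightarrow> 'r"
  assumes "\<And>v. ev g v = a * det (\<chi> i. (R ** (evm M v ** K)) $ r i)"
  shows "g \<in> ideal_gen (maxminors M)"
proof -
  define Rr :: "complex^'r^'c" where "Rr = (\<chi> i. R $ r i)"
  have rows: "(\<chi> i. (R ** X) $ r i) = Rr ** X" for X :: "complex^'c^'r"
    by (simp add: Rr_def matrix_matrix_mult_def vec_eq_iff)
  have "ev g v = a * (det (Rr ** evm M v) * det K)" for v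
    unfolding assms rows by (simp add: det_mul matrix_mul_assoc)
  then have "g = pconst (a * det K) * det (pcm Rr ** M)"
    by (intro ev_inject) (simp add: ev_hom ev_det_evm evm_mult evm_pcm)
  then show ?thesis
    using det_mult_in_maxminors[of "pcm Rr" M] is_ideal_ideal_gen unfolding is_ideal_def by metis
qed

text \<open>A kernel vector makes every square selection of rows singular. This gives the easy
  inclusion for the determinantal ideals.\<close>

lemma maxminor_eq_0:
  assumes "g \<in> maxminors M" "k \<noteq> 0" "evm M v *v k = 0"
  shows "ev g v = 0"
proof -
  obtain r where r: "g = det (\<chi> i. M $ r i)" using assms(1) by (auto simp: maxminors_def)
  have "evm (\<chi> i. M $ r i) v *v k = 0"
    using assms(3) by (simp add: evm_def matrix_vector_mult_def vec_eq_iff)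
  then have "\<not> invertible (evm (\<chi> i. M $ r i) v)"
    using assms(2) by (metis invertible_left_inverse matrix_left_invertible_ker)
  then show ?thesis unfolding r ev_det_evm by (simp add: invertible_det_nz)
qed

section \<open>Determinants with unit pivots\<close>

lemma det_axis_rows:
  fixes S :: "'a::comm_ring_1^'n^'n"
  assumes axis: "\<And>i j. i \<notin> T \<Longrightarrow> S $ i $ j = (if j = i then 1 else 0)"
  shows "det S = (\<Sum>p | p permutes T. of_int (sign p) * (\<Prod>i\<in>T. S $ i $ p i))"
proof -
  have "det S = (\<Sum>p | p permutes T. of_int (sign p) * (\<Prod>i\<in>UNIV. S $ i $ p i))"
    unfolding det_def
  proof (rule sum.mono_neutral_right)
    show "{p. p permutes T} \<subseteq> {p. p permutes UNIV}" using permutes_subset by blast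
    show "\<forall>p\<in>{p. p permutes UNIV} - {p. p permutes T}. of_int (sign p) * (\<Prod>i\<in>UNIV. S $ i $ p i) = 0"
    proof
      fix p assume "p \<in> {p. p permutes UNIV} - {p. p permutes T}"
      then obtain i where "i \<notin> T" "p i \<noteq> i" unfolding permutes_def by auto
      then have "S $ i $ p i = 0" using axis by simp
      then have "(\<Prod>i\<in>UNIV. S $ i $ p i) = 0" by (intro prod_zero) auto
      then show "of_int (sign p) * (\<Prod>i\<in>UNIV. S $ i $ p i) = 0" by simp
    qed
  qed (simp add: finite_permutations)
  also have "\<dots> = (\<Sum>p | p permutes T. of_int (sign p) * (\<Prod>i\<in>T. S $ i $ p i))"
  proof (rule sum.cong)
    fix p assume "p \<in> {p. p permutes T}"
    then have "S $ i $ p i = 1" if "i \<notin> T" for i using axis that permutes_not_in by fastforce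
    then have "(\<Prod>i\<in>UNIV. S $ i $ p i) = (\<Prod>i\<in>T. S $ i $ p i)" by (intro prod.mono_neutral_right) auto
    then show "of_int (sign p) * (\<Prod>i\<in>UNIV. S $ i $ p i) = of_int (sign p) * (\<Prod>i\<in>T. S $ i $ p i)" by simp
  qed simp
  finally show ?thesis .
qed

lemma det_axis_rows_2:
  fixes S :: "'a::comm_ring_1^'n^'n"
  assumes "x \<noteq> y" and "\<And>i j. i \<notin> {x, y} \<Longrightarrow> S $ i $ j = (if j = i then 1 else 0)"
  shows "det S = S $ x $ x * S $ y $ y - S $ x $ y * S $ y $ x"
proof -
  have f: "finite {y}" "x \<notin> {y}" using assms(1) by auto
  have "det S = (\<Sum>p | p permutes {x, y}. of_int (sign p) * (\<Prod>i\<in>{x, y}. S $ i $ p i))"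
    by (rule det_axis_rows) (rule assms(2))
  then show ?thesis
    unfolding sum_over_permutations_insert[OF f] permutes_sing
    using assms(1) by (simp add: sign_swap_id sign_id swap_id_eq)
qed

lemma det_axis_rows_3:
  fixes S :: "'a::comm_ring_1^'n^'n"
  assumes d: "x \<noteq> y" "x \<noteq> z" "y \<noteq> z" and "\<And>i j. i \<notin> {x, y, z} \<Longrightarrow> S $ i $ j = (if j = i then 1 else 0)"
  shows "det S = S $ x $ x * S $ y $ y * S $ z $ z + S $ x $ y * S $ y $ z * S $ z $ x + S $ x $ z * S $ y $ x * S $ z $ y
    - S $ x $ x * S $ y $ z * S $ z $ y - S $ x $ y * S $ y $ x * S $ z $ z - S $ x $ z * S $ y $ y * S $ z $ x"
proof -
  have f: "finite {y, z}" "x \<notin> {y, z}" "finite {z}" "y \<notin> {z}" using d by auto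
  have "det S = (\<Sum>p | p permutes {x, y, z}. of_int (sign p) * (\<Prod>i\<in>{x, y, z}. S $ i $ p i))"
    by (rule det_axis_rows) (rule assms(4))
  then show ?thesis
    unfolding sum_over_permutations_insert[OF f(1,2)] sum_over_permutations_insert[OF f(3,4)] permutes_sing
    using d d[symmetric] by (simp add: sign_swap_id permutation_swap_id sign_compose sign_id swap_id_eq)
qed

text \<open>Elimination with unit pivots: \<open>S\<close> carries the Schur complement on \<open>T\<close>.\<close>
lemma det_schur:
  fixes W :: "'a::comm_ring_1^'n^'n"
  assumes W: "\<And>i j. i \<notin> T \<Longrightarrow> j \<notin> T \<Longrightarrow> W $ i $ j = (if j = i then 1 else 0)"
  defines "S \<equiv> \<chi> i j. if i \<in> T then if j \<in> T then W $ i $ j - (\<Sum>k\<in>UNIV. if k \<in> T then 0 else W $ i $ k * W $ k $ j)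
      else W $ i $ j else if j = i then 1 else 0"
  shows "det W = det S"
proof -
  \<comment> \<open>The column operations that clear the pivot rows in the columns of
    \<open>T\<close>.\<close>
  define N where "N = (\<chi> c j. if c = j then 1 else if c \<notin> T \<and> j \<in> T then - W $ c $ j else 0)"
  have "det N = det (transpose N)" by (simp add: det_transpose)
  also have "\<dots> = (\<Sum>p | p permutes T. of_int (sign p) * (\<Prod>i\<in>T. transpose N $ i $ p i))"
    by (rule det_axis_rows) (auto simp: transpose_def N_def)
  also have "\<dots> = (\<Sum>p\<in>{id}. of_int (sign p) * (\<Prod>i\<in>T. transpose N $ i $ p i))"
  proof (rule sum.mono_neutral_right)
    show "\<forall>p\<in>{p. p permutes T} - {id}. of_int (sign p) * (\<Prod>i\<in>T. transpose N $ i $ p i) = 0"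
    proof
      fix p assume p: "p \<in> {p. p permutes T} - {id}"
      then obtain i where i: "p i \<noteq> i" by (auto simp: fun_eq_iff)
      then have "i \<in> T" "p i \<in> T" using p by (auto simp: permutes_in_image dest: permutes_not_in)
      then have "(\<Prod>i\<in>T. transpose N $ i $ p i) = 0"
        using i by (intro prod_zero) (auto simp: transpose_def N_def intro!: bexI[of _ i])
      then show "of_int (sign p) * (\<Prod>i\<in>T. transpose N $ i $ p i) = 0" by simp
    qed
  qed (auto simp: finite_permutations permutes_id)
  also have "\<dots> = 1" by (simp add: transpose_def N_def sign_id)
  finally have N: "det N = 1" .
  have "(W ** N) $ i $ j = S $ i $ j" for i j
  proof (cases "j \<in> T")
    case False
    then have "(W ** N) $ i $ j = (\<Sum>c\<in>UNIV. if c = j then W $ i $ c else 0)"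
      unfolding matrix_matrix_mult_def N_def vec_lambda_beta by (intro sum.cong) auto
    then show ?thesis using False W[of i j] by (simp add: S_def)
  next
    case True
    have "(W ** N) $ i $ j = (\<Sum>c\<in>UNIV. (if c = j then W $ i $ c else 0) - (if c \<in> T then 0 else W $ i $ c * W $ c $ j))"
      unfolding matrix_matrix_mult_def N_def vec_lambda_beta using True by (intro sum.cong) auto
    also have "\<dots> = W $ i $ j - (\<Sum>k\<in>UNIV. if k \<in> T then 0 else W $ i $ k * W $ k $ j)"
      by (simp add: sum_subtractf)
    finally have e: "(W ** N) $ i $ j = W $ i $ j - (\<Sum>k\<in>UNIV. if k \<in> T then 0 else W $ i $ k * W $ k $ j)" .
    show ?thesis
    proof (cases "i \<in> T")
      case False
      then have "(\<Sum>k\<in>UNIV. if k \<in> T then 0 else W $ i $ k * W $ k $ j) = (\<Sum>k\<in>UNIV. if k = i then W $ k $ j else 0)"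
        using W by (intro sum.cong) auto
      then show ?thesis using e False True by (simp add: S_def) (metis False)
    qed (use True e in \<open>simp add: S_def\<close>)
  qed
  then have "W ** N = S" by (simp add: vec_eq_iff)
  then show ?thesis using det_mul[of W N] N by simp
qed

lemma sum_UNIV_Plus:
  "(\<Sum>x\<in>(UNIV :: ('a::finite + 'b::finite) set). f x) = (\<Sum>i\<in>UNIV. f (Inl i)) + (\<Sum>j\<in>UNIV. f (Inr j))"
  by (simp add: UNIV_Plus_UNIV[symmetric] sum.Plus del: UNIV_Plus_UNIV)

lemma all_Plus: "(\<forall>x::'a + 'b. P x) \<longleftrightarrow> (\<forall>i. P (Inl i)) \<and> (\<forall>j. P (Inr j))"
  by (metis sum.exhaust)

lemma col6_simps [simp]:
  "col6 (Inl 1) = Some 1" "col6 (Inl 2) = Some 2" "col6 (Inl 3) = Some 3" "col6 (Inr 1) = Some 4" "col6 (Inr 2) = None" "col6 (Inr 3) = None"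
  by (simp_all add: col6_def e4_def)

lemma col7_simps [simp]:
  "col7 (Inl 1) = Some 1" "col7 (Inl 2) = Some 2" "col7 (Inl 3) = Some 3" "col7 (Inr (Inl 1)) = Some 4"
  "col7 (Inr (Inl 2)) = None" "col7 (Inr (Inl 3)) = None" "col7 (Inr (Inr k)) = None"
  by (simp_all add: col7_def e4_def)

lemma vec_eq_Plus: "u = v \<longleftrightarrow> (\<forall>i. u $ Inl i = v $ Inl i) \<and> (\<forall>j. u $ Inr j = v $ Inr j)" for u v :: "'a^('b::finite + 'c::finite)"
  by (simp add: vec_eq_iff all_Plus)

definition plc :: "complex^4^3 \<Rightarrow> complex^4^3 \<Rightarrow> complex^4^3 \<Rightarrow> complex^3 \<Rightarrow> complex^3 \<Rightarrow> complex^3 \<Rightarrow> complex^(3+3)^(3+3+1)" where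
  "plc P Q D x y l = (\<chi> row col. case row of
     Inl i \<Rightarrow> (case col6 col of Some k \<Rightarrow> P $ i $ k | None \<Rightarrow> if col = Inr 2 then x $ i else 0)
   | Inr (Inl j) \<Rightarrow> (case col6 col of Some k \<Rightarrow> Q $ j $ k | None \<Rightarrow> if col = Inr 3 then y $ j else 0)
   | Inr (Inr _) \<Rightarrow> (case col6 col of Some k \<Rightarrow> (\<Sum>m\<in>UNIV. l $ m * D $ m $ k) | None \<Rightarrow> 0))"

lemma evm_pl_mat: "evm (pl_mat P Q D Inl (Inr \<circ> Inl) (Inr \<circ> Inr)) (asg (x, y, l)) = plc P Q D x y l"
  by (auto simp: evm_def pl_mat_def plc_def vec_eq_iff ev_hom split: sum.split option.split)

text \<open>The column change: \<open>G\<close> on the four camera columns, the identity on the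
  columns that hold image points. Together with a row change such as \<open>R7\<close> it carries
  the matrix to normal coordinates.\<close>

definition K6 :: "complex^4^4 \<Rightarrow> complex^(3+3)^(3+3)" where
  "K6 G = (\<chi> c c'. case col6 c of Some k \<Rightarrow> (case col6 c' of Some k' \<Rightarrow> G $ k $ k' | None \<Rightarrow> 0)
     | None \<Rightarrow> if c = c' then 1 else 0)"

definition R7 :: "complex^3^3 \<Rightarrow> complex^3^3 \<Rightarrow> complex^(3+3+1)^(3+3+1)" where
  "R7 N1 N2 = (\<chi> r r'. case r of Inl i \<Rightarrow> (case r' of Inl j \<Rightarrow> N1 $ i $ j | _ \<Rightarrow> 0)
     | Inr (Inl i) \<Rightarrow> (case r' of Inr (Inl j) \<Rightarrow> N2 $ i $ j | _ \<Rightarrow> 0)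
     | Inr (Inr _) \<Rightarrow> (case r' of Inr (Inr _) \<Rightarrow> 1 | _ \<Rightarrow> 0))"

lemma plc_mult_K6: "plc P Q D x y l ** K6 G = plc (P ** G) (Q ** G) (D ** G) x y l"
  unfolding vec_eq_Plus forall_3
  by (simp add: plc_def K6_def matrix_matrix_mult_def vec_eq_Plus all_Plus forall_3 sum_UNIV_Plus sum_3 sum_4 algebra_simps)

lemma R7_mult_plc: "R7 N1 N2 ** plc P Q D x y l = plc (N1 ** P) (N2 ** Q) D (N1 *v x) (N2 *v y) l"
  unfolding vec_eq_Plus forall_3
  by (simp add: plc_def R7_def matrix_matrix_mult_def matrix_vector_mult_def vec_eq_Plus all_Plus forall_3 sum_UNIV_Plus sum_3)

lemma plc_line: "plc P Q (N ** D) x y l = plc P Q D x y (transpose N *v l)"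
proof -
  have "(\<Sum>m\<in>UNIV. l $ m * (N ** D) $ m $ k) = (\<Sum>m\<in>UNIV. (transpose N *v l) $ m * D $ m $ k)" for k
    by (simp add: matrix_matrix_mult_def matrix_vector_mult_def transpose_def sum_3 algebra_simps)
  then show ?thesis by (simp only: plc_def)
qed

definition sel6 :: "'r \<Rightarrow> 'r \<Rightarrow> 'r \<Rightarrow> 'r \<Rightarrow> 'r \<Rightarrow> 'r \<Rightarrow> 3 + 3 \<Rightarrow> 'r" where
  "sel6 r1 r2 r3 r4 r5 r6 i = (case i of Inl c \<Rightarrow> if c = 1 then r1 else if c = 2 then r2 else r3
     | Inr c \<Rightarrow> if c = 1 then r4 else if c = 2 then r5 else r6)"

lemma sel6_simps [simp]: "sel6 r1 r2 r3 r4 r5 r6 (Inl 1) = r1" "sel6 r1 r2 r3 r4 r5 r6 (Inl 2) = r2" "sel6 r1 r2 r3 r4 r5 r6 (Inl 3) = r3"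
  "sel6 r1 r2 r3 r4 r5 r6 (Inr 1) = r4" "sel6 r1 r2 r3 r4 r5 r6 (Inr 2) = r5" "sel6 r1 r2 r3 r4 r5 r6 (Inr 3) = r6"
  by (simp_all add: sel6_def)

text \<open>If the rows chosen for the four camera columns form the identity there, the determinant
  shrinks to the two columns of image points.\<close>

lemma det6_schur:
  fixes W :: "complex^(3+3)^(3+3)"
  assumes "\<forall>i. i \<noteq> Inr 2 \<longrightarrow> i \<noteq> Inr 3 \<longrightarrow> (\<forall>j. j \<noteq> Inr 2 \<longrightarrow> j \<noteq> Inr 3 \<longrightarrow> W $ i $ j = (if j = i then 1 else 0))"
  defines "c i j \<equiv> W $ i $ j - (W $ i $ Inl 1 * W $ Inl 1 $ j + W $ i $ Inl 2 * W $ Inl 2 $ j + W $ i $ Inl 3 * W $ Inl 3 $ j + W $ i $ Inr 1 * W $ Inr 1 $ j)"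
  shows "det W = c (Inr 2) (Inr 2) * c (Inr 3) (Inr 3) - c (Inr 2) (Inr 3) * c (Inr 3) (Inr 2)"
proof -
  have "det W = det (\<chi> i j. if i \<in> {Inr 2, Inr 3} then if j \<in> {Inr 2, Inr 3} then W $ i $ j - (\<Sum>k\<in>UNIV. if k \<in> {Inr 2, Inr 3} then 0 else W $ i $ k * W $ k $ j)
      else W $ i $ j else if j = i then 1 else 0)"
    by (rule det_schur) (use assms(1) in auto)
  also have "\<dots> = c (Inr 2) (Inr 2) * c (Inr 3) (Inr 3) - c (Inr 2) (Inr 3) * c (Inr 3) (Inr 2)"
    by (subst det_axis_rows_2[of "Inr 2" "Inr 3"]) (simp_all add: c_def sum_UNIV_Plus sum_3 add.assoc)
  finally show ?thesis .
qed

text \<open>The first row of \<open>B0\<close> and the three rows of \<open>A0\<close> are the four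
  unit vectors in order and serve as pivots; only the last two rows vary.\<close>

lemma minors_PPL:
  "det (\<chi> i. plc A0 B0 C0 x y l $ sel6 (Inr (Inl 1)) (Inl 1) (Inl 2) (Inl 3) (Inr (Inl 2)) (Inr (Inl 3)) i) = - (x $ 2 * y $ 3 - x $ 3 * y $ 2)"
  "det (\<chi> i. plc A0 B0 C0 x y l $ sel6 (Inr (Inl 1)) (Inl 1) (Inl 2) (Inl 3) (Inr (Inl 2)) (Inr (Inr 1)) i)
    = l $ 1 * y $ 1 * x $ 2 + l $ 2 * x $ 1 * y $ 2 + l $ 3 * x $ 3 * y $ 2"
  "det (\<chi> i. plc A0 B0 C0 x y l $ sel6 (Inr (Inl 1)) (Inl 1) (Inl 2) (Inl 3) (Inr (Inl 3)) (Inr (Inr 1)) i)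
    = l $ 1 * y $ 1 * x $ 3 + l $ 2 * x $ 1 * y $ 3 + l $ 3 * x $ 3 * y $ 3"
  by (subst det6_schur; simp add: plc_def all_Plus forall_3 sum_3 algebra_simps)+

definition twoc :: "complex^4^3 \<Rightarrow> complex^4^3 \<Rightarrow> complex^3 \<Rightarrow> complex^3 \<Rightarrow> complex^(3+3)^(3+3)" where
  "twoc P Q x y = (\<chi> row col. case row of
     Inl i \<Rightarrow> (case col6 col of Some k \<Rightarrow> P $ i $ k | None \<Rightarrow> if col = Inr 2 then x $ i else 0)
   | Inr j \<Rightarrow> (case col6 col of Some k \<Rightarrow> Q $ j $ k | None \<Rightarrow> if col = Inr 3 then y $ j else 0))"

lemma evm_two_mat:
  "evm (two_mat P Q xv yv) v = twoc P Q (\<chi> i. v (xv i)) (\<chi> i. v (yv i))"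
  by (auto simp: evm_def two_mat_def twoc_def vec_eq_iff ev_hom split: sum.split option.split)

definition R6 :: "complex^3^3 \<Rightarrow> complex^3^3 \<Rightarrow> complex^(3+3)^(3+3)" where
  "R6 N1 N2 = (\<chi> r r'. case r of Inl i \<Rightarrow> (case r' of Inl j \<Rightarrow> N1 $ i $ j | _ \<Rightarrow> 0)
     | Inr i \<Rightarrow> (case r' of Inr j \<Rightarrow> N2 $ i $ j | _ \<Rightarrow> 0))"

lemma twoc_mult_K6: "twoc P Q x y ** K6 G = twoc (P ** G) (Q ** G) x y"
  unfolding vec_eq_Plus forall_3
  by (simp add: twoc_def K6_def matrix_matrix_mult_def vec_eq_Plus all_Plus forall_3 sum_UNIV_Plus sum_3 sum_4 algebra_simps)

lemma R6_mult_twoc: "R6 N1 N2 ** twoc P Q x y = twoc (N1 ** P) (N2 ** Q) (N1 *v x) (N2 *v y)"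
  unfolding vec_eq_Plus forall_3
  by (simp add: twoc_def R6_def matrix_matrix_mult_def matrix_vector_mult_def vec_eq_Plus all_Plus forall_3 sum_UNIV_Plus sum_3)

text \<open>Each standard camera lacks one unit vector, and the pivot for it is taken from the other
  camera.\<close>

lemma minors_two:
  "det (\<chi> i. twoc A0 B0 x y $ sel6 (Inr 1) (Inl 1) (Inl 2) (Inl 3) (Inr 2) (Inr 3) i) = - (x $ 2 * y $ 3 - x $ 3 * y $ 2)"
  "det (\<chi> i. twoc A0 C0 x y $ sel6 (Inr 1) (Inl 1) (Inl 2) (Inl 3) (Inr 2) (Inr 3) i) = y $ 2 * x $ 3 - x $ 1 * y $ 3"
  "det (\<chi> i. twoc B0 C0 x y $ sel6 (Inl 1) (Inr 2) (Inl 2) (Inl 3) (Inr 1) (Inr 3) i) = - (x $ 1 * y $ 3 - x $ 3 * y $ 1)"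
  by (subst det6_schur; simp add: twoc_def all_Plus forall_3 sum_3 algebra_simps)+

definition threec :: "complex^4^3 \<Rightarrow> complex^4^3 \<Rightarrow> complex^4^3 \<Rightarrow> complex^3 \<Rightarrow> complex^3 \<Rightarrow> complex^3 \<Rightarrow> complex^(3+3+1)^(3+3+3)" where
  "threec P Q D x y z = (\<chi> row col. case row of
     Inl i \<Rightarrow> (case col7 col of Some k \<Rightarrow> P $ i $ k | None \<Rightarrow> if col = Inr (Inl 2) then x $ i else 0)
   | Inr (Inl j) \<Rightarrow> (case col7 col of Some k \<Rightarrow> Q $ j $ k | None \<Rightarrow> if col = Inr (Inl 3) then y $ j else 0)
   | Inr (Inr m) \<Rightarrow> (case col7 col of Some k \<Rightarrow> D $ m $ k | None \<Rightarrow> if col = Inr (Inr 1) then z $ m else 0))"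

lemma evm_three_mat: "evm (three_mat P Q D) (asg (x, y, z)) = threec P Q D x y z"
  by (auto simp: evm_def three_mat_def threec_def vec_eq_iff ev_hom split: sum.split option.split)

definition K7 :: "complex^4^4 \<Rightarrow> complex^(3+3+1)^(3+3+1)" where
  "K7 G = (\<chi> c c'. case col7 c of Some k \<Rightarrow> (case col7 c' of Some k' \<Rightarrow> G $ k $ k' | None \<Rightarrow> 0)
     | None \<Rightarrow> if c = c' then 1 else 0)"

definition R9 :: "complex^3^3 \<Rightarrow> complex^3^3 \<Rightarrow> complex^3^3 \<Rightarrow> complex^(3+3+3)^(3+3+3)" where
  "R9 N1 N2 N3 = (\<chi> r r'. case r of Inl i \<Rightarrow> (case r' of Inl j \<Rightarrow> N1 $ i $ j | _ \<Rightarrow> 0)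
     | Inr (Inl i) \<Rightarrow> (case r' of Inr (Inl j) \<Rightarrow> N2 $ i $ j | _ \<Rightarrow> 0)
     | Inr (Inr i) \<Rightarrow> (case r' of Inr (Inr j) \<Rightarrow> N3 $ i $ j | _ \<Rightarrow> 0))"

lemma threec_mult_K7: "threec P Q D x y z ** K7 G = threec (P ** G) (Q ** G) (D ** G) x y z"
  unfolding vec_eq_Plus forall_3
  by (simp add: threec_def K7_def matrix_matrix_mult_def vec_eq_Plus all_Plus forall_3 sum_UNIV_Plus sum_3 sum_4 algebra_simps)

lemma R9_mult_threec: "R9 N1 N2 N3 ** threec P Q D x y z = threec (N1 ** P) (N2 ** Q) (N3 ** D) (N1 *v x) (N2 *v y) (N3 *v z)"
  unfolding vec_eq_Plus forall_3
  by (simp add: threec_def R9_def matrix_matrix_mult_def matrix_vector_mult_def vec_eq_Plus all_Plus forall_3 sum_UNIV_Plus sum_3)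

lemma det7_schur:
  fixes W :: "complex^(3+3+1)^(3+3+1)"
  assumes "\<forall>i. i \<notin> {Inr (Inl 2), Inr (Inl 3), Inr (Inr 1)} \<longrightarrow> (\<forall>j. j \<notin> {Inr (Inl 2), Inr (Inl 3), Inr (Inr 1)} \<longrightarrow> W $ i $ j = (if j = i then 1 else 0))"
  defines "c i j \<equiv> W $ i $ j - (W $ i $ Inl 1 * W $ Inl 1 $ j + W $ i $ Inl 2 * W $ Inl 2 $ j + W $ i $ Inl 3 * W $ Inl 3 $ j + W $ i $ Inr (Inl 1) * W $ Inr (Inl 1) $ j)"
  defines "x \<equiv> Inr (Inl 2)" and "y \<equiv> Inr (Inl 3)" and "z \<equiv> Inr (Inr 1)"
  shows "det W = c x x * c y y * c z z + c x y * c y z * c z x + c x z * c y x * c z y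
    - c x x * c y z * c z y - c x y * c y x * c z z - c x z * c y y * c z x"
proof -
  have "det W = det (\<chi> i j. if i \<in> {x, y, z} then if j \<in> {x, y, z} then W $ i $ j - (\<Sum>k\<in>UNIV. if k \<in> {x, y, z} then 0 else W $ i $ k * W $ k $ j)
      else W $ i $ j else if j = i then 1 else 0)"
    by (rule det_schur) (use assms(1) in \<open>auto simp: x_def y_def z_def\<close>)
  also have "\<dots> = c x x * c y y * c z z + c x y * c y z * c z x + c x z * c y x * c z y
    - c x x * c y z * c z y - c x y * c y x * c z z - c x z * c y y * c z x"
    by (subst det_axis_rows_3[of x y z]) (simp_all add: c_def x_def y_def z_def sum_UNIV_Plus sum_3 add.assoc)
  finally show ?thesis .
qed

definition sel7 :: "'r \<Rightarrow> 'r \<Rightarrow> 'r \<Rightarrow> 'r \<Rightarrow> 'r \<Rightarrow> 'r \<Rightarrow> 'r \<Rightarrow> 3 + 3 + 1 \<Rightarrow> 'r" where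
  "sel7 r1 r2 r3 r4 r5 r6 r7 i = (case i of Inl c \<Rightarrow> if c = 1 then r1 else if c = 2 then r2 else r3
     | Inr (Inl c) \<Rightarrow> if c = 1 then r4 else if c = 2 then r5 else r6 | Inr (Inr _) \<Rightarrow> r7)"

text \<open>The pivots are again the first row of \<open>B0\<close> and the rows of
  \<open>A0\<close>. The other rows record coordinate 3 in the second view and coordinates 1 and 2
  in the third, which produces the cubic generator.\<close>

lemma minor_PPP:
  "det (\<chi> i. threec A0 B0 C0 x y z $ sel7 (Inr (Inl 1)) (Inl 1) (Inl 2) (Inl 3) (Inr (Inl 2)) (Inr (Inr 1)) (Inr (Inr 2)) i)
    = x $ 2 * y $ 1 * z $ 2 - x $ 1 * y $ 2 * z $ 1"
  by (subst det7_schur; simp add: threec_def sel7_def all_Plus forall_3 sum_3 algebra_simps)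

section \<open>The ideals of the multi-view varieties\<close>

locale normal_cameras =
  fixes A B C :: "complex^4^3" and G Gi :: "complex^4^4" and N1 N1i N2 N2i N3 N3i :: "complex^3^3"
  assumes cam: "camera A" "camera B" "camera C"
    and G: "inverse_pair G Gi" and N: "inverse_pair N1 N1i" "inverse_pair N2 N2i" "inverse_pair N3 N3i"
    and K: "A ** G = N1 ** A0" "B ** G = N2 ** B0" "C ** G = N3 ** C0"
begin

lemma img_chart:
  assumes \<phi>: "chart d \<phi>" "coneI (flags b1 b2 b3 A0 B0 C0) = coneI \<phi>" "coneI \<phi> = ideal_gen H"
  defines "\<sigma> \<equiv> bsub (emat b1 N1 N1i) (emat b2 N2 N2i) (emat b3 N3 N3i)"
    and "\<tau> \<equiv> bsub (emat b1 N1i N1) (emat b2 N2i N2) (emat b3 N3i N3)"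
  shows "vanI (img b1 b2 b3 A B C) = coneI (\<lambda>y. Es \<sigma> (\<phi> y))"
    "chart d (\<lambda>y. Es \<sigma> (\<phi> y))"
    "vanI (img b1 b2 b3 A B C) = ideal_gen (subst \<tau> ` H)"
proof -
  have cc: "coord_change \<sigma> \<tau> id"
    unfolding \<sigma>_def \<tau>_def by (intro coord_change_bsub inverse_pair_emat N)
  show 1: "vanI (img b1 b2 b3 A B C) = coneI (\<lambda>y. Es \<sigma> (\<phi> y))"
    unfolding vanI_img[OF cam] coneI_flags_normal[OF G N K]
    using coneI_flags_chart[OF cc \<phi>(2)] unfolding \<sigma>_def .
  show "chart d (\<lambda>y. Es \<sigma> (\<phi> y))" by (rule chart_coord_change[OF cc \<phi>(1)])
  show "vanI (img b1 b2 b3 A B C) = ideal_gen (subst \<tau> ` H)"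
    unfolding 1 by (rule coneI_coord_change_ideal[OF cc \<phi>(3)])
qed

end

text \<open>Exchanges the transported generators of the normal form for the minors, which vanish on
  the variety and generate the former.\<close>

lemma ideal_gen_replace:
  assumes "J = ideal_gen H" "H' \<subseteq> J" "H \<subseteq> ideal_gen H'"
  shows "J = ideal_gen H'"
  using assms ideal_gen_least[OF is_ideal_ideal_gen] by blast

lemma vanI_imgI:
  assumes "\<And>s z. s 0 \<noteq> 0 \<Longrightarrow> s 1 \<noteq> 0 \<Longrightarrow> s 2 \<noteq> 0 \<Longrightarrow>
    ev g (asg (s 0 *s flm b1 A z, s 1 *s flm b2 B z, s (2::nat) *s flm b3 C z)) = 0"
  shows "g \<in> vanI (img b1 b2 b3 A B C)"
  unfolding vanI_def
proof (intro CollectI ballI)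
  fix p assume "p \<in> img b1 b2 b3 A B C"
  then obtain z where "p = topt (flags b1 b2 b3 A B C z)" unfolding img_def by blast
  then show "mvanish g p" using assms by (simp add: mvanish_iff flags_def scl_asg)
qed

text \<open>A scene point followed by the scales that relate its projections to the given image
  points: the solution of the homogeneous system of a multi-view matrix.\<close>

definition k6 :: "complex^4 \<Rightarrow> complex \<Rightarrow> complex \<Rightarrow> complex^(3+3)" where
  "k6 X a b = (\<chi> col. case col6 col of Some j \<Rightarrow> X $ j | None \<Rightarrow> if col = Inr 2 then a else b)"

definition k7 :: "complex^4 \<Rightarrow> complex \<Rightarrow> complex \<Rightarrow> complex \<Rightarrow> complex^(3+3+1)" where
  "k7 X a b c = (\<chi> col. case col7 col of Some j \<Rightarrow> X $ j | None \<Rightarrow> if col = Inr (Inl 2) then a else if col = Inr (Inl 3) then b else c)"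

lemma k6_nonzero: "a \<noteq> 0 \<Longrightarrow> k6 X a b \<noteq> 0"
  by (auto simp: k6_def vec_eq_iff intro!: exI[of _ "Inr 2"])

lemma k7_nonzero: "a \<noteq> 0 \<Longrightarrow> k7 X a b c \<noteq> 0"
  by (auto simp: k7_def vec_eq_iff intro!: exI[of _ "Inr (Inl 2)"])

lemma plc_k6:
  assumes "P *v X + a *s x = 0" "Q *v X + b *s y = 0" "(\<Sum>m\<in>UNIV. l $ m * (D *v X) $ m) = 0"
  shows "plc P Q D x y l *v k6 X a b = 0"
proof -
  have "(P *v X) $ i + a * x $ i = 0" "(Q *v X) $ i + b * y $ i = 0" for i
    using assms(1,2) by (simp_all add: vec_eq_iff)
  with assms(3) show ?thesis
    unfolding vec_eq_Plus forall_3
    by (simp add: plc_def k6_def matrix_vector_mult_def all_Plus forall_3 sum_UNIV_Plus sum_3 sum_4 algebra_simps)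
qed

lemma twoc_k6:
  assumes "P *v X + a *s x = 0" "Q *v X + b *s y = 0"
  shows "twoc P Q x y *v k6 X a b = 0"
proof -
  have "(P *v X) $ i + a * x $ i = 0" "(Q *v X) $ i + b * y $ i = 0" for i
    using assms(1,2) by (simp_all add: vec_eq_iff)
  then show ?thesis
    unfolding vec_eq_Plus forall_3
    by (simp add: twoc_def k6_def matrix_vector_mult_def sum_UNIV_Plus sum_3 sum_4 algebra_simps)
qed

lemma threec_k7:
  assumes "P *v X + a *s x = 0" "Q *v X + b *s y = 0" "D *v X + c *s z = 0"
  shows "threec P Q D x y z *v k7 X a b c = 0"
proof -
  have "(P *v X) $ i + a * x $ i = 0" "(Q *v X) $ i + b * y $ i = 0" "(D *v X) $ i + c * z $ i = 0" for i
    using assms by (simp_all add: vec_eq_iff)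
  then show ?thesis
    unfolding vec_eq_Plus forall_3
    by (simp add: threec_def k7_def matrix_vector_mult_def all_Plus forall_3 sum_UNIV_Plus sum_3 sum_4 algebra_simps)
qed

lemma lnm_incident: "(\<Sum>m\<in>UNIV. lnm C z $ m * (C *v (z 8 *s V4 z 0 + z 9 *s V4 z 4)) $ m) = 0"
  by (simp add: lnm_def matrix_vector_right_distrib vector_scalar_commute sum_3 algebra_simps)

text \<open>\<open>D\<close> is the matrix in normal coordinates as a function of the transformed
  image coordinates, in which the generators are written.\<close>

lemma minor_change:
  fixes M :: "mpoly^'c^'r" and R :: "complex^'r^'r" and K :: "complex^'c^'c" and r :: "'c \<Rightarrow> 'r"
  assumes "\<And>x y z. R ** (evm M (asg (x, y, z)) ** K) = D (F1 *v x) (F2 *v y) (F3 *v z)"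
    and "\<And>x y z. ev g (asg (x, y, z)) = a * det (\<chi> i. D x y z $ r i)"
  shows "subst (bsub F1 F2 F3) g \<in> ideal_gen (maxminors M)"
proof (rule minor_transfer)
  fix v
  obtain x y z where v: "v = asg (x, y, z)" using ex_asg by blast
  show "ev (subst (bsub F1 F2 F3) g) v = a * det (\<chi> i. (R ** (evm M v ** K)) $ r i)"
    unfolding v assms ev_subst_Es Es_bsub ..
qed

text \<open>An injective selection from all rows of a square matrix permutes them. So membership
  results for maximal minors also serve the single determinants among the generators.\<close>

lemma maxminors_square: "maxminors M \<subseteq> ideal_gen {det M}"
proof
  fix g assume "g \<in> maxminors M"
  then obtain r where r: "inj r" "g = det (\<chi> i. M $ r i)" by (auto simp: maxminors_def)
  have "bij r" using r(1) finite_UNIV_inj_surj[of r] by (simp add: bij_def)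
  then have "r permutes UNIV" by (simp add: permutes_univ bij_iff)
  then have "g = of_int (sign r) * det M" unfolding r(2) by (rule det_permute_rows)
  then show "g \<in> ideal_gen {det M}"
    using ideal_gen_base[of "det M" "{det M}"] is_ideal_ideal_gen[of "{det M}"] unfolding is_ideal_def by simp
qed

lemma det_in_maxminors: "det M \<in> maxminors M"
  unfolding maxminors_def by (intro CollectI exI[of _ id]) simp

lemma normal_cancel: "inverse_pair N N' \<Longrightarrow> A ** G = N ** K \<Longrightarrow> N' ** (A ** G) = K"
  unfolding inverse_pair_def by (metis matrix_mul_assoc matrix_mul_lid)

lemma emat_simps [simp]: "emat True N N' = N" "emat False N N' = transpose N'"
  by (simp_all add: emat_def)

lemma (in normal_cameras) ideal_PPL:
  shows "vanI (img True True False A B C) = ideal_gen (maxminors (pl_mat A B C Inl (Inr \<circ> Inl) (Inr \<circ> Inr)))"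
proof (rule ideal_gen_replace[OF img_chart(3)[OF chart_PPL flags_PPL coneI_PPL]])
  let ?M = "pl_mat A B C Inl (Inr \<circ> Inl) (Inr \<circ> Inr)"
  show "maxminors ?M \<subseteq> vanI (img True True False A B C)"
  proof (rule subsetI, rule vanI_imgI)
    fix g :: mpoly and s z :: "nat \<Rightarrow> complex" assume g: "g \<in> maxminors ?M" and s: "s 0 \<noteq> 0" "s 1 \<noteq> 0" "s 2 \<noteq> 0"
    let ?X = "z 8 *s V4 z 0 + z 9 *s V4 z 4"
    have "(\<Sum>m\<in>UNIV. (s 2 *s lnm C z) $ m * (C *v ?X) $ m) = s 2 * (\<Sum>m\<in>UNIV. lnm C z $ m * (C *v ?X) $ m)"
      by (simp add: sum_distrib_left mult_ac)
    \<comment> \<open>The image points are s0 and s1 times the projections of X, so the matching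
      scales are - 1 / s0 and - 1 / s1; the last row vanishes because X lies on its line.\<close>
    then have "plc A B C (s 0 *s ptm A z) (s 1 *s ptm B z) (s 2 *s lnm C z) *v k6 ?X (- 1 / s 0) (- 1 / s 1) = 0"
      using s unfolding lnm_incident by (intro plc_k6) (simp_all add: ptm_def vec_eq_iff)
    then show "ev g (asg (s 0 *s flm True A z, s 1 *s flm True B z, s 2 *s flm False C z)) = 0"
      using s by (intro maxminor_eq_0[OF g k6_nonzero[of "- 1 / s 0"]]) (simp_all add: evm_pl_mat flm_def)
  qed
  let ?\<tau> = "bsub (emat True N1i N1) (emat True N2i N2) (emat False N3i N3)"
  have tr: "R7 N1i N2i ** (evm ?M (asg (x, y, l)) ** K6 G) = plc A0 B0 C0 (N1i *v x) (N2i *v y) (transpose N3 *v l)" for x y l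
    unfolding evm_pl_mat plc_mult_K6 R7_mult_plc normal_cancel[OF N(1) K(1)] normal_cancel[OF N(2) K(2)] K(3) plc_line ..
  note mc = minor_change[of "R7 N1i N2i" ?M "K6 G" "plc A0 B0 C0", OF tr]
  show "subst ?\<tau> ` gens_PPL \<subseteq> ideal_gen (maxminors ?M)"
    unfolding gens_PPL_def image_insert image_empty insert_subset emat_simps
    by (intro conjI empty_subsetI)
      (rule mc[where a = "-1" and r = "sel6 (Inr (Inl 1)) (Inl 1) (Inl 2) (Inl 3) (Inr (Inl 2)) (Inr (Inl 3))"],
        simp only: minors_PPL, simp add: ev_hom,
       rule mc[where a = 1 and r = "sel6 (Inr (Inl 1)) (Inl 1) (Inl 2) (Inl 3) (Inr (Inl 2)) (Inr (Inr 1))"],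
        simp only: minors_PPL, simp add: ev_hom,
       rule mc[where a = 1 and r = "sel6 (Inr (Inl 1)) (Inl 1) (Inl 2) (Inl 3) (Inr (Inl 3)) (Inr (Inr 1))"],
        simp only: minors_PPL, simp add: ev_hom)
qed

lemma evm_two_mat_asg:
  "evm (two_mat P Q Inl (Inr \<circ> Inl)) (asg (x, y, z)) = twoc P Q x y"
  "evm (two_mat P Q Inl (Inr \<circ> Inr)) (asg (x, y, z)) = twoc P Q x z"
  "evm (two_mat P Q (Inr \<circ> Inl) (Inr \<circ> Inr)) (asg (x, y, z)) = twoc P Q y z"
  by (simp_all add: evm_two_mat comp_def vec_lambda_eta)

lemma (in normal_cameras) ideal_PPP:
  shows "vanI (img True True True A B C) = ideal_gen (maxminors (three_mat A B C) \<union>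
    {det (two_mat A B Inl (Inr \<circ> Inl)), det (two_mat A C Inl (Inr \<circ> Inr)), det (two_mat B C (Inr \<circ> Inl) (Inr \<circ> Inr))})"
    (is "_ = ideal_gen ?H")
proof (rule ideal_gen_replace[OF img_chart(3)[OF chart_PPP flags_PPP coneI_PPP]])
  show "?H \<subseteq> vanI (img True True True A B C)"
  proof (rule subsetI, rule vanI_imgI)
    fix g :: mpoly and s z :: "nat \<Rightarrow> complex" assume g: "g \<in> ?H" and s: "s 0 \<noteq> 0" "s 1 \<noteq> 0" "s 2 \<noteq> 0"
    let ?X = "z 8 *s V4 z 0 + z 9 *s V4 z 4"
    let ?v = "asg (s 0 *s ptm A z, s 1 *s ptm B z, s 2 *s ptm C z)"
    have X: "P *v ?X + (- 1 / t) *s (t *s ptm P z) = 0" if "t \<noteq> 0" for P and t :: complex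
      using that by (simp add: ptm_def vec_eq_iff)
    consider "g \<in> maxminors (three_mat A B C)" | "g = det (two_mat A B Inl (Inr \<circ> Inl))"
      | "g = det (two_mat A C Inl (Inr \<circ> Inr))" | "g = det (two_mat B C (Inr \<circ> Inl) (Inr \<circ> Inr))" using g by blast
    then have "ev g ?v = 0"
    proof cases
      case 1
      have "threec A B C (s 0 *s ptm A z) (s 1 *s ptm B z) (s 2 *s ptm C z) *v k7 ?X (- 1 / s 0) (- 1 / s 1) (- 1 / s 2) = 0"
        by (intro threec_k7 X s)
      then show ?thesis using s by (intro maxminor_eq_0[OF 1 k7_nonzero[of "- 1 / s 0"]]) (simp_all add: evm_three_mat)
    next
      case 2
      have "evm (two_mat A B Inl (Inr \<circ> Inl)) ?v *v k6 ?X (- 1 / s 0) (- 1 / s 1) = 0"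
        unfolding evm_two_mat_asg by (intro twoc_k6 X s)
      then show ?thesis unfolding 2 using s by (intro maxminor_eq_0[OF det_in_maxminors k6_nonzero[of "- 1 / s 0"]]) simp_all
    next
      case 3
      have "evm (two_mat A C Inl (Inr \<circ> Inr)) ?v *v k6 ?X (- 1 / s 0) (- 1 / s 2) = 0"
        unfolding evm_two_mat_asg by (intro twoc_k6 X s)
      then show ?thesis unfolding 3 using s by (intro maxminor_eq_0[OF det_in_maxminors k6_nonzero[of "- 1 / s 0"]]) simp_all
    next
      case 4
      have "evm (two_mat B C (Inr \<circ> Inl) (Inr \<circ> Inr)) ?v *v k6 ?X (- 1 / s 1) (- 1 / s 2) = 0"
        unfolding evm_two_mat_asg by (intro twoc_k6 X s)
      then show ?thesis unfolding 4 using s by (intro maxminor_eq_0[OF det_in_maxminors k6_nonzero[of "- 1 / s 1"]]) simp_all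
    qed
    then show "ev g (asg (s 0 *s flm True A z, s 1 *s flm True B z, s 2 *s flm True C z)) = 0" by (simp add: flm_def)
  qed
  let ?\<tau> = "bsub (emat True N1i N1) (emat True N2i N2) (emat True N3i N3)"
  have sub: "ideal_gen (maxminors (three_mat A B C)) \<subseteq> ideal_gen ?H"
    by (rule ideal_gen_least[OF is_ideal_ideal_gen]) (auto intro: ideal_gen_base)
  have sub2: "ideal_gen (maxminors M) \<subseteq> ideal_gen ?H" if "det M \<in> ?H" for M :: "mpoly^(3+3)^(3+3)"
  proof (rule ideal_gen_least[OF is_ideal_ideal_gen])
    have "ideal_gen {det M} \<subseteq> ideal_gen ?H"
      using that by (intro ideal_gen_least is_ideal_ideal_gen) (auto intro: ideal_gen_base)
    then show "maxminors M \<subseteq> ideal_gen ?H" using maxminors_square by blast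
  qed
  note cancel = normal_cancel[OF N(1) K(1)] normal_cancel[OF N(2) K(2)] normal_cancel[OF N(3) K(3)]
  have tr: "R6 N1i N2i ** (evm (two_mat A B Inl (Inr \<circ> Inl)) (asg (x, y, z)) ** K6 G) = twoc A0 B0 (N1i *v x) (N2i *v y)"
    "R6 N2i N3i ** (evm (two_mat B C (Inr \<circ> Inl) (Inr \<circ> Inr)) (asg (x, y, z)) ** K6 G) = twoc B0 C0 (N2i *v y) (N3i *v z)"
    "R6 N1i N3i ** (evm (two_mat A C Inl (Inr \<circ> Inr)) (asg (x, y, z)) ** K6 G) = twoc A0 C0 (N1i *v x) (N3i *v z)"
    "R9 N1i N2i N3i ** (evm (three_mat A B C) (asg (x, y, z)) ** K7 G) = threec A0 B0 C0 (N1i *v x) (N2i *v y) (N3i *v z)" for x y z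
    unfolding evm_two_mat_asg twoc_mult_K6 R6_mult_twoc evm_three_mat threec_mult_K7 R9_mult_threec cancel by (rule refl)+
  show "subst ?\<tau> ` gens_PPP \<subseteq> ideal_gen ?H"
    unfolding gens_PPP_def image_insert image_empty insert_subset emat_simps
    by (intro conjI empty_subsetI)
      (rule subsetD[OF sub2 minor_change[where D = "\<lambda>x y z. twoc A0 B0 x y" and a = "-1"
          and r = "sel6 (Inr 1) (Inl 1) (Inl 2) (Inl 3) (Inr 2) (Inr 3)", OF tr(1)]], simp, simp only: minors_two, simp add: ev_hom,
       rule subsetD[OF sub2 minor_change[where D = "\<lambda>x y z. twoc B0 C0 y z" and a = "-1"
          and r = "sel6 (Inl 1) (Inr 2) (Inl 2) (Inl 3) (Inr 1) (Inr 3)", OF tr(2)]], simp, simp only: minors_two, simp add: ev_hom,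
       rule subsetD[OF sub2 minor_change[where D = "\<lambda>x y z. twoc A0 C0 x z" and a = 1
          and r = "sel6 (Inr 1) (Inl 1) (Inl 2) (Inl 3) (Inr 2) (Inr 3)", OF tr(3)]], simp, simp only: minors_two, simp add: ev_hom,
       rule subsetD[OF sub minor_change[where D = "threec A0 B0 C0" and a = 1
          and r = "sel7 (Inr (Inl 1)) (Inl 1) (Inl 2) (Inl 3) (Inr (Inl 2)) (Inr (Inr 1)) (Inr (Inr 2))", OF tr(4)]],
        simp only: minor_PPP, simp add: ev_hom)
qed

definition lllc :: "complex^4^3 \<Rightarrow> complex^4^3 \<Rightarrow> complex^4^3 \<Rightarrow> complex^3 \<Rightarrow> complex^3 \<Rightarrow> complex^3 \<Rightarrow> complex^3^4" where
  "lllc A B C l l' l'' = transpose (vector [transpose A *v l, transpose B *v l', transpose C *v l''])"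

lemma evm_lll_mat: "evm (lll_mat A B C) (asg (l, l', l'')) = lllc A B C l l' l''"
  by (simp add: evm_def lll_mat_def lllc_def vec_eq_iff forall_3 transpose_def matrix_vector_mult_def ev_hom)

lemma transpose_mult_lllc: "transpose G ** lllc A B C l l' l'' = lllc (A ** G) (B ** G) (C ** G) l l' l''"
  by (simp add: lllc_def vec_eq_iff forall_3 transpose_def matrix_vector_mult_def matrix_matrix_mult_def sum_3 sum_4 algebra_simps)

lemma lllc_line: "lllc (N1 ** A) (N2 ** B) (N3 ** C) l l' l'' = lllc A B C (transpose N1 *v l) (transpose N2 *v l') (transpose N3 *v l'')"
  by (simp add: lllc_def matrix_transpose_mul matrix_vector_mul_assoc del: transpose_matrix_vector)

definition sel3 :: "'r \<Rightarrow> 'r \<Rightarrow> 'r \<Rightarrow> 3 \<Rightarrow> 'r" where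
  "sel3 r1 r2 r3 c = (if c = 1 then r1 else if c = 2 then r2 else r3)"

lemma (in normal_cameras) ideal_LLL:
  shows "vanI (img False False False A B C) = ideal_gen (maxminors (lll_mat A B C))"
proof (rule ideal_gen_replace[OF img_chart(3)[OF chart_LLL flags_LLL coneI_LLL]])
  let ?M = "lll_mat A B C"
  let ?\<sigma> = "bsub (emat False N1 N1i) (emat False N2 N2i) (emat False N3 N3i)"
  let ?\<tau> = "bsub (emat False N1i N1) (emat False N2i N2) (emat False N3i N3)"
  have cc: "coord_change ?\<sigma> ?\<tau> id" by (intro coord_change_bsub inverse_pair_emat N)
  have tr: "transpose G ** (evm ?M (asg (x, y, l))) = lllc A0 B0 C0 (transpose N1 *v x) (transpose N2 *v y) (transpose N3 *v l)" for x y l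
    unfolding evm_lll_mat transpose_mult_lllc K lllc_line ..
  \<comment> \<open>In the chart the linear dependency of the three planes is explicit, so vanishing
    is checked there instead of on flags.\<close>
  show "maxminors ?M \<subseteq> vanI (img False False False A B C)"
    unfolding img_chart(1)[OF chart_LLL flags_LLL coneI_LLL] 
  proof
    fix g assume g: "g \<in> maxminors ?M"
    have "ev g (Es ?\<sigma> (scl s (chart_LLL y))) = 0" for s y
    proof -
      obtain u v w where uvw: "scl s (chart_LLL y) = asg (u, v, w)" using ex_asg by blast
      have uvw': "u = s 0 *s vector [1, - y 2 * y 0, y 3 - y 2 * y 1]" "v = s 1 *s vector [1, y 0, y 1]" "w = s 2 *s vector [y 2, 1, y 3]"
        using arg_cong[OF uvw, of topt] unfolding chart_LLL_def mkv_def scl_asg topt_asg by simp_all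
      have "\<exists>k. k \<noteq> 0 \<and> lllc A0 B0 C0 u v w *v k = 0"
      \<comment> \<open>A zero scalar kills one column, and the corresponding unit vector lies in
        the kernel.\<close>
      proof (cases "s 0 = 0 \<or> s 1 = 0 \<or> s 2 = 0")
        case True
        then have "(axis 1 1 :: complex^3) \<noteq> 0 \<and> lllc A0 B0 C0 u v w *v axis 1 1 = 0 \<or> (axis 2 1 :: complex^3) \<noteq> 0 \<and> lllc A0 B0 C0 u v w *v axis 2 1 = 0
          \<or> (axis 3 1 :: complex^3) \<noteq> 0 \<and> lllc A0 B0 C0 u v w *v axis 3 1 = 0"
          by (auto simp: uvw' lllc_def vec_eq_iff matrix_vector_mult_def transpose_def sum_3 axis_def forall_4)
        then show ?thesis by blast
      next
        case False
        \<comment> \<open>The planes satisfy plane(l) + y2 plane(l') - plane(l'') = 0 before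
          scaling; the witness is this relation multiplied by s0 s1 s2.\<close>
        then show ?thesis
          by (intro exI[of _ "vector [s 1 * s 2, s 0 * s 2 * y 2, - s 0 * s 1]"])
            (simp add: uvw' lllc_def vec_eq_iff matrix_vector_mult_def transpose_def sum_3 forall_3 forall_4 algebra_simps)
      qed
      then obtain k where k: "k \<noteq> 0" "lllc A0 B0 C0 u v w *v k = 0" by blast
      define E where "E = evm ?M (asg (transpose N1i *v u, transpose N2i *v v, transpose N3i *v w))"
      have "transpose G ** E = lllc A0 B0 C0 u v w"
        unfolding E_def tr using N by (simp add: inverse_pair_vec[OF inverse_pair_sym[OF inverse_pair_transpose]] del: transpose_matrix_vector)
      then have "transpose G *v (E *v k) = 0" using k(2) by (simp add: matrix_vector_mul_assoc del: transpose_matrix_vector)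
      then have "transpose Gi *v (transpose G *v (E *v k)) = 0" by simp
      then have "E *v k = 0" using inverse_pair_vec[OF inverse_pair_transpose[OF G]] by metis
      then show ?thesis unfolding uvw Es_bsub emat_simps using maxminor_eq_0[OF g k(1)] unfolding E_def by blast
    qed
    then have "subst ?\<sigma> g \<in> coneI chart_LLL" by (simp add: coneI_def ev_subst_Es)
    then show "g \<in> coneI (\<lambda>y. Es ?\<sigma> (chart_LLL y))" unfolding coneI_coord_change[OF cc] .
  qed
  have tr1: "transpose G ** (evm ?M (asg (x, y, z)) ** mat 1) = lllc A0 B0 C0 (transpose N1 *v x) (transpose N2 *v y) (transpose N3 *v z)" for x y z
    unfolding matrix_mul_rid by (rule tr)
  note mc = minor_change[of "transpose G" ?M "mat 1" "lllc A0 B0 C0", OF tr1]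
  note d = lllc_def det_3 sel3_def transpose_def matrix_vector_mult_def sum_3 ev_hom algebra_simps
  show "subst ?\<tau> ` gens_LLL \<subseteq> ideal_gen (maxminors ?M)"
    unfolding gens_LLL_def image_insert image_empty insert_subset emat_simps
    by (intro conjI empty_subsetI)
      (rule mc[where a = "-1" and r = "sel3 2 3 4"], simp add: d, rule mc[where a = "-1" and r = "sel3 1 3 4"], simp add: d,
       rule mc[where a = 1 and r = "sel3 1 2 4"], simp add: d, rule mc[where a = 1 and r = "sel3 1 2 3"], simp add: d)
qed

section \<open>The trifocal tensor\<close>

lemma det_4:
  "det (A :: 'a::comm_ring_1^4^4) = A $ 1 $ 1 * A $ 2 $ 2 * A $ 3 $ 3 * A $ 4 $ 4
    - A $ 1 $ 1 * A $ 2 $ 2 * A $ 3 $ 4 * A $ 4 $ 3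
    - A $ 1 $ 1 * A $ 2 $ 3 * A $ 3 $ 2 * A $ 4 $ 4
    + A $ 1 $ 1 * A $ 2 $ 3 * A $ 3 $ 4 * A $ 4 $ 2
    + A $ 1 $ 1 * A $ 2 $ 4 * A $ 3 $ 2 * A $ 4 $ 3
    - A $ 1 $ 1 * A $ 2 $ 4 * A $ 3 $ 3 * A $ 4 $ 2
    - A $ 1 $ 2 * A $ 2 $ 1 * A $ 3 $ 3 * A $ 4 $ 4
    + A $ 1 $ 2 * A $ 2 $ 1 * A $ 3 $ 4 * A $ 4 $ 3
    + A $ 1 $ 2 * A $ 2 $ 3 * A $ 3 $ 1 * A $ 4 $ 4
    - A $ 1 $ 2 * A $ 2 $ 3 * A $ 3 $ 4 * A $ 4 $ 1
    - A $ 1 $ 2 * A $ 2 $ 4 * A $ 3 $ 1 * A $ 4 $ 3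
    + A $ 1 $ 2 * A $ 2 $ 4 * A $ 3 $ 3 * A $ 4 $ 1
    + A $ 1 $ 3 * A $ 2 $ 1 * A $ 3 $ 2 * A $ 4 $ 4
    - A $ 1 $ 3 * A $ 2 $ 1 * A $ 3 $ 4 * A $ 4 $ 2
    - A $ 1 $ 3 * A $ 2 $ 2 * A $ 3 $ 1 * A $ 4 $ 4
    + A $ 1 $ 3 * A $ 2 $ 2 * A $ 3 $ 4 * A $ 4 $ 1
    + A $ 1 $ 3 * A $ 2 $ 4 * A $ 3 $ 1 * A $ 4 $ 2
    - A $ 1 $ 3 * A $ 2 $ 4 * A $ 3 $ 2 * A $ 4 $ 1
    - A $ 1 $ 4 * A $ 2 $ 1 * A $ 3 $ 2 * A $ 4 $ 3
    + A $ 1 $ 4 * A $ 2 $ 1 * A $ 3 $ 3 * A $ 4 $ 2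
    + A $ 1 $ 4 * A $ 2 $ 2 * A $ 3 $ 1 * A $ 4 $ 3
    - A $ 1 $ 4 * A $ 2 $ 2 * A $ 3 $ 3 * A $ 4 $ 1
    - A $ 1 $ 4 * A $ 2 $ 3 * A $ 3 $ 1 * A $ 4 $ 2
    + A $ 1 $ 4 * A $ 2 $ 3 * A $ 3 $ 2 * A $ 4 $ 1"
proof -
  have f: "finite {2::4, 3, 4}" "1 \<notin> {2::4, 3, 4}" "finite {3::4, 4}" "2 \<notin> {3::4, 4}" "finite {4::4}" "3 \<notin> {4::4}"
    by auto
  show ?thesis
    unfolding det_def UNIV_4
    unfolding sum_over_permutations_insert[OF f(1,2)]
    unfolding sum_over_permutations_insert[OF f(3,4)]
    unfolding sum_over_permutations_insert[OF f(5,6)]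
    unfolding permutes_sing
    by (simp add: sign_swap_id permutation_swap_id permutation_compose sign_compose sign_id swap_id_eq algebra_simps)
qed

lemma det_vector_linear:
  fixes u w p q :: "complex^4" and B :: "complex^4^3"
  shows "det (vector [u, w, transpose B *v l, q] :: complex^4^4) = (\<Sum>j\<in>UNIV. l $ j * det (vector [u, w, B $ j, q] :: complex^4^4))"
    "det (vector [u, w, p, transpose B *v l] :: complex^4^4) = (\<Sum>j\<in>UNIV. l $ j * det (vector [u, w, p, B $ j] :: complex^4^4))"
  by (simp_all add: det_4 sum_3 transpose_def matrix_vector_mult_def algebra_simps del: transpose_matrix_vector)

lemma det_vector_mult:
  "det (vector [p, q, r, s] :: complex^4^4) * det G
    = det (vector [transpose G *v p, transpose G *v q, transpose G *v r, transpose G *v s] :: complex^4^4)"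
proof -
  have "(vector [p, q, r, s] :: complex^4^4) ** G = vector [transpose G *v p, transpose G *v q, transpose G *v r, transpose G *v s]"
    by (simp add: vec_eq_iff forall_4 matrix_matrix_mult_def matrix_vector_mult_def transpose_def sum_4 mult.commute del: transpose_matrix_vector)
  then show ?thesis by (metis det_mul)
qed

text \<open>The lines enter the trifocal tensor only through the planes \<open>p\<close> and
  \<open>q\<close> to which they back-project. In this form a base change \<open>G\<close> of space
  acts on the rows of every determinant and costs the single factor det G.\<close>

definition trif_form :: "complex^4^3 \<Rightarrow> complex^3 \<Rightarrow> complex^4 \<Rightarrow> complex^4 \<Rightarrow> complex" where
  "trif_form A x p q = x $ 1 * det (vector [A $ 2, A $ 3, p, q] :: complex^4^4) - x $ 2 * det (vector [A $ 1, A $ 3, p, q] :: complex^4^4)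
    + x $ 3 * det (vector [A $ 1, A $ 2, p, q] :: complex^4^4)"

lemma ev_trif_poly: "ev (trif_poly A B C) (asg (x, l, m)) = trif_form A x (transpose B *v l) (transpose C *v m)"
  by (simp add: trif_form_def det_vector_linear trif_poly_def ev_hom trifocal_def sum_3 algebra_simps del: transpose_matrix_vector)

lemma trif_form_std:
  "trif_form (N ** A0) (N *v u) (vector [v $ 1, 0, v $ 2, v $ 3]) (vector [w $ 1, w $ 2, 0, w $ 3])
    = - det N * (w $ 1 * v $ 2 * u $ 2 + w $ 1 * v $ 3 * u $ 3 - v $ 1 * w $ 2 * u $ 1 - v $ 1 * w $ 3 * u $ 3)"
  by (simp add: trif_form_def det_4 det_3 matrix_matrix_mult_def matrix_vector_mult_def sum_3 algebra_simps)

lemma trif_form_change: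
  assumes "A ** G = N1 ** A0" "B ** G = N2 ** B0" "C ** G = N3 ** C0"
  shows "trif_form A (N1 *v u) (transpose B *v l) (transpose C *v m) * det G
    = - det N1 * ev (pvar vc1 * pvar vb3 * pvar va3 + pvar vc1 * pvar vb4 * pvar va4 - pvar vb1 * pvar vc2 * pvar va2 - pvar vb1 * pvar vc4 * pvar va4)
        (asg (u, transpose N2 *v l, transpose N3 *v m))"
proof -
  have rows: "transpose G *v (A $ i) = (N1 ** A0) $ i" for i
    unfolding assms(1)[symmetric]
    by (simp add: vec_eq_iff matrix_matrix_mult_def matrix_vector_mult_def transpose_def mult.commute del: transpose_matrix_vector)
  have tB: "transpose G *v (transpose B *v l) = transpose (N2 ** B0) *v l" "transpose G *v (transpose C *v m) = transpose (N3 ** C0) *v m"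
    unfolding assms(2,3)[symmetric] by (simp_all add: matrix_transpose_mul matrix_vector_mul_assoc del: transpose_matrix_vector)
  have B0: "transpose (N2 ** B0) *v l = vector [(transpose N2 *v l) $ 1, 0, (transpose N2 *v l) $ 2, (transpose N2 *v l) $ 3]"
    "transpose (N3 ** C0) *v m = vector [(transpose N3 *v m) $ 1, (transpose N3 *v m) $ 2, 0, (transpose N3 *v m) $ 3]"
    by (simp_all add: vec_eq_iff forall_4 matrix_matrix_mult_def matrix_vector_mult_def transpose_def sum_3 del: transpose_matrix_vector)
  have ch: "trif_form A (N1 *v u) p q * det G = trif_form (N1 ** A0) (N1 *v u) (transpose G *v p) (transpose G *v q)" for p q
    unfolding trif_form_def distrib_right left_diff_distrib mult.assoc det_vector_mult rows ..
  show ?thesis unfolding ch tB B0 trif_form_std by (simp add: ev_hom del: transpose_matrix_vector)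
qed

text \<open>The trifocal form is the transported normal-form generator times the nonzero constant -
  det N1 / det G, so both generate the same ideal.\<close>

lemma (in normal_cameras) ideal_PLL:
  shows "vanI (img True False False A B C) = ideal_gen {trif_poly A B C}"
proof -
  let ?\<tau> = "bsub (emat True N1i N1) (emat False N2i N2) (emat False N3i N3)"
  define g where "g = pvar vc1 * pvar vb3 * pvar va3 + pvar vc1 * pvar vb4 * pvar va4 - pvar vb1 * pvar vc2 * pvar va2 - pvar vb1 * pvar vc4 * pvar va4"
  have gens: "gens_PLL = {g}" by (simp add: gens_PLL_def g_def)
  define a where "a = - det N1 / det G"
  have a: "a \<noteq> 0" using inverse_pair_det[OF G] inverse_pair_det[OF N(1)] by (simp add: a_def)
  have eq: "trif_poly A B C = pconst a * subst ?\<tau> g"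
  proof (rule ev_inject)
    fix f
    obtain x l m where f: "f = asg (x, l, m)" using ex_asg by blast
    have "ev (trif_poly A B C) f * det G = - det N1 * ev g (asg (N1i *v x, transpose N2 *v l, transpose N3 *v m))"
      using trif_form_change[OF K, of "N1i *v x" l m] unfolding f ev_trif_poly g_def inverse_pair_vec[OF N(1)] .
    then show "ev (trif_poly A B C) f = ev (pconst a * subst ?\<tau> g) f"
      using inverse_pair_det[OF G] by (simp add: f ev_hom ev_subst_Es Es_bsub a_def field_simps del: transpose_matrix_vector)
  qed
  have eq': "subst ?\<tau> g = pconst (1 / a) * trif_poly A B C"
    using a by (intro ev_inject) (simp add: eq ev_hom)
  have van: "vanI (img True False False A B C) = ideal_gen {subst ?\<tau> g}"
    using img_chart(3)[OF chart_PLL flags_PLL coneI_PLL] unfolding gens by simp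
  show ?thesis
  proof (rule ideal_gen_replace[OF van])
    have mult: "h * f \<in> ideal_gen {f}" for h f
      using ideal_gen_base[of f "{f}"] is_ideal_ideal_gen[of "{f}"] unfolding is_ideal_def by simp
    show "{trif_poly A B C} \<subseteq> vanI (img True False False A B C)" unfolding van eq using mult by simp
    show "{subst ?\<tau> g} \<subseteq> ideal_gen {trif_poly A B C}" unfolding eq' using mult by simp
  qed
qed

section \<open>Exchanging the second and third views\<close>

definition swp :: "var \<Rightarrow> mpoly" where
  "swp x = (case x of Inl i \<Rightarrow> pvar (Inl i) | Inr (Inl i) \<Rightarrow> pvar (Inr (Inr i)) | Inr (Inr i) \<Rightarrow> pvar (Inr (Inl i)))"

lemma Es_swp: "Es swp (asg (u, v, w)) = asg (u, w, v)"
  by (simp add: fun_eq_iff all_var Es_def swp_def ev_hom)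

lemma coord_change_swp: "coord_change swp swp (\<lambda>b. if b = 1 then 2 else if b = 2 then 1 else b)"
  unfolding coord_change_def
proof (intro conjI allI impI)
  fix f :: "var \<Rightarrow> complex"
  obtain u v w where f: "f = asg (u, v, w)" using ex_asg by blast
  show "Es swp (Es swp f) = f" "Es swp (Es swp f) = f" by (simp_all add: f Es_swp)
  show "scl s (Es swp f) = Es swp (scl (s \<circ> (\<lambda>b. if b = 1 then 2 else if b = 2 then 1 else b)) f)" for s
    by (simp add: f Es_swp scl_asg)
  show "valid_pt (topt (Es swp f))" if "valid_pt (topt f)" using that by (simp add: f Es_swp valid_pt_def)
qed auto

lemma maxminors_subst: "subst \<sigma> ` maxminors M = maxminors (\<chi> i j. subst \<sigma> (M $ i $ j))"
proof -
  have "subst \<sigma> (det (\<chi> i. M $ r i)) = det (\<chi> i. (\<chi> i j. subst \<sigma> (M $ i $ j)) $ r i)" for r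
    by (simp add: subst_det)
  then show ?thesis unfolding maxminors_def by (auto simp: image_iff) metis
qed

lemma pl_mat_swp:
  "(\<chi> i j. subst swp (pl_mat A C B Inl (Inr \<circ> Inl) (Inr \<circ> Inr) $ i $ j)) = pl_mat A C B Inl (Inr \<circ> Inr) (Inr \<circ> Inl)"
  by (auto simp: pl_mat_def vec_eq_iff subst_hom swp_def split: sum.split option.split)

lemma flags_PLP: "flags True False True A B C = (\<lambda>z. Es swp (flags True True False A C B z))"
  by (simp add: fun_eq_iff flags_def Es_swp)

lemma indep_centers_swap: "indep_centers A B C \<Longrightarrow> indep_centers A C B"
proof -
  assume "indep_centers A B C"
  then have "s = 0 \<and> t = 0 \<and> u = 0"
    if "a \<noteq> 0 \<and> b \<noteq> 0 \<and> c \<noteq> 0 \<and> A *v a = 0 \<and> C *v b = 0 \<and> B *v c = 0" "s *s a + t *s b + u *s c = 0" for a b c s t u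
  proof -
    have "s *s a + u *s c + t *s b = 0" using that(2) by (simp add: ac_simps)
    then show ?thesis using \<open>indep_centers A B C\<close> that(1) unfolding indep_centers_def by blast
  qed
  then show ?thesis unfolding indep_centers_def by blast
qed

theorem theorem3p2:
  fixes A B C :: "complex^4^3"
  assumes "camera A" and "camera B" and "camera C"
  shows "mp_irreducible (X_PLL A B C) \<and> mp_irreducible (X_LLL A B C) \<and>
         mp_irreducible (X_PPL A B C) \<and> mp_irreducible (X_PLP A B C) \<and>
         mp_irreducible (X_PPP A B C) \<and>
         (indep_centers A B C \<longrightarrow>
            (mp_dim (X_PLL A B C) = 5 \<and> vanI (X_PLL A B C) = ideal_gen {trif_poly A B C}) \<and>
            (mp_dim (X_LLL A B C) = 4 \<and> vanI (X_LLL A B C) = ideal_gen (maxminors (lll_mat A B C))) \<and>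
            (mp_dim (X_PPL A B C) = 4 \<and>
               vanI (X_PPL A B C) = ideal_gen (maxminors (pl_mat A B C Inl (Inr \<circ> Inl) (Inr \<circ> Inr)))) \<and>
            (mp_dim (X_PLP A B C) = 4 \<and>
               vanI (X_PLP A B C) = ideal_gen (maxminors (pl_mat A C B Inl (Inr \<circ> Inr) (Inr \<circ> Inl)))) \<and>
            (mp_dim (X_PPP A B C) = 3 \<and>
               vanI (X_PPP A B C) = ideal_gen (maxminors (three_mat A B C) \<union>
                  {det (two_mat A B Inl (Inr \<circ> Inl)), det (two_mat A C Inl (Inr \<circ> Inr)),
                   det (two_mat B C (Inr \<circ> Inl) (Inr \<circ> Inr))})))"
proof -
  note X_defs = X_PLL_def X_LLL_def X_PPL_def X_PLP_def X_PPP_def img_PLL_eq img_LLL_eq img_PPL_eq img_PLP_eq img_PPP_eq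
  note irr = mp_irreducible_img[OF assms]
  have num: "(5::enat) = enat 5" "(4::enat) = enat 4" "(3::enat) = enat 3" by (simp_all add: numeral_eq_enat)
  show ?thesis
    unfolding X_defs vanI_zclosure_img num
  proof (intro conjI impI irr)
    assume indep: "indep_centers A B C"
    obtain G Gi N1 N1i N2 N2i N3 N3i where G: "inverse_pair G Gi"
      and N: "inverse_pair N1 N1i" "inverse_pair N2 N2i" "inverse_pair N3 N3i"
      and K: "A ** G = N1 ** A0" "B ** G = N2 ** B0" "C ** G = N3 ** C0"
      using normal_form[OF assms indep] .
    interpret normal_cameras A B C G Gi N1 N1i N2 N2i N3 N3i by unfold_locales (fact assms G N K)+
    show "vanI (img True False False A B C) = ideal_gen {trif_poly A B C}" by (rule ideal_PLL)
    show "vanI (img False False False A B C) = ideal_gen (maxminors (lll_mat A B C))" by (rule ideal_LLL)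
    show "vanI (img True True False A B C) = ideal_gen (maxminors (pl_mat A B C Inl (Inr \<circ> Inl) (Inr \<circ> Inr)))"
      by (rule ideal_PPL)
    show "vanI (img True True True A B C) = ideal_gen (maxminors (three_mat A B C) \<union>
      {det (two_mat A B Inl (Inr \<circ> Inl)), det (two_mat A C Inl (Inr \<circ> Inr)), det (two_mat B C (Inr \<circ> Inl) (Inr \<circ> Inr))})"
      by (rule ideal_PPP)
    show "mp_dim (zclosure (img True False False A B C)) = enat 5"
      using img_chart(2,1)[OF chart_PLL flags_PLL coneI_PLL] by (rule mp_dim_chart)
    show "mp_dim (zclosure (img False False False A B C)) = enat 4"
      using img_chart(2,1)[OF chart_LLL flags_LLL coneI_LLL] by (rule mp_dim_chart)
    show "mp_dim (zclosure (img True True False A B C)) = enat 4"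
      using img_chart(2,1)[OF chart_PPL flags_PPL coneI_PPL] by (rule mp_dim_chart)
    show "mp_dim (zclosure (img True True True A B C)) = enat 3"
      using img_chart(2,1)[OF chart_PPP flags_PPP coneI_PPP] by (rule mp_dim_chart)
  next
    assume indep: "indep_centers A B C"
    \<comment> \<open>The normal form is taken for the cameras in the order A, C, B: for that order
      PLP becomes PPL, with the last two factors exchanged by \<open>swp\<close>.\<close>
    obtain G Gi N1 N1i N2 N2i N3 N3i where G: "inverse_pair G Gi"
      and N: "inverse_pair N1 N1i" "inverse_pair N2 N2i" "inverse_pair N3 N3i"
      and K: "A ** G = N1 ** A0" "C ** G = N2 ** B0" "B ** G = N3 ** C0"
      using normal_form[OF assms(1,3,2) indep_centers_swap[OF indep]] .
    interpret normal_cameras A C B G Gi N1 N1i N2 N2i N3 N3i by unfold_locales (fact assms G N K)+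
    have van: "vanI (img True False True A B C) = coneI (\<lambda>z. Es swp (flags True True False A C B z))"
      unfolding vanI_img[OF assms] flags_PLP ..
    have PPL: "coneI (flags True True False A C B) = vanI (img True True False A C B)"
      by (rule vanI_img[OF assms(1,3,2), symmetric])
    show "vanI (img True False True A B C) = ideal_gen (maxminors (pl_mat A C B Inl (Inr \<circ> Inr) (Inr \<circ> Inl)))"
      unfolding van using coneI_coord_change_ideal[OF coord_change_swp PPL[unfolded ideal_PPL]]
      unfolding maxminors_subst pl_mat_swp .
    note \<psi> = img_chart(1,2)[OF chart_PPL flags_PPL coneI_PPL]
    show "mp_dim (zclosure (img True False True A B C)) = enat 4"
      by (rule mp_dim_chart[OF chart_coord_change[OF coord_change_swp \<psi>(2)]])
        (simp only: van coneI_flags_chart[OF coord_change_swp PPL[unfolded \<psi>(1)]])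
  qed
qed

end
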